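(* Let $\mathcal C\subset \mathbb T^2$ be a smooth curve with nowhere-zero curvature. Then there exists a constant $C>0$, depending only on $\mathcal C$, such that for every $\lambda>0$ and every real-valued function $F$ on $\mathbb T^2$ with $-\Delta F=\lambda^2F$, $F\ne 0$, $$\|F\|_{L^4(\mathcal C)}\ \le\ C\,B_\lambda^{1/4}\,\|F\|_2 .$$
   Context: $\mathbb T^2=\mathbb R^2/2\pi\mathbb Z^2$ is the standard flat torus and $\Delta$ its Laplacian. The curve $\mathcal C$ is of finite positive length, with a smooth arc-length parameterization $\gamma:[0,L]\to\mathcal C$, and $\|F\|_{L^4(\mathcal C)}^4=\int_0^L|F(\gamma(t))|^4dt$. $\|F\|_2^2=\int_{\mathbb T^2}|F(x)|^2dx$. For $\lambda>0$, $\mathcal E_\lambda=\{\mu\in\mathbb Z^2:|\mu|=\lambda\}$ is the set of lattice points on the circle of radius $\lambda$, and $$B_\lambda=\max_{x\in\mathbb R^2,\ |x|=\lambda}\#\{\xi\in\mathcal E_\lambda: |x-\xi|\le\sqrt\lambda\}.$$ *)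

theory Defs
  imports "HOL-Analysis.Analysis"
begin

text \<open>Functions on the torus \<open>\<real>\<^sup>2 / 2\<pi>\<int>\<^sup>2\<close> are represented by functions on the plane that are
  periodic with respect to \<open>2\<pi>\<int>\<^sup>2\<close>, and curves in the torus by their lifts to the plane.\<close>

definition int_lattice :: "(real^2) set" where
  "int_lattice = {\<mu>. \<forall>i. \<mu> $ i \<in> \<int>}"

definition on_torus :: "(real^2 \<Rightarrow> 'a) \<Rightarrow> bool" where
  "on_torus F \<longleftrightarrow> (\<forall>x. \<forall>\<mu>\<in>int_lattice. F (x + (2 * pi) *\<^sub>R \<mu>) = F x)"

definition torus_cell :: "(real^2) set" where
  "torus_cell = cbox 0 (\<chi> i. 2 * pi)"

definition partial_deriv :: "2 \<Rightarrow> (real^2 \<Rightarrow> real) \<Rightarrow> real^2 \<Rightarrow> real" where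
  "partial_deriv i F x = frechet_derivative F (at x) (axis i 1)"

definition C1_fun :: "(real^2 \<Rightarrow> real) \<Rightarrow> bool" where
  "C1_fun F \<longleftrightarrow> F differentiable_on UNIV \<and> (\<forall>i. continuous_on UNIV (partial_deriv i F))"

definition C2_fun :: "(real^2 \<Rightarrow> real) \<Rightarrow> bool" where
  "C2_fun F \<longleftrightarrow> C1_fun F \<and> (\<forall>i. C1_fun (partial_deriv i F))"

definition laplacian :: "(real^2 \<Rightarrow> real) \<Rightarrow> real^2 \<Rightarrow> real" where
  "laplacian F x = (\<Sum>i\<in>UNIV. partial_deriv i (partial_deriv i F) x)"

text \<open>The regularity \<open>C\<^sup>2\<close> is what the equation needs in the classical sense.\<close>

definition torus_eigenfunction :: "real \<Rightarrow> (real^2 \<Rightarrow> real) \<Rightarrow> bool" where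
  "torus_eigenfunction lam F \<longleftrightarrow>
     on_torus F \<and> C2_fun F \<and> (\<forall>x. - laplacian F x = lam\<^sup>2 * F x) \<and> F \<noteq> (\<lambda>x. 0)"

definition torus_L2_norm :: "(real^2 \<Rightarrow> real) \<Rightarrow> real" where
  "torus_L2_norm F = sqrt (integral torus_cell (\<lambda>x. \<bar>F x\<bar>\<^sup>2))"

text \<open>All derivatives of a curve on \<open>[0, L]\<close> are taken within \<open>[0, L]\<close>, hence one-sided at the
  end points; values outside \<open>[0, L]\<close> are irrelevant.\<close>

primrec curve_deriv :: "real \<Rightarrow> nat \<Rightarrow> (real \<Rightarrow> real^2) \<Rightarrow> real \<Rightarrow> real^2" where
  "curve_deriv L 0 \<gamma> = \<gamma>"
| "curve_deriv L (Suc n) \<gamma> = (\<lambda>t. vector_derivative (curve_deriv L n \<gamma>) (at t within {0..L}))"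

definition smooth_curve :: "real \<Rightarrow> (real \<Rightarrow> real^2) \<Rightarrow> bool" where
  "smooth_curve L \<gamma> \<longleftrightarrow> (\<forall>n. curve_deriv L n \<gamma> differentiable_on {0..L})"

definition arclength_param :: "real \<Rightarrow> (real \<Rightarrow> real^2) \<Rightarrow> bool" where
  "arclength_param L \<gamma> \<longleftrightarrow>
     0 < L \<and> smooth_curve L \<gamma> \<and> (\<forall>t\<in>{0..L}. norm (curve_deriv L 1 \<gamma> t) = 1)"

text \<open>This is the curvature only for curves parameterized by arc length.\<close>

definition curvature :: "real \<Rightarrow> (real \<Rightarrow> real^2) \<Rightarrow> real \<Rightarrow> real" where
  "curvature L \<gamma> t = norm (curve_deriv L 2 \<gamma> t)"

definition curve_L4_norm :: "real \<Rightarrow> (real \<Rightarrow> real^2) \<Rightarrow> (real^2 \<Rightarrow> real) \<Rightarrow> real" where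
  "curve_L4_norm L \<gamma> F = (integral {0..L} (\<lambda>t. \<bar>F (\<gamma> t)\<bar> ^ 4)) powr (1/4)"

definition lattice_circle :: "real \<Rightarrow> (real^2) set" where
  "lattice_circle lam = {\<mu> \<in> int_lattice. norm \<mu> = lam}"

definition B_max :: "real \<Rightarrow> nat" where
  "B_max lam = Max {card {\<xi> \<in> lattice_circle lam. norm (x - \<xi>) \<le> sqrt lam} | x. norm x = lam}"

end

theory Submission
  imports Defs
begin

text \<open>
  On the circle of radius \<open>\<lambda>\<close> write \<open>E\<close> for the set of lattice points. An eigenfunction is a finite sum
  \<open>F = \<Sum> a\<^sub>\<mu> e(\<mu> \<bullet> x)\<close> over \<open>\<mu> \<in> E\<close>, with \<open>\<parallel>F\<parallel>\<^sup>2 = 4\<pi>\<^sup>2 \<Sum> |a\<^sub>\<mu>|\<^sup>2\<close>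
  (\<open>eigenfunction_expansion\<close>). Since \<open>F\<close> is real, its fourth power along the curve is the sum over
  quadruples of \<open>a a a a\<close> times the Fourier transform of arc length at \<open>w = x\<^sub>1 + x\<^sub>2 + x\<^sub>3 + x\<^sub>4\<close>, and
  curvature makes that transform \<open>O(|w|\<^sup>-\<^sup>1\<^sup>/\<^sup>2)\<close> (\<open>curve_Fourier_kernel_bound\<close>). What remains is a
  weighted count of quadruples of lattice points with a short sum (\<open>quadruple_sum_bound\<close>).

  Quadruples with \<open>|w|\<close> above a small multiple of \<open>\<lambda>\<^sup>1\<^sup>/\<^sup>3\<close> are harmless, because
  \<open>|E| = O(\<lambda>\<^sup>\<epsilon>)\<close> by the divisor bound, and any fixed power of \<open>\<lambda>\<close> wins (\<open>far_sum_bound\<close>).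

  For the others there are two geometric facts. First, a disc of radius a small multiple of
  \<open>\<lambda>\<^sup>1\<^sup>/\<^sup>3\<close> holds at most two points of \<open>E\<close>, since a lattice triangle has area at least \<open>1/2\<close> while its
  area is the product of its sides divided by \<open>4\<lambda>\<close>; so \<open>x\<^sub>4\<close> is nearly determined by the
  other three points. Second, four points on the circle satisfy
  \<open>|x\<^sub>1 + x\<^sub>2| |x\<^sub>1 + x\<^sub>3| |x\<^sub>1 + x\<^sub>4| \<le> 2 \<lambda>\<^sup>2 |w|\<close>: the four points of a quadruple with
  zero sum form two antipodal pairs, and this is the stable form of that statement.
  Order the three gaps as \<open>D\<^sub>1 \<le> D\<^sub>2 \<le> D\<^sub>3\<close>. Then \<open>D\<^sub>3\<close> is comparable to \<open>\<lambda>\<close>, hence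
  \<open>|w| \<ge> c D\<^sub>1 D\<^sub>2 / \<lambda>\<close>.

  The decisive choice is to run Schur's test with the \<^emph>\<open>middle\<close> gap fixed: the pair
  \<open>(x\<^sub>1, x\<^sub>3)\<close>, whose gap is \<open>D\<^sub>2\<close>, indexes the rows and \<open>(x\<^sub>2, x\<^sub>4)\<close> the columns. A row sum is
  then a sum over \<open>x\<^sub>2\<close> at distance \<open>D\<^sub>1 \<le> D\<^sub>2\<close> from \<open>-x\<^sub>1\<close> of \<open>(D\<^sub>1 D\<^sub>2 / \<lambda>)\<^sup>-\<^sup>1\<^sup>/\<^sup>2\<close>. Arcs of
  length \<open>\<surd>\<lambda>\<close> hold at most \<open>B\<close> points each, so with \<open>D\<^sub>2 = s \<surd>\<lambda>\<close> the row sum is at most a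
  constant times \<open>B (1 + \<Sum> min 1 ((j s)\<^sup>-\<^sup>1\<^sup>/\<^sup>2))\<close> over \<open>1 \<le> j \<le> 2s + 2\<close>, and this is \<open>O(B)\<close> uniformly
  in \<open>s\<close> (\<open>arc_sum_bound\<close>). With the smallest gap fixed instead, \<open>j\<close> would range over \<open>j \<ge> s\<close>, and the
  same sum would grow with \<open>\<lambda>\<close>.
\<close>

section \<open>Decay of the Fourier transform of a curved arc\<close>

lemma smooth_curve_has_deriv:
  assumes "smooth_curve L \<gamma>" "t \<in> {0..L}"
  shows "(curve_deriv L n \<gamma> has_vector_derivative curve_deriv L (Suc n) \<gamma> t) (at t within {0..L})"
proof -
  have "curve_deriv L n \<gamma> differentiable (at t within {0..L})"
    using assms unfolding smooth_curve_def differentiable_on_def by blast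
  then show ?thesis by (simp add: vector_derivative_works)
qed

lemma smooth_curve_continuous:
  assumes "smooth_curve L \<gamma>"
  shows "continuous_on {0..L} (curve_deriv L n \<gamma>)"
  using assms unfolding smooth_curve_def by (auto intro: differentiable_imp_continuous_on)

lemma smooth_curve_bounded:
  assumes "smooth_curve L \<gamma>"
  shows "\<exists>M>0. \<forall>t\<in>{0..L}. norm (curve_deriv L n \<gamma> t) \<le> M"
proof -
  have "bounded (curve_deriv L n \<gamma> ` {0..L})"
    by (intro compact_imp_bounded compact_continuous_image smooth_curve_continuous assms) auto
  then show ?thesis unfolding bounded_pos by auto
qed

text \<open>
  The tangent and the normal of an arc-length curve form an orthogonal frame, so the component of a
  vector along the normal is what its component along the tangent leaves over. This is how
  non-vanishing curvature enters: where the phase is stationary its second derivative is large.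
\<close>

lemma orthogonal_frame_real2:
  fixes p q x :: "real^2"
  assumes "norm p = 1" "p \<bullet> q = 0"
  shows "(x \<bullet> q)\<^sup>2 = (norm q)\<^sup>2 * ((norm x)\<^sup>2 - (x \<bullet> p)\<^sup>2)"
proof -
  have 1: "p$1 * p$1 + p$2 * p$2 = 1"
    using assms(1) by (simp add: norm_eq_1 inner_vec_def sum_2)
  have 2: "p$1 * q$1 + p$2 * q$2 = 0"
    using assms(2) by (simp add: inner_vec_def sum_2)
  have "(x$1 * q$1 + x$2*q$2)^2 = (q$1*q$1 + q$2*q$2) * ((x$1*x$1+x$2*x$2) - (x$1*p$1+x$2*p$2)^2)"
    using 1 2 by algebra
  then show ?thesis
    by (simp add: power2_norm_eq_inner inner_vec_def sum_2)
qed

lemma arclength_orthogonal: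
  assumes "arclength_param L \<gamma>" "t \<in> {0..L}"
  shows "curve_deriv L 1 \<gamma> t \<bullet> curve_deriv L 2 \<gamma> t = 0"
proof -
  have L: "0 < L" and sm: "smooth_curve L \<gamma>"
    and n1: "\<And>t. t\<in>{0..L} \<Longrightarrow> norm (curve_deriv L 1 \<gamma> t) = 1"
    using assms(1) by (auto simp: arclength_param_def)
  let ?g = "curve_deriv L 1 \<gamma>"
  have d: "(?g has_vector_derivative curve_deriv L 2 \<gamma> t) (at t within {0..L})"
    using smooth_curve_has_deriv[OF sm assms(2), of 1] by (simp add: numeral_2_eq_2)
  have "((\<lambda>t. ?g t \<bullet> ?g t) has_vector_derivative
     (?g t \<bullet> curve_deriv L 2 \<gamma> t + curve_deriv L 2 \<gamma> t \<bullet> ?g t)) (at t within {0..L})"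
    by (rule bounded_bilinear.has_vector_derivative[OF bounded_bilinear_inner d d])
  then have "((\<lambda>t. 1::real) has_vector_derivative
     (?g t \<bullet> curve_deriv L 2 \<gamma> t + curve_deriv L 2 \<gamma> t \<bullet> ?g t)) (at t within {0..L})"
    by (rule has_vector_derivative_transform[OF assms(2), rotated])
       (use n1 in \<open>simp add: norm_eq_1\<close>)
  moreover have "((\<lambda>t. 1::real) has_vector_derivative 0) (at t within {0..L})"
    by simp
  ultimately have "?g t \<bullet> curve_deriv L 2 \<gamma> t + curve_deriv L 2 \<gamma> t \<bullet> ?g t = 0"
    using vector_derivative_unique_within_closed_interval[of 0 L t] L assms(2)
    by (metis box_real(2))
  then show ?thesis by (simp add: inner_commute)
qed

lemma has_vector_derivative_inner_right:
  assumes "(f has_vector_derivative f') (at t within S)"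
  shows "((\<lambda>t. x \<bullet> f t) has_real_derivative x \<bullet> f') (at t within S)"
  unfolding has_real_derivative_iff_has_vector_derivative
  by (rule bounded_linear.has_vector_derivative[OF bounded_linear_inner_right assms])

text \<open>
  The hypothesis makes \<open>u\<close> move fast near its zeros, so the integrand is concentrated on a set of measure
  \<open>O(1/\<surd>X)\<close>. In an elementary proof one would cut \<open>[0, L]\<close> into pieces on which \<open>u\<close> is monotone or
  bounded away from \<open>0\<close>. The cutting is avoided by the auxiliary function
  \<open>arctan (\<surd>X u) / \<surd>X \<sqdot> u'\<close>: it is \<open>O(1/\<surd>X)\<close>, and its derivative is \<open>u'\<^sup>2 / (1 + X u\<^sup>2)\<close> up to
  \<open>O(1/\<surd>X)\<close>.
\<close>

lemma integral_majorant_bound: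
  fixes u u1 u2 :: "real \<Rightarrow> real"
  assumes L: "0 < L" and X: "1 \<le> X" and k: "0 < k"
    and du: "\<And>t. t \<in> {0..L} \<Longrightarrow> (u has_real_derivative u1 t) (at t within {0..L})"
    and du1: "\<And>t. t \<in> {0..L} \<Longrightarrow> (u1 has_real_derivative u2 t) (at t within {0..L})"
    and b1: "\<And>t. t \<in> {0..L} \<Longrightarrow> \<bar>u1 t\<bar> \<le> M"
    and b2: "\<And>t. t \<in> {0..L} \<Longrightarrow> \<bar>u2 t\<bar> \<le> M"
    and low: "\<And>t. t \<in> {0..L} \<Longrightarrow> k * (1 - (u t)\<^sup>2) \<le> (u1 t)\<^sup>2"
  shows "integral {0..L} (\<lambda>t. 1 / (1 + X * (u t)\<^sup>2)) \<le> ((4 * M + 2 * M * L) / k + L) / sqrt X"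
proof -
  define h where "h t = 1 / (1 + X * (u t)\<^sup>2)" for t
  \<comment> \<open>In the derivative of \<open>P\<close> the factor \<open>\<surd>X\<close> of the inner derivative cancels, which leaves \<open>u1\<^sup>2 h\<close>.\<close>
  define P where "P t = arctan (sqrt X * u t) / sqrt X * u1 t" for t
  define P' where "P' t = (u1 t)\<^sup>2 * h t + arctan (sqrt X * u t) / sqrt X * u2 t" for t
  have sX: "0 < sqrt X" "sqrt X * sqrt X = X" using X by auto
  have pos: "0 < 1 + X * (u t)\<^sup>2" for t
    using X by (smt (verit) mult_nonneg_nonneg zero_le_power2)
  have uc: "continuous_on {0..L} u"
    using du by (meson DERIV_continuous continuous_on_eq_continuous_within)
  have hc: "continuous_on {0..L} h"
    unfolding h_def using pos by (intro continuous_intros uc) (metis less_irrefl)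
  have hi: "h integrable_on {0..L}"
    using hc by (rule integrable_continuous_real)
  have at: "\<bar>arctan y\<bar> \<le> 2" for y
    using arctan_bounded[of y] pi_less_4 by (auto simp: abs_if)
  have M0: "0 \<le> M" using b1[of 0] L by auto
  have dP: "(P has_real_derivative P' t) (at t within {0..L})" if "t \<in> {0..L}" for t
  proof -
    have "((\<lambda>t. arctan (sqrt X * u t)) has_real_derivative
        inverse (1 + (sqrt X * u t)\<^sup>2) * (sqrt X * u1 t)) (at t within {0..L})"
      by (rule DERIV_chain2[OF DERIV_arctan DERIV_cmult[OF du[OF that]]])
    from DERIV_mult[OF DERIV_cdivide[OF this, of "sqrt X"] du1[OF that]] show ?thesis
      unfolding P_def
      by (rule DERIV_cong)
         (use sX in \<open>simp add: P'_def h_def power_mult_distrib power2_eq_square divide_inverse\<close>)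
  qed
  have P'i: "(P' has_integral (P L - P 0)) {0..L}"
    by (rule fundamental_theorem_of_calculus)
       (use L dP in \<open>auto simp: has_real_derivative_iff_has_vector_derivative\<close>)
  have pt: "k * h t \<le> P' t + (2 * M + k) / sqrt X" if "t \<in> {0..L}" for t
  proof -
    have "(u t)\<^sup>2 * h t \<le> 1 / X"
      unfolding h_def using pos[of t] X by (simp add: field_simps)
    also have "\<dots> \<le> 1 / sqrt X"
      using X sX by (intro divide_left_mono) (auto simp: real_le_lsqrt sqrt_le_D power2_eq_square
        intro: real_le_lsqrt)
    finally have a: "(u t)\<^sup>2 * h t \<le> 1 / sqrt X" .
    have h0: "0 \<le> h t" unfolding h_def using pos[of t] by simp
    have "\<bar>arctan (sqrt X * u t) / sqrt X * u2 t\<bar> \<le> 2 / sqrt X * M"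
      unfolding abs_mult abs_divide using at[of "sqrt X * u t"] b2[OF that] sX M0
      by (intro mult_mono divide_mono) auto
    then have b: "arctan (sqrt X * u t) / sqrt X * u2 t \<ge> - (2 * M / sqrt X)"
      by (simp only: abs_le_iff) (simp add: mult.commute)
    have "k * h t = k * (1 - (u t)\<^sup>2) * h t + k * ((u t)\<^sup>2 * h t)"
      by (simp add: algebra_simps)
    also have "\<dots> \<le> (u1 t)\<^sup>2 * h t + k * (1 / sqrt X)"
      using low[OF that] h0 a k by (intro add_mono mult_right_mono mult_left_mono) auto
    finally show ?thesis using b unfolding P'_def by (simp add: add_divide_distrib)
  qed
  have bP: "\<bar>P t\<bar> \<le> 2 * M / sqrt X" if "t \<in> {0..L}" for t
  proof -
    have "\<bar>P t\<bar> \<le> 2 / sqrt X * M"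
      unfolding P_def abs_mult abs_divide using at[of "sqrt X * u t"] b1[OF that] sX M0
      by (intro mult_mono divide_mono) auto
    then show ?thesis by simp
  qed
  have "integral {0..L} (\<lambda>t. k * h t) \<le> integral {0..L} (\<lambda>t. P' t + (2 * M + k) / sqrt X)"
    using pt hi P'i by (intro integral_le integrable_add integrable_on_mult_right) auto
  also have "\<dots> = P L - P 0 + L * ((2 * M + k) / sqrt X)"
    using P'i L by (subst integral_add) (auto simp: has_integral_integrable integral_unique[OF P'i])
  also have "\<dots> \<le> 4 * M / sqrt X + L * ((2 * M + k) / sqrt X)"
    using bP[of 0] bP[of L] L by (simp add: abs_le_iff)
  finally have "k * integral {0..L} h \<le> (4 * M + 2 * M * L + k * L) / sqrt X"
    by (simp add: algebra_simps add_divide_distrib)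
  then have "integral {0..L} h \<le> (4 * M + 2 * M * L + k * L) / sqrt X / k"
    using k by (simp only: pos_le_divide_eq mult.commute)
  also have "\<dots> = ((4 * M + 2 * M * L) / k + L) / sqrt X"
    using k sX by (simp add: field_simps)
  finally show ?thesis unfolding h_def .
qed

text \<open>
  A single integration by parts that serves stationary and non-stationary points at once. The usual
  amplitude \<open>1/\<phi>'\<close> is replaced by \<open>\<phi>' / (\<phi>'\<^sup>2 + X)\<close>, which has no singularity; with \<open>\<phi>' = X u\<close> it equals
  \<open>p = u / (1 + X u\<^sup>2)\<close>. The price is the term \<open>1 / (1 + X u\<^sup>2)\<close>, which is integrated by the previous
  lemma, and \<open>p'\<close> is bounded by a multiple of the same function.
\<close>

lemma oscillatory_integral_bound:
  fixes u u1 u2 \<phi> :: "real \<Rightarrow> real"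
  assumes L: "0 < L" and X: "1 \<le> X" and k: "0 < k"
    and d\<phi>: "\<And>t. t \<in> {0..L} \<Longrightarrow> (\<phi> has_real_derivative X * u t) (at t within {0..L})"
    and du: "\<And>t. t \<in> {0..L} \<Longrightarrow> (u has_real_derivative u1 t) (at t within {0..L})"
    and du1: "\<And>t. t \<in> {0..L} \<Longrightarrow> (u1 has_real_derivative u2 t) (at t within {0..L})"
    and b1: "\<And>t. t \<in> {0..L} \<Longrightarrow> \<bar>u1 t\<bar> \<le> M"
    and b2: "\<And>t. t \<in> {0..L} \<Longrightarrow> \<bar>u2 t\<bar> \<le> M"
    and low: "\<And>t. t \<in> {0..L} \<Longrightarrow> k * (1 - (u t)\<^sup>2) \<le> (u1 t)\<^sup>2"
  shows "norm (integral {0..L} (\<lambda>t. cis (\<phi> t)))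
     \<le> (2 + (1 + M) * ((4 * M + 2 * M * L) / k + L)) / sqrt X"
proof -
  define h where "h t = 1 / (1 + X * (u t)\<^sup>2)" for t
  define p where "p t = u t * h t" for t
  define p' where "p' t = u1 t * (1 - X * (u t)\<^sup>2) * (h t)\<^sup>2" for t
  define W where "W t = cis (\<phi> t) * of_real (p t)" for t
  define W' where "W' t = \<i> * of_real (X * u t * p t) * cis (\<phi> t) + cis (\<phi> t) * of_real (p' t)" for t
  have sX: "0 < sqrt X" "sqrt X * sqrt X = X" using X by auto
  have pos: "0 < 1 + X * (u t)\<^sup>2" for t
    using X by (smt (verit) mult_nonneg_nonneg zero_le_power2)
  have M0: "0 \<le> M" using b1[of 0] L by auto
  have uc: "continuous_on {0..L} u"
    using du by (meson DERIV_continuous continuous_on_eq_continuous_within)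
  have u1c: "continuous_on {0..L} u1"
    using du1 by (meson DERIV_continuous continuous_on_eq_continuous_within)
  have \<phi>c: "continuous_on {0..L} \<phi>"
    using d\<phi> by (meson DERIV_continuous continuous_on_eq_continuous_within)
  have hc: "continuous_on {0..L} h"
    unfolding h_def using pos by (intro continuous_intros uc) (metis less_irrefl)
  have hi: "h integrable_on {0..L}"
    using hc by (rule integrable_continuous_real)
  have h0: "0 \<le> h t" for t unfolding h_def using pos[of t] by simp
  have dp: "(p has_real_derivative p' t) (at t within {0..L})" if "t \<in> {0..L}" for t
  proof -
    have "(h has_real_derivative - (X * (2 * u t * u1 t)) * (h t)\<^sup>2) (at t within {0..L})"
      unfolding h_def
      by (rule derivative_eq_intros du[OF that] refl)+
         (use pos[of t] in \<open>auto simp: divide_inverse power2_eq_square\<close>)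
    from DERIV_mult[OF du[OF that] this] show ?thesis
      unfolding p_def
    proof (rule DERIV_cong)
      have "h t = (1 + X * (u t)\<^sup>2) * (h t)\<^sup>2"
        using pos[of t] by (simp add: h_def power2_eq_square)
      then have "u1 t * h t = u1 t * ((1 + X * (u t)\<^sup>2) * (h t)\<^sup>2)" by simp
      then show "u1 t * h t + - (X * (2 * u t * u1 t)) * (h t)\<^sup>2 * u t = p' t"
        by (simp add: p'_def algebra_simps power2_eq_square)
    qed
  qed
  have dc: "((\<lambda>t. cis (\<phi> t)) has_vector_derivative \<i> * of_real (X * u t) * cis (\<phi> t))
      (at t within {0..L})" if "t \<in> {0..L}" for t
  proof -
    have "((\<lambda>t. \<i> * of_real (\<phi> t)) has_vector_derivative \<i> * of_real (X * u t)) (at t within {0..L})"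
      by (intro has_vector_derivative_mult_right has_vector_derivative_of_real d\<phi> that)
    from field_vector_diff_chain_within[OF this DERIV_subset[OF DERIV_exp subset_UNIV]]
    show ?thesis by (simp add: o_def cis_conv_exp)
  qed
  have dW: "(W has_vector_derivative W' t) (at t within {0..L})" if "t \<in> {0..L}" for t
    unfolding W_def W'_def
    using has_vector_derivative_mult[OF dc[OF that]
       has_vector_derivative_of_real[OF dp[OF that]]]
    by (simp add: algebra_simps)
  have W'i: "(W' has_integral (W L - W 0)) {0..L}"
    by (rule fundamental_theorem_of_calculus) (use L dW in auto)
  have idn: "1 - X * u t * p t = h t" for t
    using pos[of t] by (simp add: p_def h_def field_simps power2_eq_square)
  \<comment> \<open>The part \<open>\<i> X u p cis \<phi>\<close> of \<open>W'\<close> reproduces the integrand up to \<open>h\<close>, since \<open>1 - X u p = h\<close>.\<close>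
  have eq: "cis (\<phi> t) + \<i> * W' t = cis (\<phi> t) * (of_real (h t) + \<i> * of_real (p' t))" for t
  proof -
    have "cis (\<phi> t) + \<i> * W' t = cis (\<phi> t) * (of_real (1 - X * u t * p t) + \<i> * of_real (p' t))"
      unfolding W'_def by (simp add: algebra_simps)
    then show ?thesis by (simp only: idn)
  qed
  have ci: "(\<lambda>t. cis (\<phi> t)) integrable_on {0..L}"
    unfolding cis_conv_exp by (intro integrable_continuous_real continuous_intros \<phi>c)
  have p'b: "\<bar>p' t\<bar> \<le> M * h t" if "t \<in> {0..L}" for t
  proof -
    have "0 \<le> X * (u t)\<^sup>2" using X by simp
    then have "\<bar>1 - X * (u t)\<^sup>2\<bar> \<le> 1 + X * (u t)\<^sup>2" by (auto simp: abs_le_iff)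
    then have "\<bar>1 - X * (u t)\<^sup>2\<bar> * (h t)\<^sup>2 \<le> (1 + X * (u t)\<^sup>2) * (h t)\<^sup>2"
      by (rule mult_right_mono) simp
    also have "\<dots> = h t" using pos[of t] unfolding h_def by (simp add: power2_eq_square)
    finally have "\<bar>u1 t\<bar> * (\<bar>1 - X * (u t)\<^sup>2\<bar> * (h t)\<^sup>2) \<le> M * h t"
      using b1[OF that] M0 by (intro mult_mono) auto
    then show ?thesis by (simp add: p'_def abs_mult mult.assoc)
  qed
  have Wb: "norm (W t) \<le> 1 / sqrt X" for t
  proof -
    have "0 \<le> (sqrt X * \<bar>u t\<bar> - 1)\<^sup>2 + sqrt X * \<bar>u t\<bar>"
      using sX by (intro add_nonneg_nonneg) auto
    then have "sqrt X * \<bar>u t\<bar> \<le> 1 + X * (u t)\<^sup>2"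
      using sX(2) by (simp add: power2_eq_square algebra_simps) (simp add: mult.assoc[symmetric])
    then show ?thesis
      using sX pos[of t]
      by (simp add: W_def p_def h_def norm_mult abs_mult field_simps del: of_real_mult of_real_divide)
  qed
  have "integral {0..L} (\<lambda>t. cis (\<phi> t)) + \<i> * (W L - W 0)
      = integral {0..L} (\<lambda>t. cis (\<phi> t) + \<i> * W' t)"
    using integral_unique[OF W'i] has_integral_integrable[OF W'i] ci
    by (subst integral_add) (auto intro: integrable_on_mult_right)
  then have "norm (integral {0..L} (\<lambda>t. cis (\<phi> t)) + \<i> * (W L - W 0))
      = norm (integral {0..L} (\<lambda>t. cis (\<phi> t) + \<i> * W' t))"
    by simp
  also have "\<dots> \<le> integral {0..L} (\<lambda>t. (1 + M) * h t)"
  proof (rule integral_norm_bound_integral)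
    show "(\<lambda>t. cis (\<phi> t) + \<i> * W' t) integrable_on {0..L}"
      using ci has_integral_integrable[OF W'i] by (intro integrable_add integrable_on_mult_right)
    show "(\<lambda>t. (1 + M) * h t) integrable_on {0..L}"
      using hi by (rule integrable_on_mult_right)
    show "norm (cis (\<phi> t) + \<i> * W' t) \<le> (1 + M) * h t" if "t \<in> {0..L}" for t
    proof -
      have "norm (cis (\<phi> t) + \<i> * W' t) = norm (of_real (h t) + \<i> * of_real (p' t))"
        by (simp add: eq norm_mult)
      also have "\<dots> \<le> \<bar>h t\<bar> + \<bar>p' t\<bar>"
        by (rule order_trans[OF norm_triangle_ineq]) (simp add: norm_mult)
      also have "\<dots> \<le> (1 + M) * h t"
        using p'b[OF that] h0[of t] by (simp add: algebra_simps)
      finally show ?thesis .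
    qed
  qed
  also have "\<dots> = (1 + M) * integral {0..L} h" by simp
  also have "\<dots> \<le> (1 + M) * (((4 * M + 2 * M * L) / k + L) / sqrt X)"
    using integral_majorant_bound[OF L X k du du1 b1 b2 low] M0
    unfolding h_def by (intro mult_left_mono) auto
  finally have 1: "norm (integral {0..L} (\<lambda>t. cis (\<phi> t)) + \<i> * (W L - W 0))
     \<le> (1 + M) * (((4 * M + 2 * M * L) / k + L) / sqrt X)" .
  have "norm (\<i> * (W L - W 0)) \<le> 2 / sqrt X"
    using Wb[of L] Wb[of 0] norm_triangle_ineq4[of "W L" "W 0"] by (simp add: norm_mult)
  then have "norm (integral {0..L} (\<lambda>t. cis (\<phi> t)))
     \<le> (1 + M) * (((4 * M + 2 * M * L) / k + L) / sqrt X) + 2 / sqrt X"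
    using 1 norm_triangle_ineq4[of "integral {0..L} (\<lambda>t. cis (\<phi> t)) + \<i> * (W L - W 0)" "\<i> * (W L - W 0)"]
    by simp
  then show ?thesis by (simp add: add_divide_distrib algebra_simps)
qed

text \<open>
  Stationary phase for arc length, with a constant depending only on the
  curve. With \<open>x = \<xi>/|\<xi>|\<close> the phase has derivative \<open>|\<xi>| u\<close> for \<open>u = x \<bullet> \<gamma>'\<close>, and the frame identity bounds
  \<open>u'\<^sup>2\<close> below by the least squared curvature times \<open>1 - u\<^sup>2\<close>.
\<close>

lemma curve_Fourier_decay:
  assumes arc: "arclength_param L \<gamma>"
    and curv: "\<forall>t\<in>{0..L}. curvature L \<gamma> t \<noteq> 0"
  shows "\<exists>C>0. \<forall>\<xi>. norm \<xi> \<ge> 1 \<longrightarrow>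
    norm (integral {0..L} (\<lambda>t. cis (\<xi> \<bullet> \<gamma> t))) \<le> C / sqrt (norm \<xi>)"
proof -
  have L: "0 < L" and sm: "smooth_curve L \<gamma>"
    and n1: "\<And>t. t\<in>{0..L} \<Longrightarrow> norm (curve_deriv L 1 \<gamma> t) = 1"
    using arc by (auto simp: arclength_param_def)
  obtain M2 where M2: "M2 > 0" "\<And>t. t \<in> {0..L} \<Longrightarrow> norm (curve_deriv L 2 \<gamma> t) \<le> M2"
    using smooth_curve_bounded[OF sm] by blast
  obtain M3 where M3: "M3 > 0" "\<And>t. t \<in> {0..L} \<Longrightarrow> norm (curve_deriv L 3 \<gamma> t) \<le> M3"
    using smooth_curve_bounded[OF sm] by blast
  define M where "M = max M2 M3"
  have M: "M > 0" "\<And>t. t \<in> {0..L} \<Longrightarrow> norm (curve_deriv L 2 \<gamma> t) \<le> M"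
    "\<And>t. t \<in> {0..L} \<Longrightarrow> norm (curve_deriv L 3 \<gamma> t) \<le> M"
    using M2 M3 unfolding M_def by (auto simp: le_max_iff_disj)
  have "\<exists>x\<in>{0..L}. \<forall>y\<in>{0..L}. norm (curve_deriv L 2 \<gamma> x) \<le> norm (curve_deriv L 2 \<gamma> y)"
    using L by (intro continuous_attains_inf continuous_on_norm smooth_curve_continuous sm) auto
  then obtain t0 where t0: "t0 \<in> {0..L}"
    "\<And>y. y \<in> {0..L} \<Longrightarrow> norm (curve_deriv L 2 \<gamma> t0) \<le> norm (curve_deriv L 2 \<gamma> y)" by blast
  define k where "k = (norm (curve_deriv L 2 \<gamma> t0))\<^sup>2"
  have k: "k > 0" using curv t0(1) by (simp add: k_def curvature_def)
  define C where "C = 2 + (1 + M) * ((4 * M + 2 * M * L) / k + L)"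
  have C: "C > 0" unfolding C_def using M(1) k L
    by (intro add_pos_nonneg mult_nonneg_nonneg) auto
  show ?thesis
  proof (intro exI[of _ C] conjI allI impI C)
    fix \<xi> :: "real^2" assume \<xi>: "1 \<le> norm \<xi>"
    define X where "X = norm \<xi>"
    define x where "x = \<xi> /\<^sub>R X"
    have X: "1 \<le> X" using \<xi> X_def by simp
    have x: "norm x = 1" "\<xi> = X *\<^sub>R x" using X by (auto simp: x_def simp flip: X_def)
    have d: "((\<lambda>t. x \<bullet> curve_deriv L n \<gamma> t) has_real_derivative x \<bullet> curve_deriv L (Suc n) \<gamma> t)
       (at t within {0..L})" if "t \<in> {0..L}" for t n
      by (rule has_vector_derivative_inner_right[OF smooth_curve_has_deriv[OF sm that]])
    have d0: "((\<lambda>t. \<xi> \<bullet> \<gamma> t) has_real_derivative X * (x \<bullet> curve_deriv L 1 \<gamma> t))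
       (at t within {0..L})" if "t \<in> {0..L}" for t
      using has_vector_derivative_inner_right[OF smooth_curve_has_deriv[OF sm that], of \<xi> 0] x(2)
      by simp
    have cs: "\<bar>x \<bullet> v\<bar> \<le> norm v" for v using Cauchy_Schwarz_ineq2[of x v] x(1) by simp
    have low: "k * (1 - (x \<bullet> curve_deriv L 1 \<gamma> t)\<^sup>2) \<le> (x \<bullet> curve_deriv L 2 \<gamma> t)\<^sup>2"
      if "t \<in> {0..L}" for t
    proof -
      have "(x \<bullet> curve_deriv L 2 \<gamma> t)\<^sup>2
         = (norm (curve_deriv L 2 \<gamma> t))\<^sup>2 * (1 - (x \<bullet> curve_deriv L 1 \<gamma> t)\<^sup>2)"
        using orthogonal_frame_real2[OF n1[OF that] arclength_orthogonal[OF arc that], of x] x(1) by simp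
      moreover have "k \<le> (norm (curve_deriv L 2 \<gamma> t))\<^sup>2"
        unfolding k_def using t0(2)[OF that] by (intro power_mono) auto
      moreover have "(x \<bullet> curve_deriv L 1 \<gamma> t)\<^sup>2 \<le> 1"
        using cs[of "curve_deriv L 1 \<gamma> t"] n1[OF that] by (simp add: abs_square_le_1)
      ultimately show ?thesis by (simp add: mult_right_mono)
    qed
    have "norm (integral {0..L} (\<lambda>t. cis (\<xi> \<bullet> \<gamma> t))) \<le> C / sqrt X"
      unfolding C_def
    proof (rule oscillatory_integral_bound[OF L X k, where u = "\<lambda>t. x \<bullet> curve_deriv L 1 \<gamma> t"
          and ?u1.0 = "\<lambda>t. x \<bullet> curve_deriv L 2 \<gamma> t" and ?u2.0 = "\<lambda>t. x \<bullet> curve_deriv L 3 \<gamma> t"])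
      fix t assume t: "t \<in> {0..L}"
      show "((\<lambda>t. \<xi> \<bullet> \<gamma> t) has_real_derivative X * (x \<bullet> curve_deriv L 1 \<gamma> t)) (at t within {0..L})"
        by (rule d0[OF t])
      show "((\<lambda>t. x \<bullet> curve_deriv L 1 \<gamma> t) has_real_derivative x \<bullet> curve_deriv L 2 \<gamma> t) (at t within {0..L})"
        using d[OF t, of 1] by (simp only: Suc_1)
      show "((\<lambda>t. x \<bullet> curve_deriv L 2 \<gamma> t) has_real_derivative x \<bullet> curve_deriv L 3 \<gamma> t) (at t within {0..L})"
        using d[OF t, of 2] by (simp add: numeral_3_eq_3 numeral_2_eq_2)
      show "\<bar>x \<bullet> curve_deriv L 2 \<gamma> t\<bar> \<le> M" using cs M(2)[OF t] order_trans by blast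
      show "\<bar>x \<bullet> curve_deriv L 3 \<gamma> t\<bar> \<le> M" using cs M(3)[OF t] order_trans by blast
      show "k * (1 - (x \<bullet> curve_deriv L 1 \<gamma> t)\<^sup>2) \<le> (x \<bullet> curve_deriv L 2 \<gamma> t)\<^sup>2" by (rule low[OF t])
    qed
    then show "norm (integral {0..L} (\<lambda>t. cis (\<xi> \<bullet> \<gamma> t))) \<le> C / sqrt (norm \<xi>)"
      by (simp add: X_def)
  qed
qed

section \<open>The divisor bound\<close>

lemma card_divisors_le_prod:
  fixes n :: nat
  assumes "n > 0"
  shows "card {d. d dvd n} \<le> (\<Prod>p\<in>prime_factors n. multiplicity p n + 1)"
proof -
  let ?P = "prime_factors n"
  have "card {d. d dvd n} \<le> card (Pi\<^sub>E ?P (\<lambda>p. {..multiplicity p n}))"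
  proof (rule card_inj_on_le)
    show "inj_on (\<lambda>d. restrict (\<lambda>p. multiplicity p d) ?P) {d. d dvd n}"
    proof (rule inj_onI)
      fix d e assume de: "d \<in> {d. d dvd n}" "e \<in> {d. d dvd n}"
        and eq: "restrict (\<lambda>p. multiplicity p d) ?P = restrict (\<lambda>p. multiplicity p e) ?P"
      have pos: "d \<noteq> 0" "e \<noteq> 0" using de assms by auto
      have "multiplicity p d = multiplicity p e" if "prime p" for p
      proof (cases "p \<in> ?P")
        case True
        then show ?thesis using fun_cong[OF eq, of p] by simp
      next
        case False
        then have "\<not> p dvd n" using that assms by (auto simp: in_prime_factors_iff)
        then have "\<not> p dvd d" "\<not> p dvd e" using de dvd_trans by blast+
        then show ?thesis by (simp add: not_dvd_imp_multiplicity_0)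
      qed
      then show "d = e" using pos by (auto intro: multiplicity_eq_nat)
    qed
    show "(\<lambda>d. restrict (\<lambda>p. multiplicity p d) ?P) ` {d. d dvd n} \<subseteq> Pi\<^sub>E ?P (\<lambda>p. {..multiplicity p n})"
      using assms by (auto intro!: dvd_imp_multiplicity_le)
    show "finite (Pi\<^sub>E ?P (\<lambda>p. {..multiplicity p n}))"
      by (intro finite_PiE) auto
  qed
  also have "\<dots> = (\<Prod>p\<in>?P. multiplicity p n + 1)"
    by (simp add: card_PiE)
  finally show ?thesis .
qed

text \<open>
  Each prime power \<open>p\<^sup>a\<close> contributes a factor \<open>a + 1\<close> to the number of divisors. It is at most \<open>p\<^sup>a\<^sup>\<epsilon>\<close> once
  \<open>p \<ge> 2\<^sup>1\<^sup>/\<^sup>\<epsilon>\<close>, and for the finitely many smaller primes it costs at most a constant factor each.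
\<close>

lemma divisor_bound:
  fixes \<epsilon> :: real
  assumes "\<epsilon> > 0"
  shows "\<exists>C>0. \<forall>n>0. real (card {d. d dvd n}) \<le> C * real n powr \<epsilon>"
proof -
  define Q where "Q = nat \<lceil>2 powr (1/\<epsilon>)\<rceil>"
  \<comment> \<open>\<open>K\<close> satisfies \<open>a + 1 \<le> K (1 + a \<epsilon> ln 2)\<close>, and \<open>1 + a \<epsilon> ln 2 \<le> 2\<^sup>a\<^sup>\<epsilon> \<le> p\<^sup>a\<^sup>\<epsilon>\<close>.\<close>
  define K where "K = 1 + 1 / (\<epsilon> * ln 2)"
  have K1: "K \<ge> 1" using assms by (simp add: K_def)
  have big: "real a + 1 \<le> (real p powr \<epsilon>) ^ a" if "p \<ge> Q" for p a :: nat
  proof -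
    have "2 powr (1/\<epsilon>) \<le> real p" using that unfolding Q_def by linarith
    then have "(2 powr (1/\<epsilon>)) powr \<epsilon> \<le> real p powr \<epsilon>"
      using assms by (intro powr_mono2) auto
    then have "2 \<le> real p powr \<epsilon>" using assms by (simp add: powr_powr)
    then have "2 ^ a \<le> (real p powr \<epsilon>) ^ a" by (intro power_mono) auto
    moreover have "real a + 1 \<le> 2 ^ a"
      using Bernoulli_inequality[of "1::real" a] by simp
    ultimately show ?thesis by linarith
  qed
  have small: "real a + 1 \<le> K * (real p powr \<epsilon>) ^ a" if "prime p" for p a :: nat
  proof -
    have p2: "2 \<le> real p" using prime_ge_2_nat[OF that] by simp
    have "ln 2 * \<epsilon> \<le> ln (real p) * \<epsilon>" using assms p2 by (intro mult_right_mono) auto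
    then have 1: "exp (real a * (\<epsilon> * ln 2)) \<le> exp (real a * (\<epsilon> * ln p))"
      by (simp add: mult_left_mono mult.commute)
    have 2: "(real p powr \<epsilon>) ^ a = exp (real a * (\<epsilon> * ln p))"
      using p2 by (simp add: powr_def exp_of_nat_mult)
    have "1 + real a * (\<epsilon> * ln 2) \<le> (real p powr \<epsilon>) ^ a"
      using 1 2 exp_ge_add_one_self[of "real a * (\<epsilon> * ln 2)"] by linarith
    then have "K * (1 + real a * (\<epsilon> * ln 2)) \<le> K * (real p powr \<epsilon>) ^ a"
      using K1 by (intro mult_left_mono) auto
    moreover have "real a + 1 \<le> K * (1 + real a * (\<epsilon> * ln 2))"
      using assms by (simp add: K_def field_simps)
    ultimately show ?thesis by linarith
  qed
  show ?thesis
  proof (intro exI[of _ "K ^ Q"] conjI allI impI)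
    show "0 < K ^ Q" using K1 by simp
    fix n :: nat assume n: "n > 0"
    let ?P = "prime_factors n"
    have "real (card {d. d dvd n}) \<le> real (\<Prod>p\<in>?P. multiplicity p n + 1)"
      using card_divisors_le_prod[OF n] of_nat_le_iff by blast
    also have "\<dots> = (\<Prod>p\<in>?P. real (multiplicity p n) + 1)" by (simp add: add.commute)
    also have "\<dots> \<le> (\<Prod>p\<in>?P. (if p < Q then K else 1) * (real p powr \<epsilon>) ^ multiplicity p n)"
      using big small by (intro prod_mono) (auto simp: in_prime_factors_iff)
    also have "\<dots> = (\<Prod>p\<in>?P. if p < Q then K else 1) * (\<Prod>p\<in>?P. real p ^ multiplicity p n) powr \<epsilon>"
    proof -
      have "(\<Prod>p\<in>?P. (real p powr \<epsilon>) ^ multiplicity p n) = (\<Prod>p\<in>?P. (real p ^ multiplicity p n) powr \<epsilon>)"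
      proof (rule prod.cong[OF refl])
        fix p assume "p \<in> ?P"
        then have "real p > 0" by (auto simp: in_prime_factors_iff prime_gt_0_nat)
        then show "(real p powr \<epsilon>) ^ multiplicity p n = (real p ^ multiplicity p n) powr \<epsilon>"
          by (simp add: powr_powr mult.commute flip: powr_realpow)
      qed
      then show ?thesis by (simp add: prod_powr_distrib prod.distrib)
    qed
    also have "(\<Prod>p\<in>?P. real p ^ multiplicity p n) = real n"
    proof -
      have "real n = real (\<Prod>p\<in>?P. p ^ multiplicity p n)"
        using prime_factorization_nat[OF n] by simp
      then show ?thesis by simp
    qed
    finally have bd: "real (card {d. d dvd n}) \<le> (\<Prod>p\<in>?P. if p < Q then K else 1) * real n powr \<epsilon>" .
    have "(\<Prod>p\<in>?P. if p < Q then K else 1) \<le> K ^ Q"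
    proof -
      have "(\<Prod>p\<in>?P. if p < Q then K else 1) = K ^ card (?P \<inter> {p. p < Q})"
        by (simp add: prod.If_cases)
      also have "card (?P \<inter> {p. p < Q}) \<le> card {..<Q}" by (intro card_mono) auto
      then have "K ^ card (?P \<inter> {p. p < Q}) \<le> K ^ Q" using K1 by (intro power_increasing) auto
      finally show ?thesis .
    qed
    then have "(\<Prod>p\<in>?P. if p < Q then K else 1) * real n powr \<epsilon> \<le> K ^ Q * real n powr \<epsilon>"
      by (rule mult_right_mono) simp
    with bd show "real (card {d. d dvd n}) \<le> K ^ Q * real n powr \<epsilon>" by linarith
  qed
qed

section \<open>The number of lattice points on a circle\<close>

lemma primitive_representation_coprime:
  fixes a b m :: int
  assumes "a\<^sup>2 + b\<^sup>2 = m" "coprime a b"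
  shows "coprime a m" "coprime b m"
proof -
  have "coprime a (b\<^sup>2)" "coprime b (a\<^sup>2)" using assms(2) by (auto simp: coprime_commute)
  moreover have "gcd a m = gcd a (b\<^sup>2)"
    using gcd_add_mult[of a a "b\<^sup>2"] assms(1) by (simp add: power2_eq_square)
  moreover have "gcd b m = gcd b (a\<^sup>2)"
    using gcd_add_mult[of b b "a\<^sup>2"] assms(1) by (simp add: power2_eq_square add.commute)
  ultimately show "coprime a m" "coprime b m"
    by (simp_all add: coprime_iff_gcd_eq_1)
qed

text \<open>
  For primitive representations \<open>(a, b)\<close> and \<open>(c, d)\<close> of \<open>m\<close> the product \<open>(ad - bc)(ad + bc)\<close> is divisible by
  \<open>m\<close>, so \<open>g = gcd m (ad - bc)\<close> records how \<open>m\<close> is split between the two factors; in terms of Gaussian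
  integers it says which prime factors the two representations share. If two representations have the
  same \<open>g\<close> relative to \<open>(c, d)\<close>, then both \<open>g\<close> and \<open>m / g\<close> divide their cross product, and these two
  numbers have no common factor beyond \<open>2\<close>.
\<close>

lemma primitive_fibre_cross:
  fixes a b a' b' c d m :: int
  assumes m: "m > 0"
    and r: "a\<^sup>2 + b\<^sup>2 = m" "a'\<^sup>2 + b'\<^sup>2 = m" "c\<^sup>2 + d\<^sup>2 = m"
    and cp: "coprime a b" "coprime c d"
    and g: "gcd m (a * d - b * c) = g" "gcd m (a' * d - b' * c) = g"
  shows "m dvd 2 * (a * b' - a' * b)"
proof -
  obtain h where h: "m = g * h" using g(1) by (metis gcd_dvd1 dvdE)
  have h0: "h \<noteq> 0" "g \<noteq> 0" using h m by auto
  have dm: "coprime d m" and am: "coprime a m"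
    using primitive_representation_coprime[OF r(3) cp(2)] primitive_representation_coprime[OF r(1) cp(1)] by auto
  have other: "h dvd x * d + y * c" if xy: "x\<^sup>2 + y\<^sup>2 = m" "gcd m (x * d - y * c) = g" for x y
  proof -
    obtain k where k: "x * d - y * c = g * k" using xy(2) by (metis gcd_dvd2 dvdE)
    have "coprime h k"
    proof -
      have "\<bar>g\<bar> * gcd h k = gcd (g * h) (g * k)" by (simp add: gcd_mult_left abs_mult)
      then have "\<bar>g\<bar> * gcd h k = g" using xy(2) h k by simp
      moreover have "g \<ge> 0" using xy(2) gcd_ge_0_int by metis
      ultimately have "g * gcd h k = g" by simp
      then show ?thesis using h0 by (simp add: coprime_iff_gcd_eq_1)
    qed
    have "(x * d - y * c) * (x * d + y * c) = m * (x\<^sup>2 - c\<^sup>2)"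
    proof -
      have "y\<^sup>2 = m - x\<^sup>2" "d\<^sup>2 = m - c\<^sup>2" using xy(1) r(3) by simp_all
      moreover have "(x * d - y * c) * (x * d + y * c) = x\<^sup>2 * d\<^sup>2 - y\<^sup>2 * c\<^sup>2"
        by (simp add: power2_eq_square algebra_simps)
      ultimately show ?thesis by (simp only:) (simp add: algebra_simps)
    qed
    then have "g * (k * (x * d + y * c)) = g * (h * (x\<^sup>2 - c\<^sup>2))"
      using k h by (simp add: mult.assoc)
    then have "k * (x * d + y * c) = h * (x\<^sup>2 - c\<^sup>2)" using h0 by simp
    then have "h dvd k * (x * d + y * c)" by simp
    then show ?thesis using \<open>coprime h k\<close> by (simp add: coprime_dvd_mult_right_iff)
  qed
  let ?D = "a * b' - a' * b"
  have "g dvd d * ?D"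
  proof -
    have "d * ?D = b' * (a * d - b * c) - b * (a' * d - b' * c)" by (simp add: algebra_simps)
    then show ?thesis using g by (metis dvd_diff dvd_mult gcd_dvd2)
  qed
  moreover have "h dvd d * ?D"
  proof -
    have "d * ?D = b' * (a * d + b * c) - b * (a' * d + b' * c)" by (simp add: algebra_simps)
    then show ?thesis using other[OF r(1) g(1)] other[OF r(2) g(2)] by (metis dvd_diff dvd_mult)
  qed
  moreover have "coprime g d" "coprime h d"
    using dm h by (auto simp: coprime_commute)
  ultimately have gD: "g dvd ?D" and hD: "h dvd ?D"
    by (simp_all add: coprime_dvd_mult_right_iff)
  define e where "e = gcd g h"
  have "e dvd 2 * (a * d)"
  proof -
    have "e dvd a * d - b * c" using g(1) unfolding e_def by (metis dvd_trans gcd_dvd1 gcd_dvd2)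
    moreover have "e dvd a * d + b * c" using other[OF r(1) g(1)] unfolding e_def by (metis dvd_trans gcd_dvd2)
    ultimately have "e dvd (a * d - b * c) + (a * d + b * c)" by (rule dvd_add)
    then show ?thesis by simp
  qed
  moreover have "coprime e (a * d)"
  proof -
    have "e dvd m" unfolding e_def h by (simp add: dvd_mult2)
    then show ?thesis using am dm by (metis coprime_commute coprime_divisors coprime_mult_right_iff dvd_refl)
  qed
  ultimately have e2: "e dvd 2" by (simp add: coprime_dvd_mult_left_iff)
  have "lcm g h dvd ?D" using gD hD by (rule lcm_least)
  then have "e * lcm g h dvd 2 * ?D" using e2 by (intro mult_dvd_mono)
  moreover have "m dvd e * lcm g h" unfolding e_def h by (simp flip: abs_mult)
  ultimately show ?thesis by (rule dvd_trans[rotated])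
qed

lemma finite_sum_two_squares: "finite {(a,b). a\<^sup>2 + b\<^sup>2 = (m::int)}"
proof (rule finite_subset)
  show "{(a,b). a\<^sup>2 + b\<^sup>2 = m} \<subseteq> {-m..m} \<times> {-m..m}"
  proof (rule subsetI)
    fix z assume "z \<in> {(a,b). a\<^sup>2 + b\<^sup>2 = m}"
    then obtain a b where z: "z = (a,b)" "a\<^sup>2 + b\<^sup>2 = m" by auto
    have sq: "\<bar>x\<bar> \<le> x\<^sup>2" for x :: int
      using mult_left_mono[of 1 "\<bar>x\<bar>" "\<bar>x\<bar>"] by (cases "x = 0") (auto simp: power2_eq_square)
    have "0 \<le> a\<^sup>2" "0 \<le> b\<^sup>2" by simp_all
    then have "\<bar>a\<bar> \<le> a\<^sup>2 + b\<^sup>2" "\<bar>b\<bar> \<le> a\<^sup>2 + b\<^sup>2" using sq[of a] sq[of b] by linarith+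
    then show "z \<in> {-m..m} \<times> {-m..m}" using z by (auto simp: abs_le_iff)
  qed
qed auto

text \<open>
  The cross product of two representations is at most \<open>m\<close> in absolute value, so by the previous lemma
  it takes at most five values on a fibre. The inner product is then known up to sign, and
  the two products together determine the second representation from the first.
\<close>

lemma card_primitive_fibre:
  fixes m c d g :: int
  assumes m: "m > 0" and r: "c\<^sup>2 + d\<^sup>2 = m" "coprime c d"
  shows "card {(a,b). a\<^sup>2 + b\<^sup>2 = m \<and> coprime a b \<and> gcd m (a * d - b * c) = g} \<le> 10"
    (is "card ?F \<le> 10")
proof (cases "?F = {}")
  case False
  then obtain a b where ab: "a\<^sup>2 + b\<^sup>2 = m" "coprime a b" "gcd m (a * d - b * c) = g" by auto
  \<comment> \<open>The quotient of the doubled cross product by \<open>m\<close>, and the sign of the inner product.\<close>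
  define f where "f = (\<lambda>(a',b'). (2 * (a * b' - a' * b) div m, 0 \<le> a * a' + b * b'))"
  have id: "(a * b' - a' * b)\<^sup>2 + (a * a' + b * b')\<^sup>2 = m\<^sup>2" if "a'\<^sup>2 + b'\<^sup>2 = m" for a' b'
  proof -
    have "(a * b' - a' * b)\<^sup>2 + (a * a' + b * b')\<^sup>2 = (a\<^sup>2 + b\<^sup>2) * (a'\<^sup>2 + b'\<^sup>2)"
      by (simp add: power2_eq_square algebra_simps)
    then show ?thesis using that ab(1) by (simp add: power2_eq_square)
  qed
  have dv: "m dvd 2 * (a * b' - a' * b)" if "(a',b') \<in> ?F" for a' b'
    using primitive_fibre_cross[OF m ab(1) _ r(1) ab(2) r(2) ab(3), of a' b'] that by auto
  have "card ?F \<le> card ({-2..2::int} \<times> (UNIV::bool set))"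
  proof (rule card_inj_on_le)
    show "f ` ?F \<subseteq> {-2..2} \<times> UNIV"
    proof (rule image_subsetI)
      fix z assume "z \<in> ?F"
      then obtain a' b' where z: "z = (a',b')" and F: "(a',b') \<in> ?F" and m': "a'\<^sup>2 + b'\<^sup>2 = m"
        by auto
      have "(a * b' - a' * b)\<^sup>2 \<le> m\<^sup>2" using id[OF m']
        by (metis le_add_same_cancel1 zero_le_power2)
      then have "\<bar>a * b' - a' * b\<bar> \<le> m" using m by (simp add: abs_le_square_iff[symmetric])
      moreover obtain k where k: "2 * (a * b' - a' * b) = m * k" using dv[OF F] by (elim dvdE)
      ultimately have "\<bar>m * k\<bar> \<le> m * 2" by (simp only: flip: k) (simp add: abs_mult)
      then have "\<bar>k\<bar> \<le> 2" using m by (simp add: abs_mult)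
      then have "2 * (a * b' - a' * b) div m \<in> {-2..2}"
        unfolding k using m by auto
      then show "f z \<in> {-2..2} \<times> UNIV" by (simp add: f_def z)
    qed
    show "inj_on f ?F"
    proof (rule inj_onI)
      fix z z' assume zz: "z \<in> ?F" "z' \<in> ?F" "f z = f z'"
      obtain x y x' y' where z: "z = (x,y)" "z' = (x',y')" by (cases z, cases z')
      then have F: "x\<^sup>2 + y\<^sup>2 = m" "coprime x y" "gcd m (x * d - y * c) = g"
        "x'\<^sup>2 + y'\<^sup>2 = m" "coprime x' y'" "gcd m (x' * d - y' * c) = g" "f (x,y) = f (x',y')"
        using zz by auto
      have "m dvd 2 * (a * y - x * b)" "m dvd 2 * (a * y' - x' * b)" using dv F by auto
      then have D: "a * y - x * b = a * y' - x' * b"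
        using F(7) m unfolding f_def by (auto elim!: dvdE)
      have "(a * x + b * y)\<^sup>2 = (a * x' + b * y')\<^sup>2" using id[OF F(1)] id[OF F(4)] D by simp
      then have T: "a * x + b * y = a * x' + b * y'"
        using F(7) unfolding f_def power2_eq_iff by auto
      have "m * x = a * (a * x + b * y) - b * (a * y - x * b)"
        unfolding ab(1)[symmetric] by (simp add: power2_eq_square algebra_simps)
      also have "\<dots> = m * x'"
        unfolding D T unfolding ab(1)[symmetric] by (simp add: power2_eq_square algebra_simps)
      finally have "x = x'" using m by simp
      have "m * y = b * (a * x + b * y) + a * (a * y - x * b)"
        unfolding ab(1)[symmetric] by (simp add: power2_eq_square algebra_simps)
      also have "\<dots> = m * y'"
        unfolding D T unfolding ab(1)[symmetric] by (simp add: power2_eq_square algebra_simps)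
      finally have "y = y'" using m by simp
      show "z = z'" using \<open>x = x'\<close> \<open>y = y'\<close> z by simp
    qed
  qed auto
  then show ?thesis by simp
qed (simp only: card.empty le0)

lemma card_primitive_representations:
  fixes m :: nat
  assumes m: "m > 0"
  shows "card {(a,b). a\<^sup>2 + b\<^sup>2 = int m \<and> coprime a b} \<le> 10 * card {d. d dvd m}"
    (is "card ?R \<le> _")
proof (cases "?R = {}")
  case False
  then obtain c d where cd: "c\<^sup>2 + d\<^sup>2 = int m" "coprime c d" by auto
  let ?F = "\<lambda>g. {(a,b). a\<^sup>2 + b\<^sup>2 = int m \<and> coprime a b \<and> gcd (int m) (a * d - b * c) = int g}"
  have fin: "finite (?F g)" for g
    by (rule finite_subset[OF _ finite_sum_two_squares[of "int m"]]) auto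
  have "?R \<subseteq> (\<Union>g\<in>{d. d dvd m}. ?F g)"
  proof clarsimp
    fix a b assume "a\<^sup>2 + b\<^sup>2 = int m" "coprime a b"
    have "int (nat (gcd (int m) (a * d - b * c))) = gcd (int m) (a * d - b * c)" by simp
    moreover have "nat (gcd (int m) (a * d - b * c)) dvd m"
      using nat_dvd_iff by (metis calculation gcd_dvd1 int_dvd_int_iff)
    ultimately show "\<exists>x. x dvd m \<and> gcd (int m) (a * d - b * c) = int x" by metis
  qed
  then have "card ?R \<le> card (\<Union>g\<in>{d. d dvd m}. ?F g)"
    using m fin by (intro card_mono) (auto intro!: finite_UN_I)
  also have "\<dots> \<le> (\<Sum>g\<in>{d. d dvd m}. card (?F g))"
    using m by (intro card_UN_le) auto
  also have "\<dots> \<le> (\<Sum>g\<in>{d. d dvd m}. 10)"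
    using card_primitive_fibre[OF _ cd] m by (intro sum_mono) auto
  finally show ?thesis by simp
qed (simp only: card.empty le0)

text \<open>
  A representation with greatest common divisor \<open>g\<close> is \<open>g\<close> times a primitive representation of \<open>n / g\<^sup>2\<close>.
\<close>

lemma card_sum_two_squares:
  fixes n :: nat
  assumes n: "n > 0"
  shows "card {(a,b). a\<^sup>2 + b\<^sup>2 = int n} \<le> 10 * (card {d. d dvd n})\<^sup>2"
    (is "card ?S \<le> _")
proof -
  let ?D = "{d. d dvd n}"
  have finD: "finite ?D" using n by simp
  let ?S' = "\<lambda>g. {(a,b). a\<^sup>2 + b\<^sup>2 = int n \<and> gcd a b = int g}"
  have fin: "finite (?S' g)" for g
    by (rule finite_subset[OF _ finite_sum_two_squares[of "int n"]]) auto
  have sub: "?S \<subseteq> (\<Union>g\<in>?D. ?S' g)"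
  proof clarsimp
    fix a b assume ab: "a\<^sup>2 + b\<^sup>2 = int n"
    have "int (nat (gcd a b)) = gcd a b" by simp
    moreover have "gcd a b dvd int n"
      unfolding ab[symmetric] by (simp add: power2_eq_square)
    ultimately show "\<exists>x. x dvd n \<and> gcd a b = int x" by (metis int_dvd_int_iff)
  qed
  have each: "card (?S' g) \<le> 10 * card ?D" if "g dvd n" for g
  proof (cases "?S' g = {}")
    case False
    then obtain a b where ab: "a\<^sup>2 + b\<^sup>2 = int n" "gcd a b = int g" by auto
    have "(int g)\<^sup>2 dvd int n"
      unfolding ab(1)[symmetric] ab(2)[symmetric] by (intro dvd_add dvd_power_same) auto
    then obtain m where m: "n = g\<^sup>2 * m" by (metis dvdE int_dvd_int_iff of_nat_power)
    have m0: "m > 0" "g > 0" using m n by (auto intro: Nat.gr0I)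
    let ?R = "{(a,b). a\<^sup>2 + b\<^sup>2 = int m \<and> coprime a b}"
    have "?S' g \<subseteq> (\<lambda>(a,b). (int g * a, int g * b)) ` ?R"
    proof clarify
      fix x y assume xy: "x\<^sup>2 + y\<^sup>2 = int n" "gcd x y = int g"
      obtain u v where uv: "x = int g * u" "y = int g * v"
        by (metis xy(2) gcd_dvd1 gcd_dvd2 dvdE)
      have "(int g)\<^sup>2 * (u\<^sup>2 + v\<^sup>2) = (int g)\<^sup>2 * int m"
        using xy(1) m uv by (simp add: power_mult_distrib algebra_simps)
      then have "u\<^sup>2 + v\<^sup>2 = int m" using m0 by simp
      moreover have "int g * gcd u v = int g * 1"
        using xy(2) uv by (simp add: gcd_mult_left)
      then have "coprime u v" using m0 by (simp add: coprime_iff_gcd_eq_1)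
      ultimately show "(x,y) \<in> (\<lambda>(a,b). (int g * a, int g * b)) ` ?R" using uv by force
    qed
    moreover have finR: "finite ?R"
      by (rule finite_subset[OF _ finite_sum_two_squares[of "int m"]]) auto
    ultimately have "card (?S' g) \<le> card ?R"
      by (meson card_image_le card_mono finite_imageI order_trans)
    also have "\<dots> \<le> 10 * card {d. d dvd m}" by (rule card_primitive_representations[OF m0(1)])
    also have "card {d. d dvd m} \<le> card ?D" using finD m by (intro card_mono) auto
    finally show ?thesis by simp
  qed (simp only: card.empty le0)
  have "card ?S \<le> card (\<Union>g\<in>?D. ?S' g)"
    using sub finD fin by (intro card_mono) (auto intro!: finite_UN_I)
  also have "\<dots> \<le> (\<Sum>g\<in>?D. card (?S' g))" using finD by (rule card_UN_le)
  also have "\<dots> \<le> (\<Sum>g\<in>?D. 10 * card ?D)" using each by (intro sum_mono) auto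
  finally show ?thesis by (simp add: power2_eq_square)
qed

definition int_coords :: "real^2 \<Rightarrow> int \<times> int" where
  "int_coords \<mu> = (\<lfloor>\<mu> $ 1\<rfloor>, \<lfloor>\<mu> $ 2\<rfloor>)"

lemma int_lattice_coords:
  assumes "\<mu> \<in> int_lattice"
  shows "\<mu> $ 1 = of_int (fst (int_coords \<mu>))" "\<mu> $ 2 = of_int (snd (int_coords \<mu>))"
  using assms by (auto simp: int_coords_def int_lattice_def elim!: Ints_cases allE)

lemma lattice_circle_radius:
  assumes "\<mu> \<in> lattice_circle lam" "lam > 0"
  shows "\<exists>n::nat. n > 0 \<and> lam\<^sup>2 = real n"
proof -
  have \<mu>: "\<mu> \<in> int_lattice" "norm \<mu> = lam" using assms by (auto simp: lattice_circle_def)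
  let ?n = "nat ((fst (int_coords \<mu>))\<^sup>2 + (snd (int_coords \<mu>))\<^sup>2)"
  have "lam\<^sup>2 = (\<mu> $ 1)\<^sup>2 + (\<mu> $ 2)\<^sup>2"
    unfolding \<mu>(2)[symmetric] power2_norm_eq_inner by (simp add: inner_vec_def sum_2 power2_eq_square)
  also have "\<dots> = real ?n" using int_lattice_coords[OF \<mu>(1)] by simp
  finally have eq: "lam\<^sup>2 = real ?n" .
  moreover have "?n > 0" using eq assms(2) by (metis gr0I of_nat_0 power_not_zero order_less_irrefl)
  ultimately show ?thesis by blast
qed

lemma lattice_circle_inj:
  assumes "lam\<^sup>2 = real n"
  shows "inj_on int_coords (lattice_circle lam)"
    "int_coords ` lattice_circle lam \<subseteq> {(a,b). a\<^sup>2 + b\<^sup>2 = int n}"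
proof -
  show "inj_on int_coords (lattice_circle lam)"
  proof (rule inj_onI)
    fix x y assume "x \<in> lattice_circle lam" "y \<in> lattice_circle lam" "int_coords x = int_coords y"
    then have "x $ 1 = y $ 1" "x $ 2 = y $ 2"
      using int_lattice_coords by (auto simp: lattice_circle_def)
    then show "x = y" by (simp add: vec_eq_iff forall_2)
  qed
  show "int_coords ` lattice_circle lam \<subseteq> {(a,b). a\<^sup>2 + b\<^sup>2 = int n}"
  proof clarify
    fix \<mu> a b assume h: "\<mu> \<in> lattice_circle lam" "(a, b) = int_coords \<mu>"
    then have \<mu>: "\<mu> \<in> int_lattice" "norm \<mu> = lam" by (auto simp: lattice_circle_def)
    have "lam\<^sup>2 = (\<mu> $ 1)\<^sup>2 + (\<mu> $ 2)\<^sup>2"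
      unfolding \<mu>(2)[symmetric] power2_norm_eq_inner by (simp add: inner_vec_def sum_2 power2_eq_square)
    then have "real_of_int (a\<^sup>2 + b\<^sup>2) = real_of_int (int n)"
      using int_lattice_coords[OF \<mu>(1)] assms by (simp add: h(2)[symmetric])
    then show "a\<^sup>2 + b\<^sup>2 = int n" by (simp only: of_int_eq_iff)
  qed
qed

lemma lattice_circle_finite:
  assumes "lam > 0" shows "finite (lattice_circle lam)"
proof (cases "lattice_circle lam = {}")
  case False
  then obtain n :: nat where "lam\<^sup>2 = real n" using lattice_circle_radius assms by blast
  from lattice_circle_inj[OF this] finite_sum_two_squares show ?thesis
    by (metis finite_imageD finite_subset)
qed simp

lemma lattice_circle_radius_ge_1:
  assumes "lattice_circle lam \<noteq> {}" "lam > 0" shows "lam \<ge> 1"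
proof -
  obtain n :: nat where "n > 0" "lam\<^sup>2 = real n" using lattice_circle_radius assms by blast
  then have "1 \<le> lam\<^sup>2" by simp
  then show ?thesis using assms(2) by (simp add: power2_ge_1_iff abs_le_square_iff)
qed

text \<open>
  Any exponent below \<open>1/12\<close> would serve as well. The value \<open>1/12\<close> is the one that exactly balances the decay
  \<open>|w|\<^sup>-\<^sup>1\<^sup>/\<^sup>2\<close> at \<open>|w| = \<lambda>\<^sup>1\<^sup>/\<^sup>3\<close> against the square of the number of lattice points.
\<close>

lemma card_lattice_circle_bound:
  "\<exists>C>0. \<forall>lam>0. real (card (lattice_circle lam)) \<le> C * lam powr (1/12)"
proof -
  obtain C where C: "C > 0" "\<And>n::nat. n > 0 \<Longrightarrow> real (card {d. d dvd n}) \<le> C * real n powr (1/48)"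
    using divisor_bound[of "1/48"] by auto
  show ?thesis
  proof (intro exI[of _ "10 * C\<^sup>2"] conjI allI impI)
    show "0 < 10 * C\<^sup>2" using C by simp
    fix lam :: real assume lam: "lam > 0"
    show "real (card (lattice_circle lam)) \<le> 10 * C\<^sup>2 * lam powr (1/12)"
    proof (cases "lattice_circle lam = {}")
      case False
      then obtain n :: nat where n: "n > 0" "lam\<^sup>2 = real n" using lattice_circle_radius lam by blast
      have "card (lattice_circle lam) \<le> card {(a,b). a\<^sup>2 + b\<^sup>2 = int n}"
        by (rule card_inj_on_le[OF lattice_circle_inj[OF n(2)] finite_sum_two_squares])
      also have "\<dots> \<le> 10 * (card {d. d dvd n})\<^sup>2" by (rule card_sum_two_squares[OF n(1)])
      finally have "real (card (lattice_circle lam)) \<le> 10 * (real (card {d. d dvd n}))\<^sup>2"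
        by (metis of_nat_le_iff of_nat_mult of_nat_numeral of_nat_power)
      also have "\<dots> \<le> 10 * (C * real n powr (1/48))\<^sup>2"
        using C(2)[OF n(1)] by (intro mult_left_mono power_mono) auto
      also have "real n = lam powr 2" using n(2) lam by simp
      also have "10 * (C * (lam powr 2) powr (1/48))\<^sup>2 = 10 * C\<^sup>2 * lam powr (1/12)"
        proof -
        have "((lam powr 2) powr (1/48))\<^sup>2 = lam powr (1/12)"
          unfolding power2_eq_square powr_powr powr_add[symmetric] by simp
        then show ?thesis by (simp only: power_mult_distrib mult.assoc)
      qed
      finally show ?thesis .
    qed (use C in simp)
  qed
qed

section \<open>Chords of a circle and lattice points on short arcs\<close>

definition vec_to_complex :: "real^2 \<Rightarrow> complex" where
  "vec_to_complex x = Complex (x $ 1) (x $ 2)"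

lemma vec_to_complex_simps:
  "vec_to_complex (x + y) = vec_to_complex x + vec_to_complex y"
  "vec_to_complex (x - y) = vec_to_complex x - vec_to_complex y"
  by (auto simp: vec_to_complex_def complex_eq_iff)

lemma norm_vec_to_complex: "cmod (vec_to_complex x) = norm x"
  by (simp add: vec_to_complex_def norm_vec_def L2_set_def sum_2 complex_norm)

text \<open>
  Let \<open>z\<^sub>i\<close> be the points as complex numbers and \<open>w\<close> their sum. Expanding the product
  \<open>(z\<^sub>1 + z\<^sub>2)(z\<^sub>1 + z\<^sub>3)(z\<^sub>1 + z\<^sub>4)\<close> gives \<open>z\<^sub>1\<^sup>2 w\<close> plus the third elementary symmetric function. On the circle
  \<open>r\<^sup>2 / z\<^sub>i\<close> is the conjugate of \<open>z\<^sub>i\<close>, so the latter is \<open>z\<^sub>1 z\<^sub>2 z\<^sub>3 z\<^sub>4 / r\<^sup>2\<close> times the conjugate of \<open>w\<close>. Both terms are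
  therefore at most \<open>r\<^sup>2 |w|\<close> in absolute value.
\<close>

lemma four_points_on_circle:
  fixes x1 x2 x3 x4 :: "real^2"
  assumes r: "norm x1 = r" "norm x2 = r" "norm x3 = r" "norm x4 = r" and "r > 0"
  shows "norm (x1 + x2) * norm (x1 + x3) * norm (x1 + x4) \<le> 2 * norm (x1 + x2 + x3 + x4) * r\<^sup>2"
proof -
  define z1 z2 z3 z4 where z: "z1 = vec_to_complex x1" "z2 = vec_to_complex x2"
    "z3 = vec_to_complex x3" "z4 = vec_to_complex x4"
  define w where "w = z1 + z2 + z3 + z4"
  have n: "cmod z1 = r" "cmod z2 = r" "cmod z3 = r" "cmod z4 = r"
    using r by (simp_all add: z norm_vec_to_complex)
  have c: "z1 * cnj z1 = (of_real r)\<^sup>2" "z2 * cnj z2 = (of_real r)\<^sup>2"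
     "z3 * cnj z3 = (of_real r)\<^sup>2" "z4 * cnj z4 = (of_real r)\<^sup>2"
    using n by (simp_all add: complex_norm_square[symmetric])
  have "(of_real r)\<^sup>2 * ((z1 + z2) * (z1 + z3) * (z1 + z4))
     = (of_real r)\<^sup>2 * (z1\<^sup>2 * w) + cnj w * (z1 * z2 * z3 * z4)"
  proof -
    have "cnj w * (z1 * z2 * z3 * z4) = (z1 * cnj z1) * (z2 * z3 * z4) + (z2 * cnj z2) * (z1 * z3 * z4)
       + (z3 * cnj z3) * (z1 * z2 * z4) + (z4 * cnj z4) * (z1 * z2 * z3)"
      by (simp add: w_def algebra_simps)
    also have "\<dots> = (of_real r)\<^sup>2 * (z2 * z3 * z4 + z1 * z3 * z4 + z1 * z2 * z4 + z1 * z2 * z3)"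
      unfolding c by (simp add: algebra_simps)
    finally show ?thesis by (simp add: w_def algebra_simps power2_eq_square)
  qed
  then have "cmod ((of_real r)\<^sup>2 * ((z1 + z2) * (z1 + z3) * (z1 + z4)))
     \<le> cmod ((of_real r)\<^sup>2 * (z1\<^sup>2 * w)) + cmod (cnj w * (z1 * z2 * z3 * z4))"
    by (simp add: norm_triangle_ineq)
  then have "r\<^sup>2 * (cmod (z1 + z2) * cmod (z1 + z3) * cmod (z1 + z4)) \<le> r\<^sup>2 * (2 * cmod w * r\<^sup>2)"
    using n \<open>r > 0\<close> by (simp add: norm_mult norm_power) (simp add: power2_eq_square power4_eq_xxxx mult_ac)
  then have "cmod (z1 + z2) * cmod (z1 + z3) * cmod (z1 + z4) \<le> 2 * cmod w * r\<^sup>2"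
    using \<open>r > 0\<close> by (simp add: mult_le_cancel_left)
  then show ?thesis
    by (simp add: w_def z norm_vec_to_complex flip: vec_to_complex_simps)
qed

text \<open>
  The classical formula \<open>abc = 4 R \<sqdot> area\<close> for a triangle with circumradius \<open>R\<close>; the absolute value on
  the right is twice the area.
\<close>

lemma three_points_on_circle:
  fixes p q s :: "real^2"
  assumes r: "norm p = r" "norm q = r" "norm s = r" and "r > 0"
  shows "norm (q - p) * norm (p - s) * norm (q - s)
    = 2 * r * \<bar>(q$1 - p$1) * (s$2 - p$2) - (q$2 - p$2) * (s$1 - p$1)\<bar>"
proof -
  define a b c where z: "a = vec_to_complex p" "b = vec_to_complex q" "c = vec_to_complex s"
  have n: "cmod a = r" "cmod b = r" "cmod c = r"
    using r by (simp_all add: z norm_vec_to_complex)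
  have cc: "a * cnj a = (of_real r)\<^sup>2" "b * cnj b = (of_real r)\<^sup>2" "c * cnj c = (of_real r)\<^sup>2"
    using n by (simp_all add: complex_norm_square[symmetric])
  let ?X = "(q$1 - p$1) * (s$2 - p$2) - (q$2 - p$2) * (s$1 - p$1)"
  have X: "(b - a) * cnj (c - a) - cnj (b - a) * (c - a) = - 2 * \<i> * of_real ?X"
    by (simp add: z vec_to_complex_def complex_eq_iff algebra_simps)
  have "a * b * c * ((b - a) * cnj (c - a) - cnj (b - a) * (c - a))
     = (of_real r)\<^sup>2 * ((b - a) * (a - c) * (b - c))"
  proof -
    have "a * b * c * ((b - a) * cnj (c - a) - cnj (b - a) * (c - a))
      = b * (b - a) * (a * (c * cnj c) - c * (a * cnj a)) - c * (c - a) * (a * (b * cnj b) - b * (a * cnj a))"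
      by (simp add: algebra_simps)
    also have "\<dots> = (of_real r)\<^sup>2 * ((b - a) * (a - c) * (b - c))"
      unfolding cc by (simp add: algebra_simps)
    finally show ?thesis .
  qed
  then have "cmod (a * b * c * (- 2 * \<i> * of_real ?X)) = cmod ((of_real r)\<^sup>2 * ((b - a) * (a - c) * (b - c)))"
    unfolding X by simp
  then have "r\<^sup>2 * (2 * r * \<bar>?X\<bar>) = r\<^sup>2 * (cmod (b - a) * cmod (a - c) * cmod (b - c))"
    using n \<open>r > 0\<close> unfolding norm_mult norm_power norm_minus_cancel norm_of_real
    by (simp add: power2_eq_square mult_ac)
  then have "2 * r * \<bar>?X\<bar> = cmod (b - a) * cmod (a - c) * cmod (b - c)"
    using \<open>r > 0\<close> by simp
  then show ?thesis by (simp add: z norm_vec_to_complex flip: vec_to_complex_simps)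
qed

text \<open>
  Twice the area of a lattice triangle is an integer, and it is not zero because three distinct points of
  a circle are not collinear.
\<close>

lemma lattice_circle_triangle:
  assumes "p \<in> lattice_circle lam" "q \<in> lattice_circle lam" "s \<in> lattice_circle lam" "lam > 0"
    and "p \<noteq> q" "p \<noteq> s" "q \<noteq> s"
  shows "2 * lam \<le> norm (q - p) * norm (p - s) * norm (q - s)"
proof -
  let ?X = "(q$1 - p$1) * (s$2 - p$2) - (q$2 - p$2) * (s$1 - p$1)"
  have eq: "norm (q - p) * norm (p - s) * norm (q - s) = 2 * lam * \<bar>?X\<bar>"
    using assms by (intro three_points_on_circle) (auto simp: lattice_circle_def)
  have "?X \<noteq> 0" using eq assms by auto
  moreover have "?X \<in> \<int>" using assms by (intro Ints_diff Ints_mult) (auto simp: lattice_circle_def int_lattice_def)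
  ultimately have "1 \<le> \<bar>?X\<bar>" by (rule Ints_nonzero_abs_ge1[rotated])
  then show ?thesis unfolding eq using assms(4) by simp
qed

lemma card_lattice_circle_small_ball:
  assumes "lam > 0" "4 * K ^ 3 \<le> lam"
  shows "card {\<xi> \<in> lattice_circle lam. norm (y - \<xi>) < K} \<le> 2"
proof (rule ccontr)
  let ?S = "{\<xi> \<in> lattice_circle lam. norm (y - \<xi>) < K}"
  assume "\<not> card ?S \<le> 2"
  then have "3 \<le> card ?S" by simp
  then obtain T where T: "T \<subseteq> ?S" "card T = 3" by (meson obtain_subset_with_card_n)
  then obtain p q s where pqs: "T = {p,q,s}" "p \<noteq> q" "q \<noteq> s" "p \<noteq> s"
    using card_3_iff by metis
  have d: "norm (u - v) \<le> 2 * K" "norm (u - v) < 2 * K" if "u \<in> T" "v \<in> T" for u v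
  proof -
    have "norm (u - v) \<le> norm (y - v) + norm (y - u)"
      using norm_triangle_ineq4[of "y - v" "y - u"] by simp
    moreover have "norm (y - u) < K" "norm (y - v) < K" using that T by auto
    ultimately show "norm (u - v) < 2 * K" by linarith
    then show "norm (u - v) \<le> 2 * K" by simp
  qed
  have K: "0 < K" using T pqs by (smt (verit) insert_subset mem_Collect_eq norm_ge_zero)
  have "2 * lam \<le> norm (q - p) * norm (p - s) * norm (q - s)"
    using T pqs assms(1) by (intro lattice_circle_triangle) auto
  also have "\<dots> < (2 * K * (2 * K)) * (2 * K)"
    using pqs d[of q p] d[of p s] d[of q s] K by (intro mult_strict_mono mult_mono) (auto intro: mult_strict_mono)
  also have "\<dots> \<le> 2 * lam" using assms(2) by (simp add: power3_eq_cube)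
  finally show False by simp
qed

lemma B_max_ge:
  assumes "lam > 0" "norm x = lam"
  shows "card {\<xi> \<in> lattice_circle lam. norm (x - \<xi>) \<le> sqrt lam} \<le> B_max lam"
  unfolding B_max_def
proof (rule Max_ge)
  show "finite {card {\<xi> \<in> lattice_circle lam. norm (x - \<xi>) \<le> sqrt lam} | x. norm x = lam}"
  proof (rule finite_subset)
    show "{card {\<xi> \<in> lattice_circle lam. norm (x - \<xi>) \<le> sqrt lam} | x. norm x = lam}
       \<subseteq> {..card (lattice_circle lam)}"
      using lattice_circle_finite[OF assms(1)] by (auto intro!: card_mono)
  qed simp
qed (use assms in auto)

text \<open>
  The discs in the definition of \<open>B_max\<close> have their centres on the circle. Centring such a disc at a point of
  \<open>S\<close> itself covers \<open>S\<close>.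
\<close>

lemma card_le_B_max:
  assumes lam: "lam > 0" and S: "S \<subseteq> lattice_circle lam"
    and d: "\<And>x y. x \<in> S \<Longrightarrow> y \<in> S \<Longrightarrow> norm (x - y) \<le> sqrt lam"
  shows "card S \<le> B_max lam"
proof (cases "S = {}")
  case False
  then obtain x where x: "x \<in> S" by auto
  have "card S \<le> card {\<xi> \<in> lattice_circle lam. norm (x - \<xi>) \<le> sqrt lam}"
    using S d[OF x] lattice_circle_finite[OF lam] by (intro card_mono) auto
  also have "\<dots> \<le> B_max lam" using B_max_ge[OF lam] x S by (auto simp: lattice_circle_def)
  finally show ?thesis .
qed simp

lemma B_max_pos:
  assumes "lam > 0" "lattice_circle lam \<noteq> {}" shows "B_max lam \<ge> 1"
proof -
  obtain \<xi> where "\<xi> \<in> lattice_circle lam" using assms(2) by auto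
  then have "card {\<xi>} \<le> B_max lam" using assms by (intro card_le_B_max) auto
  then show ?thesis by simp
qed

lemma sum_inverse_sqrt: "(\<Sum>j=1..n. 1 / sqrt (real j)) \<le> 2 * sqrt (real n)"
proof (induction n)
  case (Suc n)
  have "(sqrt (real (Suc n)) - sqrt (real n)) * (sqrt (real (Suc n)) + sqrt (real n)) = 1"
    by (simp add: algebra_simps)
  moreover have "sqrt (real (Suc n)) + sqrt (real n) \<le> 2 * sqrt (real (Suc n))" by simp
  moreover have "0 \<le> sqrt (real (Suc n)) - sqrt (real n)" by simp
  ultimately have "1 \<le> (sqrt (real (Suc n)) - sqrt (real n)) * (2 * sqrt (real (Suc n)))"
    by (metis mult_left_mono)
  then have "1 / sqrt (real (Suc n)) \<le> 2 * sqrt (real (Suc n)) - 2 * sqrt (real n)"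
    by (subst pos_divide_le_eq) (auto simp: algebra_simps)
  then show ?case using Suc by simp
qed simp

text \<open>
  For \<open>s \<le> 1\<close> there are at most five terms, none above \<open>1\<close>. For larger \<open>s\<close> the sum over \<open>j \<ge> 1\<close> is of
  order \<open>\<surd>(J / s)\<close>, and \<open>J \<le> 4 s\<close>.
\<close>

lemma bin_sum_bound:
  assumes s: "0 \<le> s" and J: "real J \<le> 2 * s + 2"
  shows "(\<Sum>j\<le>J. 1 / sqrt (max 1 (real j * s / 32))) \<le> 25"
proof (cases "s \<le> 1")
  case True
  have "(\<Sum>j\<le>J. 1 / sqrt (max 1 (real j * s / 32))) \<le> (\<Sum>j\<le>J. 1)"
    by (intro sum_mono) auto
  also have "\<dots> \<le> 5" using J True by simp
  finally show ?thesis by simp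
next
  case False
  have "(\<Sum>j\<le>J. 1 / sqrt (max 1 (real j * s / 32)))
     = 1 + (\<Sum>j=1..J. 1 / sqrt (max 1 (real j * s / 32)))"
    by (simp add: atMost_atLeast0 sum.atLeast_Suc_atMost)
  also have "(\<Sum>j=1..J. 1 / sqrt (max 1 (real j * s / 32))) \<le> (\<Sum>j=1..J. sqrt (32 / s) * (1 / sqrt (real j)))"
  proof (intro sum_mono)
    fix j assume j: "j \<in> {1..J}"
    then have "0 < real j * s / 32" using False by simp
    then have "1 / sqrt (max 1 (real j * s / 32)) \<le> 1 / sqrt (real j * s / 32)"
      by (intro divide_left_mono mult_pos_pos) auto
    also have "\<dots> = sqrt (32 / s) * (1 / sqrt (real j))"
      by (simp add: real_sqrt_divide real_sqrt_mult)
    finally show "1 / sqrt (max 1 (real j * s / 32)) \<le> sqrt (32 / s) * (1 / sqrt (real j))" .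
  qed
  also have "\<dots> = sqrt (32 / s) * (\<Sum>j=1..J. 1 / sqrt (real j))" by (simp add: sum_distrib_left)
  also have "\<dots> \<le> sqrt (32 / s) * (2 * sqrt (real J))"
    using s by (intro mult_left_mono sum_inverse_sqrt) auto
  also have "\<dots> = 2 * sqrt (32 / s * real J)" by (simp only: real_sqrt_mult mult_ac)
  also have "\<dots> \<le> 2 * 12"
  proof -
    have "32 * real J \<le> 12\<^sup>2 * s" using J False by simp
    then have "32 / s * real J \<le> 12\<^sup>2" using False by (simp add: pos_divide_le_eq)
    then have "sqrt (32 / s * real J) \<le> 12" by (rule real_le_lsqrt[rotated]) auto
    then show ?thesis by simp
  qed
  finally show ?thesis by simp
qed

text \<open>
  On the part of the circle where the radial coordinate \<open>s\<close> is at least half the radius, the slope of the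
  arc over the tangential coordinate \<open>t\<close> is at most \<open>\<surd>3\<close>.
\<close>

lemma arc_chord_le_tangential:
  fixes s t s' t' r :: real
  assumes c: "s\<^sup>2 + t\<^sup>2 = r\<^sup>2" "s'\<^sup>2 + t'\<^sup>2 = r\<^sup>2" and r: "r > 0" and h: "r / 2 \<le> s" "r / 2 \<le> s'"
  shows "(s - s')\<^sup>2 + (t - t')\<^sup>2 \<le> 4 * (t - t')\<^sup>2"
proof -
  have "(r/2)\<^sup>2 \<le> s\<^sup>2" "(r/2)\<^sup>2 \<le> s'\<^sup>2" using h r by (auto intro!: power_mono)
  then have t: "t\<^sup>2 + t'\<^sup>2 \<le> 3 / 2 * r\<^sup>2" using c by (simp add: power_divide)
  have "(t + t')\<^sup>2 \<le> 2 * (t\<^sup>2 + t'\<^sup>2)" using zero_le_power2[of "t - t'"]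
    by (simp add: power2_eq_square algebra_simps)
  with t have t2: "(t + t')\<^sup>2 \<le> 3 * r\<^sup>2" by simp
  have "(s - s') * (s + s') = (t' - t) * (t' + t)" using c by (simp add: power2_eq_square algebra_simps)
  then have e: "(s - s')\<^sup>2 * (s + s')\<^sup>2 = (t - t')\<^sup>2 * (t + t')\<^sup>2"
    by (metis add.commute power2_commute power_mult_distrib)
  have "r\<^sup>2 \<le> (s + s')\<^sup>2" using h r by (intro power_mono) auto
  then have "(s - s')\<^sup>2 * r\<^sup>2 \<le> (s - s')\<^sup>2 * (s + s')\<^sup>2" by (intro mult_left_mono) auto
  also have "\<dots> \<le> (t - t')\<^sup>2 * (3 * r\<^sup>2)" unfolding e using t2 by (intro mult_left_mono) auto
  finally have "(s - s')\<^sup>2 * r\<^sup>2 \<le> (3 * (t - t')\<^sup>2) * r\<^sup>2" by (simp add: mult_ac)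
  then show ?thesis using r by (simp add: mult_le_cancel_right)
qed

text \<open>
  The lattice points are sorted by their distance to the axis through \<open>y\<close>, in steps of \<open>\<surd>lam / 2\<close>, and by
  the side of the axis on which they lie. Points in the same bin have distance at most \<open>\<surd>lam\<close>, so a bin
  holds at most \<open>2 B\<close> points. The distance to \<open>y\<close> is at least the distance to the axis, which turns the sum
  into the one of the lemma on bins.
\<close>

lemma arc_sum_bound:
  assumes lam: "lam \<ge> 1" and y: "norm y = lam" and D: "0 \<le> D"
  shows "(\<Sum>\<xi> | \<xi> \<in> lattice_circle lam \<and> norm (\<xi> - y) \<le> lam \<and> norm (\<xi> - y) \<le> D + sqrt lam.
            1 / sqrt (max 1 (norm (\<xi> - y) * D / (16 * lam)))) \<le> 50 * real (B_max lam)"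
    (is "(\<Sum>\<xi> | ?P \<xi>. ?f \<xi>) \<le> _")
proof -
  have lam0: "lam > 0" using lam by simp
  define S where "S = {\<xi>. ?P \<xi>}"
  have fin: "finite S" unfolding S_def using lattice_circle_finite[OF lam0] by simp
  define t where "t \<xi> = (y$1 * \<xi>$2 - y$2 * \<xi>$1) / lam" for \<xi> :: "real^2"
  define s where "s \<xi> = (y$1 * \<xi>$1 + y$2 * \<xi>$2) / lam" for \<xi> :: "real^2"
  have nsq: "(norm v)\<^sup>2 = (v$1)\<^sup>2 + (v$2)\<^sup>2" for v :: "real^2"
    unfolding power2_norm_eq_inner by (simp add: inner_vec_def sum_2 power2_eq_square)
  have ysq: "(y$1)\<^sup>2 + (y$2)\<^sup>2 = lam\<^sup>2" using nsq[of y] y by simp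
  have st: "(s v)\<^sup>2 + (t v)\<^sup>2 = (norm v)\<^sup>2" for v
  proof -
    have "lam\<^sup>2 * ((s v)\<^sup>2 + (t v)\<^sup>2) = ((y$1)\<^sup>2 + (y$2)\<^sup>2) * (norm v)\<^sup>2"
      unfolding nsq s_def t_def using lam0
      by (simp add: power_divide distrib_left) (simp add: power2_eq_square algebra_simps)
    then show ?thesis using ysq lam0 by simp
  qed
  have lin: "s (u - v) = s u - s v" "t (u - v) = t u - t v" for u v
    by (simp_all add: s_def t_def algebra_simps add_divide_distrib diff_divide_distrib)
  have ty: "t y = 0" "s y = lam" using ysq lam0 by (simp_all add: t_def s_def power2_eq_square mult.commute)
  have tle: "\<bar>t \<xi>\<bar> \<le> norm (\<xi> - y)" for \<xi>
  proof -
    have "(t (\<xi> - y))\<^sup>2 \<le> (norm (\<xi> - y))\<^sup>2" using st[of "\<xi> - y"] by (metis le_add_same_cancel2 zero_le_power2)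
    then have "\<bar>t (\<xi> - y)\<bar> \<le> norm (\<xi> - y)" by (simp add: abs_le_square_iff[symmetric])
    then show ?thesis by (simp add: lin ty)
  qed
  \<comment> \<open>Distance at most \<open>lam\<close> from \<open>y\<close> means an angle of at most sixty degrees.\<close>
  have sge: "lam / 2 \<le> s \<xi>" and on: "(s \<xi>)\<^sup>2 + (t \<xi>)\<^sup>2 = lam\<^sup>2" if "\<xi> \<in> S" for \<xi>
  proof -
    have n: "norm \<xi> = lam" "norm (\<xi> - y) \<le> lam" using that by (auto simp: S_def lattice_circle_def)
    show on: "(s \<xi>)\<^sup>2 + (t \<xi>)\<^sup>2 = lam\<^sup>2" using st[of \<xi>] n by simp
    have "(s (\<xi> - y))\<^sup>2 + (t (\<xi> - y))\<^sup>2 \<le> lam\<^sup>2" unfolding st using n by (intro power_mono) auto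
    then have "(s \<xi> - lam)\<^sup>2 + (t \<xi>)\<^sup>2 \<le> lam\<^sup>2" by (simp add: lin ty)
    then have "lam * lam \<le> lam * (2 * s \<xi>)" using on by (simp add: power2_eq_square algebra_simps)
    then show "lam / 2 \<le> s \<xi>" using lam0 by simp
  qed
  have close: "norm (\<xi> - \<eta>) \<le> sqrt lam" if "\<xi> \<in> S" "\<eta> \<in> S" "\<bar>t \<xi> - t \<eta>\<bar> \<le> sqrt lam / 2" for \<xi> \<eta>
  proof -
    have "(norm (\<xi> - \<eta>))\<^sup>2 = (s \<xi> - s \<eta>)\<^sup>2 + (t \<xi> - t \<eta>)\<^sup>2" using st[of "\<xi> - \<eta>"] by (simp add: lin)
    also have "\<dots> \<le> 4 * (t \<xi> - t \<eta>)\<^sup>2"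
      using on sge that lam0 by (intro arc_chord_le_tangential) auto
    also have "\<dots> = (2 * \<bar>t \<xi> - t \<eta>\<bar>)\<^sup>2" by simp
    also have "\<dots> \<le> (sqrt lam)\<^sup>2" using that(3) by (intro power_mono) auto
    finally show ?thesis by (rule power2_le_imp_le) (use lam0 in auto)
  qed
  define b where "b \<xi> = nat \<lfloor>2 * \<bar>t \<xi>\<bar> / sqrt lam\<rfloor>" for \<xi>
  have b1: "real (b \<xi>) * sqrt lam / 2 \<le> \<bar>t \<xi>\<bar>" and b2: "\<bar>t \<xi>\<bar> \<le> (real (b \<xi>) + 1) * sqrt lam / 2" for \<xi>
  proof -
    have q: "0 \<le> 2 * \<bar>t \<xi>\<bar> / sqrt lam" using lam0 by simp
    have "real (b \<xi>) \<le> 2 * \<bar>t \<xi>\<bar> / sqrt lam" unfolding b_def using q by linarith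
    then show "real (b \<xi>) * sqrt lam / 2 \<le> \<bar>t \<xi>\<bar>" using lam0 by (simp add: pos_le_divide_eq)
    have "2 * \<bar>t \<xi>\<bar> / sqrt lam \<le> real (b \<xi>) + 1" unfolding b_def using q by linarith
    then show "\<bar>t \<xi>\<bar> \<le> (real (b \<xi>) + 1) * sqrt lam / 2" using lam0 by (simp add: pos_divide_le_eq)
  qed
  have bin: "card {\<xi> \<in> S. b \<xi> = j} \<le> 2 * B_max lam" for j
  proof -
    \<comment> \<open>On one side of the axis a bin is a single arc with tangential extent at most \<open>\<surd>lam / 2\<close>.\<close>
    have half: "card {\<xi> \<in> S. b \<xi> = j \<and> (0 \<le> t \<xi>) = pos} \<le> B_max lam" for pos
    proof (rule card_le_B_max[OF lam0])
      show "{\<xi> \<in> S. b \<xi> = j \<and> (0 \<le> t \<xi>) = pos} \<subseteq> lattice_circle lam" by (auto simp: S_def)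
      fix \<xi> \<eta> assume "\<xi> \<in> {\<xi> \<in> S. b \<xi> = j \<and> (0 \<le> t \<xi>) = pos}" "\<eta> \<in> {\<xi> \<in> S. b \<xi> = j \<and> (0 \<le> t \<xi>) = pos}"
      then have h: "\<xi> \<in> S" "\<eta> \<in> S" "b \<xi> = j" "b \<eta> = j" "(0 \<le> t \<xi>) = (0 \<le> t \<eta>)" by auto
      have "\<bar>t \<xi>\<bar> - \<bar>t \<eta>\<bar> \<le> sqrt lam / 2" "\<bar>t \<eta>\<bar> - \<bar>t \<xi>\<bar> \<le> sqrt lam / 2"
        using b1[of \<xi>] b2[of \<xi>] b1[of \<eta>] b2[of \<eta>] unfolding h(3,4) by (simp_all add: algebra_simps)
      then have "\<bar>t \<xi> - t \<eta>\<bar> \<le> sqrt lam / 2" using h(5) by (simp add: abs_if split: if_splits)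
      then show "norm (\<xi> - \<eta>) \<le> sqrt lam" using close h by blast
    qed
    have eq: "{\<xi> \<in> S. b \<xi> = j} = {\<xi> \<in> S. b \<xi> = j \<and> (0 \<le> t \<xi>) = True} \<union> {\<xi> \<in> S. b \<xi> = j \<and> (0 \<le> t \<xi>) = False}"
      by auto
    have "card {\<xi> \<in> S. b \<xi> = j} \<le> card {\<xi> \<in> S. b \<xi> = j \<and> (0 \<le> t \<xi>) = True}
        + card {\<xi> \<in> S. b \<xi> = j \<and> (0 \<le> t \<xi>) = False}"
      by (subst eq) (rule card_Un_le)
    then show ?thesis using half[of True] half[of False] by linarith
  qed
  define sg where "sg = D / sqrt lam"
  define J where "J = nat \<lfloor>2 * sg + 2\<rfloor>"
  have sg: "0 \<le> sg" using D lam0 by (simp add: sg_def)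
  have J: "real J \<le> 2 * sg + 2" unfolding J_def using sg by linarith
  have bJ: "b ` S \<subseteq> {..J}"
  proof clarify
    fix \<xi> assume "\<xi> \<in> S"
    then have "\<bar>t \<xi>\<bar> \<le> D + sqrt lam" using tle[of \<xi>] by (auto simp: S_def)
    then have "2 * \<bar>t \<xi>\<bar> / sqrt lam \<le> 2 * sg + 2" using lam0 by (simp add: sg_def field_simps)
    then show "b \<xi> \<le> J" unfolding b_def J_def by (intro nat_mono floor_mono)
  qed
  have "(\<Sum>\<xi>\<in>S. ?f \<xi>) = (\<Sum>j\<le>J. \<Sum>\<xi> | \<xi> \<in> S \<and> b \<xi> = j. ?f \<xi>)"
    using sum.group[OF fin _ bJ, of ?f] by simp
  also have "\<dots> \<le> (\<Sum>j\<le>J. (2 * real (B_max lam)) * (1 / sqrt (max 1 (real j * sg / 32))))"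
  proof (intro sum_mono)
    fix j
    have "(\<Sum>\<xi> | \<xi> \<in> S \<and> b \<xi> = j. ?f \<xi>) \<le> real (card {\<xi> \<in> S. b \<xi> = j}) * (1 / sqrt (max 1 (real j * sg / 32)))"
    proof (rule sum_bounded_above)
      fix \<xi> assume "\<xi> \<in> {\<xi> \<in> S. b \<xi> = j}"
      then have "real j * sqrt lam / 2 \<le> norm (\<xi> - y)" using b1[of \<xi>] tle[of \<xi>] by auto
      then have "real j * sqrt lam / 2 * D / (16 * lam) \<le> norm (\<xi> - y) * D / (16 * lam)"
        using D lam0 by (intro divide_right_mono mult_right_mono) auto
      moreover have "real j * sqrt lam / 2 * D / (16 * lam) = real j * sg / 32"
        unfolding sg_def using lam0 by (simp add: field_simps)
      ultimately have "real j * sg / 32 \<le> norm (\<xi> - y) * D / (16 * lam)" by (simp only:)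
      then have "max 1 (real j * sg / 32) \<le> max 1 (norm (\<xi> - y) * D / (16 * lam))" by (intro max.mono order_refl)
      then show "?f \<xi> \<le> 1 / sqrt (max 1 (real j * sg / 32))"
        by (intro divide_left_mono mult_pos_pos) auto
    qed
    also have "\<dots> \<le> (2 * real (B_max lam)) * (1 / sqrt (max 1 (real j * sg / 32)))"
    proof (rule mult_right_mono)
      have "real (card {\<xi> \<in> S. b \<xi> = j}) \<le> real (2 * B_max lam)" using bin[of j] by (simp only: of_nat_le_iff)
      then show "real (card {\<xi> \<in> S. b \<xi> = j}) \<le> 2 * real (B_max lam)" by simp
    qed simp
    finally show "(\<Sum>\<xi> | \<xi> \<in> S \<and> b \<xi> = j. ?f \<xi>) \<le> (2 * real (B_max lam)) * (1 / sqrt (max 1 (real j * sg / 32)))" .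
  qed
  also have "\<dots> = (2 * real (B_max lam)) * (\<Sum>j\<le>J. 1 / sqrt (max 1 (real j * sg / 32)))"
    by (simp add: sum_distrib_left)
  also have "\<dots> \<le> (2 * real (B_max lam)) * 25"
    by (intro mult_left_mono bin_sum_bound sg J) auto
  finally show ?thesis unfolding S_def by simp
qed

section \<open>Quadruples of lattice points with a short sum\<close>

definition decay_kernel :: "real^2 \<Rightarrow> real" where
  "decay_kernel w = 1 / sqrt (max 1 (norm w))"

lemma decay_kernel_nonneg: "0 \<le> decay_kernel w"
  by (simp add: decay_kernel_def)

lemma decay_kernel_le: "v \<le> norm w \<Longrightarrow> decay_kernel w \<le> 1 / sqrt (max 1 v)"
  unfolding decay_kernel_def by (intro divide_left_mono mult_pos_pos) auto

text \<open>
  The factor \<open>1/4\<close> is small enough for a disc of this radius to hold at most two lattice points of the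
  circle, and for the smallest of the three gaps of a quadruple to stay below \<open>lam\<close>.
\<close>

definition near_radius :: "real \<Rightarrow> real" where
  "near_radius lam = lam powr (1/3) / 4"

lemma near_radius_bounds:
  assumes "lam \<ge> 1"
  shows "0 < near_radius lam" "64 * near_radius lam ^ 3 = lam" "near_radius lam \<le> lam / 4"
    "near_radius lam \<le> sqrt lam"
proof -
  have "(lam powr (1/3)) ^ 3 = lam powr (1/3 * 3)"
    using assms by (simp only: powr_powr[symmetric]) simp
  then show "64 * near_radius lam ^ 3 = lam"
    using assms by (simp add: near_radius_def power_divide)
  show "0 < near_radius lam" using assms by (simp add: near_radius_def)
  have "lam powr (1/3) \<le> lam powr 1" using assms by (intro powr_mono) auto
  then show "near_radius lam \<le> lam / 4" using assms by (simp add: near_radius_def)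
  have "lam powr (1/3) \<le> lam powr (1/2)" using assms by (intro powr_mono) auto
  then have "lam powr (1/3) \<le> sqrt lam" using assms by (simp add: powr_half_sqrt)
  moreover have "lam powr (1/3) / 4 \<le> lam powr (1/3)" by simp
  ultimately show "near_radius lam \<le> sqrt lam" unfolding near_radius_def by linarith
qed

text \<open>
  What Schur's test uses about an ordered quadruple. The ordering of the gaps is tied to the base point
  \<open>x1\<close>; this weaker condition, with its slack \<open>\<surd>lam\<close> and the constant \<open>16\<close>, survives the exchange of rows and
  columns, which moves the base point to \<open>x2\<close>.
\<close>

definition row_condition :: "real \<Rightarrow> real^2 \<Rightarrow> real^2 \<Rightarrow> real^2 \<Rightarrow> real^2 \<Rightarrow> bool" where
  "row_condition lam x1 x2 x3 x4 \<longleftrightarrow>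
     norm (x1 + x2 + x3 + x4) < near_radius lam \<and> norm (x1 + x2) \<le> lam \<and>
     norm (x1 + x2) \<le> norm (x1 + x3) + sqrt lam \<and>
     norm (x1 + x2) * norm (x1 + x3) / (16 * lam) \<le> norm (x1 + x2 + x3 + x4)"

text \<open>
  Once \<open>x2\<close> is chosen, \<open>x4\<close> lies in a disc of radius \<open>near_radius lam\<close> around \<open>- (x1 + x2 + x3)\<close>, which
  leaves two possibilities. The kernel is at most a quantity that depends on the gap at \<open>x2\<close> only, and the sum over
  \<open>x2\<close> is the arc sum centred at \<open>- x1\<close>.
\<close>

lemma row_sum_bound:
  assumes lam: "lam \<ge> 1" and x1: "x1 \<in> lattice_circle lam"
  shows "(\<Sum>x2\<in>lattice_circle lam. \<Sum>x4\<in>lattice_circle lam.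
      if row_condition lam x1 x2 x3 x4 then decay_kernel (x1 + x2 + x3 + x4) else 0)
    \<le> 100 * real (B_max lam)"
proof -
  let ?E = "lattice_circle lam"
  let ?D = "norm (x1 + x3)"
  let ?f = "\<lambda>x2. 1 / sqrt (max 1 (norm (x2 - (- x1)) * ?D / (16 * lam)))"
  have lam0: "lam > 0" using lam by simp
  have fin: "finite ?E" by (rule lattice_circle_finite[OF lam0])
  have n: "norm (x2 - (- x1)) = norm (x1 + x2)" for x2 by (simp add: add.commute)
  have "(\<Sum>x2\<in>?E. \<Sum>x4\<in>?E. if row_condition lam x1 x2 x3 x4 then decay_kernel (x1 + x2 + x3 + x4) else 0)
    \<le> (\<Sum>x2\<in>?E. if norm (x2 - (- x1)) \<le> lam \<and> norm (x2 - (- x1)) \<le> ?D + sqrt lam then 2 * ?f x2 else 0)"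
  proof (rule sum_mono)
    fix x2 assume x2: "x2 \<in> ?E"
    show "(\<Sum>x4\<in>?E. if row_condition lam x1 x2 x3 x4 then decay_kernel (x1 + x2 + x3 + x4) else 0)
      \<le> (if norm (x2 - (- x1)) \<le> lam \<and> norm (x2 - (- x1)) \<le> ?D + sqrt lam then 2 * ?f x2 else 0)"
    proof (cases "norm (x1 + x2) \<le> lam \<and> norm (x1 + x2) \<le> ?D + sqrt lam")
      case True
      let ?N = "{\<xi> \<in> ?E. norm (- (x1 + x2 + x3) - \<xi>) < near_radius lam}"
      have "(\<Sum>x4\<in>?E. if row_condition lam x1 x2 x3 x4 then decay_kernel (x1 + x2 + x3 + x4) else 0)
         \<le> (\<Sum>x4\<in>?E. if x4 \<in> ?N then ?f x2 else 0)"
      proof (rule sum_mono)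
        fix x4 assume x4: "x4 \<in> ?E"
        have "norm (- (x1 + x2 + x3) - x4) = norm (x1 + x2 + x3 + x4)"
          by (metis minus_add_distrib diff_conv_add_uminus norm_minus_cancel)
        then have "row_condition lam x1 x2 x3 x4 \<Longrightarrow> x4 \<in> ?N"
          using x4 by (simp add: row_condition_def)
        moreover have "row_condition lam x1 x2 x3 x4 \<Longrightarrow> decay_kernel (x1 + x2 + x3 + x4) \<le> ?f x2"
          unfolding n by (rule decay_kernel_le) (simp add: row_condition_def)
        moreover have "0 \<le> ?f x2" by (simp add: le_max_iff_disj)
        ultimately show "(if row_condition lam x1 x2 x3 x4 then decay_kernel (x1 + x2 + x3 + x4) else 0)
           \<le> (if x4 \<in> ?N then ?f x2 else 0)"
          by (auto simp del: divide_le_0_iff zero_le_divide_iff)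
      qed
      also have "\<dots> = real (card ?N) * ?f x2"
        using fin by (simp add: sum.If_cases) (simp add: Int_def conj_commute)
      also have "\<dots> \<le> 2 * ?f x2"
      proof (rule mult_right_mono)
        have "card ?N \<le> 2"
          using near_radius_bounds[OF lam] lam0 by (intro card_lattice_circle_small_ball) auto
        then show "real (card ?N) \<le> 2" by simp
      qed simp
      finally show ?thesis using True unfolding n by simp
    next
      case False
      then have "\<not> row_condition lam x1 x2 x3 x4" for x4 by (auto simp: row_condition_def)
      then show ?thesis by (simp add: le_max_iff_disj)
    qed
  qed
  also have "\<dots> = (\<Sum>x2 | x2 \<in> ?E \<and> norm (x2 - (- x1)) \<le> lam \<and> norm (x2 - (- x1)) \<le> ?D + sqrt lam. 2 * ?f x2)"
    using fin by (simp only: sum.inter_filter)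
  also have "\<dots> = 2 * (\<Sum>x2 | x2 \<in> ?E \<and> norm (x2 - (- x1)) \<le> lam \<and> norm (x2 - (- x1)) \<le> ?D + sqrt lam. ?f x2)"
    by (simp only: sum_distrib_left)
  also have "\<dots> \<le> 2 * (50 * real (B_max lam))"
    using x1 lam by (intro mult_left_mono arc_sum_bound) (auto simp: lattice_circle_def)
  finally show ?thesis by simp
qed

definition ordered_near :: "real \<Rightarrow> real^2 \<Rightarrow> real^2 \<Rightarrow> real^2 \<Rightarrow> real^2 \<Rightarrow> bool" where
  "ordered_near lam x1 x2 x3 x4 \<longleftrightarrow>
     norm (x1 + x2 + x3 + x4) < near_radius lam \<and>
     norm (x1 + x2) \<le> norm (x1 + x3) \<and> norm (x1 + x3) \<le> norm (x1 + x4)"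

text \<open>
  For \<open>w = 0\<close> the three squared gaps add up to \<open>4 r\<^sup>2\<close>, the square of the diameter. So the largest gap of a
  quadruple with a short sum is comparable to \<open>r\<close>.
\<close>

lemma sum_of_squared_gaps:
  fixes x1 x2 x3 x4 :: "'a::real_inner"
  assumes r: "norm x1 = r" "norm x2 = r" "norm x3 = r" "norm x4 = r"
  shows "(norm (x1 + x2))\<^sup>2 + (norm (x1 + x3))\<^sup>2 + (norm (x1 + x4))\<^sup>2
    = 4 * r\<^sup>2 + 2 * (x1 \<bullet> (x1 + x2 + x3 + x4))"
proof -
  have "x1 \<bullet> x1 = r\<^sup>2" "x2 \<bullet> x2 = r\<^sup>2" "x3 \<bullet> x3 = r\<^sup>2" "x4 \<bullet> x4 = r\<^sup>2"
    using r by (simp_all add: power2_norm_eq_inner[symmetric])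
  then show ?thesis
    by (simp add: power2_norm_eq_inner inner_add_left inner_add_right inner_commute)
qed

text \<open>
  The largest gap is at least \<open>lam / 2\<close>, and dividing the four-point inequality by it gives the lower bound
  for \<open>|w|\<close>. The cube of the smallest gap is at most the product of the three, which keeps it below \<open>lam\<close>.
  Seen from \<open>x2\<close>, the gap to \<open>x1\<close> is the same and the other two change by at most \<open>|w|\<close>.
\<close>

lemma ordered_near_row_condition:
  assumes lam: "lam \<ge> 1"
    and E: "x1 \<in> lattice_circle lam" "x2 \<in> lattice_circle lam" "x3 \<in> lattice_circle lam" "x4 \<in> lattice_circle lam"
    and o: "ordered_near lam x1 x2 x3 x4"
  shows "row_condition lam x1 x2 x3 x4" "row_condition lam x2 x1 x4 x3"
proof -
  have lam0: "lam > 0" using lam by simp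
  note K = near_radius_bounds[OF lam]
  define w where "w = x1 + x2 + x3 + x4"
  have n: "norm x1 = lam" "norm x2 = lam" "norm x3 = lam" "norm x4 = lam"
    using E by (auto simp: lattice_circle_def)
  have w: "norm w < near_radius lam" and o1: "norm (x1 + x2) \<le> norm (x1 + x3)"
    and o2: "norm (x1 + x3) \<le> norm (x1 + x4)"
    using o by (auto simp: ordered_near_def w_def)
  have big: "lam / 2 \<le> norm (x1 + x4)"
  proof (rule ccontr)
    assume "\<not> lam / 2 \<le> norm (x1 + x4)"
    then have "norm (x1 + x4) \<le> lam / 2" "norm (x1 + x3) \<le> lam / 2" "norm (x1 + x2) \<le> lam / 2"
      using o1 o2 by auto
    then have "(norm (x1 + x2))\<^sup>2 + (norm (x1 + x3))\<^sup>2 + (norm (x1 + x4))\<^sup>2 \<le> (lam/2)\<^sup>2 + (lam/2)\<^sup>2 + (lam/2)\<^sup>2"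
      by (intro add_mono power_mono) auto
    moreover have "- (lam * (lam / 4)) \<le> x1 \<bullet> w"
    proof -
      have "\<bar>x1 \<bullet> w\<bar> \<le> lam * norm w" using Cauchy_Schwarz_ineq2[of x1 w] n by simp
      also have "\<dots> \<le> lam * (lam / 4)" using w K(3) lam0 by (intro mult_left_mono) auto
      finally show ?thesis by linarith
    qed
    ultimately have "4 * (lam * lam) - 2 * (lam * (lam / 4)) \<le> 3 * (lam * lam / 4)"
      using sum_of_squared_gaps[OF n] by (simp add: w_def power2_eq_square)
    then show False using lam0 by (simp add: field_simps)
  qed
  have p1: "norm (x1 + x2) * norm (x1 + x3) * norm (x1 + x4) \<le> 2 * norm w * lam\<^sup>2"
    using four_points_on_circle[OF n lam0] by (simp add: w_def)
  have p2: "norm (x1 + x2) * norm (x2 + x4) * norm (x2 + x3) \<le> 2 * norm w * lam\<^sup>2"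
    using four_points_on_circle[OF n(2) n(1) n(4) n(3) lam0] by (simp add: w_def add_ac)
  have d1: "norm (x1 + x2) \<le> lam"
  proof -
    have "norm (x1 + x2) ^ 3 \<le> norm (x1 + x2) * norm (x1 + x3) * norm (x1 + x4)"
      unfolding power3_eq_cube using o1 o2 by (intro mult_mono) auto
    also have "\<dots> \<le> 2 * norm w * lam\<^sup>2" by (rule p1)
    also have "\<dots> \<le> 2 * (lam / 4) * lam\<^sup>2" using w K(3) by (intro mult_right_mono) auto
    also have "\<dots> \<le> lam ^ 3" using lam0 by (simp add: power2_eq_square power3_eq_cube)
    finally show ?thesis using lam0 by (simp add: power_mono_iff)
  qed
  have "norm (x1 + x2) * norm (x1 + x3) * (lam / 2) \<le> norm (x1 + x2) * norm (x1 + x3) * norm (x1 + x4)"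
    using big by (intro mult_left_mono) auto
  then have "(norm (x1 + x2) * norm (x1 + x3)) * lam \<le> (4 * norm w * lam) * lam"
    using p1 by (simp add: power2_eq_square mult_ac)
  then have "norm (x1 + x2) * norm (x1 + x3) \<le> 4 * norm w * lam" using lam0 by simp
  also have "\<dots> \<le> 16 * norm w * lam" using lam0 by simp
  finally show "row_condition lam x1 x2 x3 x4"
    using w d1 o1 lam0 K(1) unfolding row_condition_def w_def by (simp add: pos_divide_le_eq mult_ac add_increasing2)
  have "norm (x1 + x4) \<le> norm (x2 + x3) + norm w"
  proof -
    have "x1 + x4 = w - (x2 + x3)" by (simp add: w_def)
    then show ?thesis using norm_triangle_ineq4[of w "x2 + x3"] by simp
  qed
  then have big': "lam / 4 \<le> norm (x2 + x3)" using big w K(3) by linarith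
  have gap: "norm (x1 + x3) \<le> norm (x2 + x4) + norm w"
  proof -
    have "x1 + x3 = w - (x2 + x4)" by (simp add: w_def)
    then show ?thesis using norm_triangle_ineq4[of w "x2 + x4"] by simp
  qed
  have "norm (x1 + x2) * norm (x2 + x4) * (lam / 4) \<le> norm (x1 + x2) * norm (x2 + x4) * norm (x2 + x3)"
    using big' by (intro mult_left_mono) auto
  then have "(norm (x1 + x2) * norm (x2 + x4)) * lam \<le> (8 * norm w * lam) * lam"
    using p2 by (simp add: power2_eq_square mult_ac)
  then have "norm (x1 + x2) * norm (x2 + x4) \<le> 8 * norm w * lam" using lam0 by simp
  also have "\<dots> \<le> 16 * norm w * lam" using lam0 by simp
  finally have "norm (x1 + x2) * norm (x2 + x4) / (16 * lam) \<le> norm w"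
    using lam0 by (simp add: pos_divide_le_eq mult_ac)
  moreover have "norm (x1 + x2) \<le> norm (x2 + x4) + sqrt lam" using o1 gap w K(4) by linarith
  moreover have "norm (x2 + x1 + x4 + x3) = norm w" "norm (x2 + x1) = norm (x1 + x2)"
    by (simp_all add: w_def add_ac)
  ultimately show "row_condition lam x2 x1 x4 x3"
    using w d1 unfolding row_condition_def by (simp only: simp_thms)
qed

text \<open>
  Schur's test: \<open>2 |A1 A3| |A2 A4| \<le> (A1 A3)\<^sup>2 + (A2 A4)\<^sup>2\<close>, and both resulting sums are row sums, the second one
  after renaming the variables.
\<close>

lemma ordered_near_sum_bound:
  fixes A :: "real^2 \<Rightarrow> real"
  assumes lam: "lam \<ge> 1"
  defines "E \<equiv> lattice_circle lam"
  shows "(\<Sum>x1\<in>E. \<Sum>x2\<in>E. \<Sum>x3\<in>E. \<Sum>x4\<in>E. if ordered_near lam x1 x2 x3 x4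
      then \<bar>A x1 * A x2 * A x3 * A x4\<bar> * decay_kernel (x1 + x2 + x3 + x4) else 0)
    \<le> 100 * real (B_max lam) * (\<Sum>x\<in>E. (A x)\<^sup>2)\<^sup>2"
    (is "?L \<le> _")
proof -
  define R where "R x1 x2 x3 x4 = (if row_condition lam x1 x2 x3 x4
     then decay_kernel (x1 + x2 + x3 + x4) else 0)" for x1 x2 x3 x4
  have R0: "0 \<le> R x1 x2 x3 x4" for x1 x2 x3 x4
    unfolding R_def using decay_kernel_nonneg by simp
  define S where "S = (\<Sum>x\<in>E. (A x)\<^sup>2)"
  let ?B = "100 * real (B_max lam)"
  have "?L \<le> (\<Sum>x1\<in>E. \<Sum>x2\<in>E. \<Sum>x3\<in>E. \<Sum>x4\<in>E.
      1/2 * ((A x1)\<^sup>2 * (A x3)\<^sup>2 * R x1 x2 x3 x4) + 1/2 * ((A x2)\<^sup>2 * (A x4)\<^sup>2 * R x2 x1 x4 x3))"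
  proof (intro sum_mono)
    fix x1 x2 x3 x4 assume E: "x1 \<in> E" "x2 \<in> E" "x3 \<in> E" "x4 \<in> E"
    show "(if ordered_near lam x1 x2 x3 x4
      then \<bar>A x1 * A x2 * A x3 * A x4\<bar> * decay_kernel (x1 + x2 + x3 + x4) else 0)
      \<le> 1/2 * ((A x1)\<^sup>2 * (A x3)\<^sup>2 * R x1 x2 x3 x4) + 1/2 * ((A x2)\<^sup>2 * (A x4)\<^sup>2 * R x2 x1 x4 x3)"
    proof (cases "ordered_near lam x1 x2 x3 x4")
      case True
      have r: "R x1 x2 x3 x4 = decay_kernel (x1 + x2 + x3 + x4)"
         "R x2 x1 x4 x3 = decay_kernel (x1 + x2 + x3 + x4)"
        using ordered_near_row_condition[OF lam _ _ _ _ True] E unfolding E_def R_def by (simp_all add: add_ac)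
      have "\<bar>A x1 * A x2 * A x3 * A x4\<bar> = \<bar>A x1 * A x3\<bar> * \<bar>A x2 * A x4\<bar>" by (simp add: abs_mult)
      also have "\<dots> \<le> ((A x1 * A x3)\<^sup>2 + (A x2 * A x4)\<^sup>2) / 2"
        using zero_le_power2[of "\<bar>A x1 * A x3\<bar> - \<bar>A x2 * A x4\<bar>"] by (simp add: power2_diff)
      finally have "\<bar>A x1 * A x2 * A x3 * A x4\<bar> * decay_kernel (x1 + x2 + x3 + x4)
         \<le> ((A x1 * A x3)\<^sup>2 + (A x2 * A x4)\<^sup>2) / 2 * decay_kernel (x1 + x2 + x3 + x4)"
        using decay_kernel_nonneg by (rule mult_right_mono)
      then show ?thesis using True r by (simp add: power_mult_distrib algebra_simps add_divide_distrib)
    qed (use R0 in simp)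
  qed
  also have "\<dots> = 1/2 * (\<Sum>x1\<in>E. \<Sum>x2\<in>E. \<Sum>x3\<in>E. \<Sum>x4\<in>E. (A x1)\<^sup>2 * (A x3)\<^sup>2 * R x1 x2 x3 x4)
     + 1/2 * (\<Sum>x1\<in>E. \<Sum>x2\<in>E. \<Sum>x3\<in>E. \<Sum>x4\<in>E. (A x2)\<^sup>2 * (A x4)\<^sup>2 * R x2 x1 x4 x3)"
    by (simp only: sum.distrib sum_distrib_left)
  also have "(\<Sum>x1\<in>E. \<Sum>x2\<in>E. \<Sum>x3\<in>E. \<Sum>x4\<in>E. (A x2)\<^sup>2 * (A x4)\<^sup>2 * R x2 x1 x4 x3)
     = (\<Sum>x1\<in>E. \<Sum>x2\<in>E. \<Sum>x3\<in>E. \<Sum>x4\<in>E. (A x1)\<^sup>2 * (A x3)\<^sup>2 * R x1 x2 x3 x4)"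
    by (subst sum.swap) (intro sum.cong refl sum.swap)
  also have "(\<Sum>x1\<in>E. \<Sum>x2\<in>E. \<Sum>x3\<in>E. \<Sum>x4\<in>E. (A x1)\<^sup>2 * (A x3)\<^sup>2 * R x1 x2 x3 x4)
     = (\<Sum>x1\<in>E. \<Sum>x3\<in>E. (A x1)\<^sup>2 * (A x3)\<^sup>2 * (\<Sum>x2\<in>E. \<Sum>x4\<in>E. R x1 x2 x3 x4))"
    unfolding sum_distrib_left by (intro sum.cong refl sum.swap)
  also have "1/2 * \<dots> + 1/2 * \<dots> = \<dots>" by simp
  also have "\<dots> \<le> (\<Sum>x1\<in>E. \<Sum>x3\<in>E. (A x1)\<^sup>2 * (A x3)\<^sup>2 * ?B)"
    unfolding R_def E_def by (intro sum_mono mult_left_mono row_sum_bound lam) auto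
  also have "\<dots> = ?B * S\<^sup>2"
    unfolding S_def power2_eq_square[of "sum _ _"] sum_product
    by (simp add: sum_distrib_left mult_ac)
  finally show ?thesis unfolding S_def .
qed

lemma sum4_swap23:
  "(\<Sum>a\<in>E. \<Sum>b\<in>E. \<Sum>c\<in>E. \<Sum>d\<in>E. f a c b d) = (\<Sum>a\<in>E. \<Sum>b\<in>E. \<Sum>c\<in>E. \<Sum>d\<in>E. f a b c d)"
  by (intro sum.cong refl sum.swap)

lemma sum4_swap34:
  "(\<Sum>a\<in>E. \<Sum>b\<in>E. \<Sum>c\<in>E. \<Sum>d\<in>E. f a b d c) = (\<Sum>a\<in>E. \<Sum>b\<in>E. \<Sum>c\<in>E. \<Sum>d\<in>E. f a b c d)"
  by (intro sum.cong refl sum.swap)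

text \<open>
  The summand is symmetric, so ordering the three gaps at \<open>x1\<close> costs a factor \<open>6\<close>.
\<close>

lemma near_sum_bound:
  fixes A :: "real^2 \<Rightarrow> real"
  assumes lam: "lam \<ge> 1"
  defines "E \<equiv> lattice_circle lam"
  shows "(\<Sum>x1\<in>E. \<Sum>x2\<in>E. \<Sum>x3\<in>E. \<Sum>x4\<in>E. if norm (x1 + x2 + x3 + x4) < near_radius lam
      then \<bar>A x1 * A x2 * A x3 * A x4\<bar> * decay_kernel (x1 + x2 + x3 + x4) else 0)
    \<le> 600 * real (B_max lam) * (\<Sum>x\<in>E. (A x)\<^sup>2)\<^sup>2"
    (is "?L \<le> _")
proof -
  define T where "T x1 x2 x3 x4 = (if ordered_near lam x1 x2 x3 x4
      then \<bar>A x1 * A x2 * A x3 * A x4\<bar> * decay_kernel (x1 + x2 + x3 + x4) else 0)" for x1 x2 x3 x4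
  let ?S = "\<lambda>f. \<Sum>x1\<in>E. \<Sum>x2\<in>E. \<Sum>x3\<in>E. \<Sum>x4\<in>E. f x1 x2 x3 x4"
  have T0: "0 \<le> T x1 x2 x3 x4" for x1 x2 x3 x4
    unfolding T_def using decay_kernel_nonneg by simp
  have "?L \<le> ?S (\<lambda>x1 x2 x3 x4. T x1 x2 x3 x4 + T x1 x2 x4 x3 + T x1 x3 x2 x4 + T x1 x3 x4 x2
     + T x1 x4 x2 x3 + T x1 x4 x3 x2)"
  proof (intro sum_mono)
    fix x1 x2 x3 x4
    let ?f = "\<bar>A x1 * A x2 * A x3 * A x4\<bar> * decay_kernel (x1 + x2 + x3 + x4)"
    let ?R = "T x1 x2 x3 x4 + T x1 x2 x4 x3 + T x1 x3 x2 x4 + T x1 x3 x4 x2 + T x1 x4 x2 x3 + T x1 x4 x3 x2"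
    have perm: "T x1 a b c = ?f" if "ordered_near lam x1 a b c" "a + b + c = x2 + x3 + x4"
        "A a * A b * A c = A x2 * A x3 * A x4" for a b c
    proof -
      have 1: "x1 + a + b + c = x1 + x2 + x3 + x4" using that(2) by (simp add: add.assoc)
      have 2: "A x1 * A a * A b * A c = A x1 * A x2 * A x3 * A x4" using that(3) by (simp add: mult.assoc)
      show ?thesis unfolding T_def 1 2 using that(1) by simp
    qed
    show "(if norm (x1 + x2 + x3 + x4) < near_radius lam then ?f else 0) \<le> ?R"
    proof (cases "norm (x1 + x2 + x3 + x4) < near_radius lam")
      case True
      consider "ordered_near lam x1 x2 x3 x4" | "ordered_near lam x1 x2 x4 x3" | "ordered_near lam x1 x3 x2 x4"
        | "ordered_near lam x1 x3 x4 x2" | "ordered_near lam x1 x4 x2 x3" | "ordered_near lam x1 x4 x3 x2"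
        using True unfolding ordered_near_def by (smt (verit) add.assoc add.commute)
      then have "?f \<le> ?R"
        by cases (use perm T0[of x1 x2 x3 x4] T0[of x1 x2 x4 x3] T0[of x1 x3 x2 x4] T0[of x1 x3 x4 x2]
          T0[of x1 x4 x2 x3] T0[of x1 x4 x3 x2] in \<open>auto simp: add_ac mult_ac intro: add_nonneg_nonneg\<close>)
      then show ?thesis using True by simp
    qed (use T0 in \<open>simp add: add_nonneg_nonneg\<close>)
  qed
  also have "\<dots> = ?S T + ?S (\<lambda>a b c d. T a b d c) + ?S (\<lambda>a b c d. T a c b d) + ?S (\<lambda>a b c d. T a c d b)
      + ?S (\<lambda>a b c d. T a d b c) + ?S (\<lambda>a b c d. T a d c b)"
    by (simp only: sum.distrib)
  also have "?S (\<lambda>a b c d. T a b d c) = ?S T" by (rule sum4_swap34)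
  also have "?S (\<lambda>a b c d. T a c b d) = ?S T" by (rule sum4_swap23)
  also have "?S (\<lambda>a b c d. T a c d b) = ?S T"
    using sum4_swap23[of "\<lambda>a b c d. T a b d c" E] sum4_swap34[of T E] by simp
  also have "?S (\<lambda>a b c d. T a d b c) = ?S T"
    using sum4_swap34[of "\<lambda>a b c d. T a c b d" E] sum4_swap23[of T E] by simp
  also have "?S (\<lambda>a b c d. T a d c b) = ?S T"
    using sum4_swap23[of "\<lambda>a b c d. T a d b c" E] sum4_swap34[of "\<lambda>a b c d. T a c b d" E] sum4_swap23[of T E] by simp
  also have "?S T + ?S T + ?S T + ?S T + ?S T + ?S T = 6 * ?S T" by simp
  also have "\<dots> \<le> 6 * (100 * real (B_max lam) * (\<Sum>x\<in>E. (A x)\<^sup>2)\<^sup>2)"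
    unfolding T_def E_def by (intro mult_left_mono ordered_near_sum_bound lam) auto
  finally show ?thesis by simp
qed

text \<open>
  The quadruples are not counted at all: the kernel is replaced by its largest value, and the sum of
  \<open>|A x|\<close> is estimated by Cauchy-Schwarz and the number of lattice points.
\<close>

lemma far_sum_bound:
  fixes A :: "real^2 \<Rightarrow> real"
  assumes lam: "lam \<ge> 1" and N: "real (card (lattice_circle lam)) \<le> C * lam powr (1/12)"
  defines "E \<equiv> lattice_circle lam"
  shows "(\<Sum>x1\<in>E. \<Sum>x2\<in>E. \<Sum>x3\<in>E. \<Sum>x4\<in>E. if norm (x1 + x2 + x3 + x4) < near_radius lam
      then 0 else \<bar>A x1 * A x2 * A x3 * A x4\<bar> * decay_kernel (x1 + x2 + x3 + x4))
    \<le> 2 * C\<^sup>2 * (\<Sum>x\<in>E. (A x)\<^sup>2)\<^sup>2"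
    (is "?L \<le> _")
proof -
  let ?k = "1 / sqrt (near_radius lam)"
  let ?s = "\<Sum>x\<in>E. \<bar>A x\<bar>"
  have K: "0 < near_radius lam" by (rule near_radius_bounds[OF lam])
  have "?L \<le> (\<Sum>x1\<in>E. \<Sum>x2\<in>E. \<Sum>x3\<in>E. \<Sum>x4\<in>E. \<bar>A x1\<bar> * \<bar>A x2\<bar> * \<bar>A x3\<bar> * \<bar>A x4\<bar> * ?k)"
  proof (intro sum_mono)
    fix x1 x2 x3 x4
    have "decay_kernel (x1 + x2 + x3 + x4) \<le> ?k" if "\<not> norm (x1 + x2 + x3 + x4) < near_radius lam"
    proof -
      have "decay_kernel (x1 + x2 + x3 + x4) \<le> 1 / sqrt (max 1 (near_radius lam))"
        using that by (intro decay_kernel_le) simp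
      also have "\<dots> \<le> ?k" using K by (intro divide_left_mono mult_pos_pos) auto
      finally show ?thesis .
    qed
    then have "\<bar>A x1\<bar> * \<bar>A x2\<bar> * \<bar>A x3\<bar> * \<bar>A x4\<bar> * decay_kernel (x1 + x2 + x3 + x4)
      \<le> \<bar>A x1\<bar> * \<bar>A x2\<bar> * \<bar>A x3\<bar> * \<bar>A x4\<bar> * ?k" if "\<not> norm (x1 + x2 + x3 + x4) < near_radius lam"
      using that by (intro mult_left_mono) auto
    then show "(if norm (x1 + x2 + x3 + x4) < near_radius lam
      then 0 else \<bar>A x1 * A x2 * A x3 * A x4\<bar> * decay_kernel (x1 + x2 + x3 + x4))
      \<le> \<bar>A x1\<bar> * \<bar>A x2\<bar> * \<bar>A x3\<bar> * \<bar>A x4\<bar> * ?k"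
      using K unfolding abs_mult by (simp del: times_divide_eq_right add: mult_nonneg_nonneg)
  qed
  also have "\<dots> = ?s ^ 4 * ?k"
  proof -
    have "(\<Sum>x1\<in>E. \<Sum>x2\<in>E. \<Sum>x3\<in>E. \<Sum>x4\<in>E. \<bar>A x1\<bar> * \<bar>A x2\<bar> * \<bar>A x3\<bar> * \<bar>A x4\<bar> * ?k)
      = ?s * ?s * ?s * ?s * ?k"
      by (simp only: sum_distrib_left[symmetric] sum_distrib_right[symmetric])
    then show ?thesis by (simp only: power4_eq_xxxx)
  qed
  also have "\<dots> = (?s\<^sup>2)\<^sup>2 * ?k" by simp
  also have "\<dots> \<le> ((C * lam powr (1/12)) * (\<Sum>x\<in>E. (A x)\<^sup>2))\<^sup>2 * ?k"
  proof (intro mult_right_mono power_mono)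
    have "?s\<^sup>2 \<le> (\<Sum>x\<in>E. 1\<^sup>2) * (\<Sum>x\<in>E. \<bar>A x\<bar>\<^sup>2)"
      using Cauchy_Schwarz_ineq_sum[of "\<lambda>_. 1" "\<lambda>x. \<bar>A x\<bar>" E] by simp
    also have "\<dots> = real (card E) * (\<Sum>x\<in>E. (A x)\<^sup>2)" by simp
    also have "\<dots> \<le> (C * lam powr (1/12)) * (\<Sum>x\<in>E. (A x)\<^sup>2)"
      using N unfolding E_def by (intro mult_right_mono sum_nonneg) auto
    finally show "?s\<^sup>2 \<le> (C * lam powr (1/12)) * (\<Sum>x\<in>E. (A x)\<^sup>2)" .
  qed (use K in auto)
  also have "\<dots> = C\<^sup>2 * (\<Sum>x\<in>E. (A x)\<^sup>2)\<^sup>2 * ((lam powr (1/12))\<^sup>2 * ?k)"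
    by (simp add: power_mult_distrib)
  also have "(lam powr (1/12))\<^sup>2 * ?k = 2"
  proof -
    have "sqrt (near_radius lam) = lam powr (1/6) / 2"
      unfolding near_radius_def using lam
      by (simp add: real_sqrt_divide powr_half_sqrt[symmetric] powr_powr)
    moreover have "(lam powr (1/12))\<^sup>2 = lam powr (1/6)"
      unfolding power2_eq_square powr_add[symmetric] by simp
    ultimately show ?thesis using lam by (simp only:) simp
  qed
  finally show ?thesis by (simp add: mult_ac)
qed

lemma quadruple_sum_bound:
  "\<exists>C>0. \<forall>lam>0. \<forall>A :: real^2 \<Rightarrow> real. lattice_circle lam \<noteq> {} \<longrightarrow>
    (\<Sum>x1\<in>lattice_circle lam. \<Sum>x2\<in>lattice_circle lam. \<Sum>x3\<in>lattice_circle lam. \<Sum>x4\<in>lattice_circle lam.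
       \<bar>A x1 * A x2 * A x3 * A x4\<bar> * decay_kernel (x1 + x2 + x3 + x4))
    \<le> C * real (B_max lam) * (\<Sum>x\<in>lattice_circle lam. (A x)\<^sup>2)\<^sup>2"
proof -
  obtain C where C: "C > 0" "\<And>lam. lam > 0 \<Longrightarrow> real (card (lattice_circle lam)) \<le> C * lam powr (1/12)"
    using card_lattice_circle_bound by blast
  show ?thesis
  proof (intro exI[of _ "600 + 2 * C\<^sup>2"] conjI allI impI)
    show "0 < 600 + 2 * C\<^sup>2" by (simp add: add_pos_nonneg)
    fix lam :: real and A :: "real^2 \<Rightarrow> real" assume lam: "lam > 0" "lattice_circle lam \<noteq> {}"
    define E where "E = lattice_circle lam"
    let ?S2 = "(\<Sum>x\<in>E. (A x)\<^sup>2)\<^sup>2"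
    let ?f = "\<lambda>x1 x2 x3 x4. \<bar>A x1 * A x2 * A x3 * A x4\<bar> * decay_kernel (x1 + x2 + x3 + x4)"
    let ?n = "\<lambda>x1 x2 x3 x4. norm (x1 + x2 + x3 + x4) < near_radius lam"
    have lam1: "lam \<ge> 1" by (rule lattice_circle_radius_ge_1[OF lam(2,1)])
    have B: "1 \<le> real (B_max lam)" using B_max_pos[OF lam] by simp
    have split: "?f x1 x2 x3 x4 = (if ?n x1 x2 x3 x4 then ?f x1 x2 x3 x4 else 0)
         + (if ?n x1 x2 x3 x4 then 0 else ?f x1 x2 x3 x4)" for x1 x2 x3 x4 by simp
    have "(\<Sum>x1\<in>E. \<Sum>x2\<in>E. \<Sum>x3\<in>E. \<Sum>x4\<in>E. ?f x1 x2 x3 x4)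
      = (\<Sum>x1\<in>E. \<Sum>x2\<in>E. \<Sum>x3\<in>E. \<Sum>x4\<in>E. if ?n x1 x2 x3 x4 then ?f x1 x2 x3 x4 else 0)
      + (\<Sum>x1\<in>E. \<Sum>x2\<in>E. \<Sum>x3\<in>E. \<Sum>x4\<in>E. if ?n x1 x2 x3 x4 then 0 else ?f x1 x2 x3 x4)"
      unfolding sum.distrib[symmetric] by (intro sum.cong refl split)
    also have "\<dots> \<le> 600 * real (B_max lam) * ?S2 + 2 * C\<^sup>2 * ?S2"
      unfolding E_def by (intro add_mono near_sum_bound far_sum_bound lam1 C lam)
    also have "\<dots> \<le> 600 * real (B_max lam) * ?S2 + 2 * C\<^sup>2 * real (B_max lam) * ?S2"
      using B mult_left_mono[of 1 "real (B_max lam)" "2 * C\<^sup>2"] by (intro add_left_mono mult_right_mono) auto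
    also have "\<dots> = (600 + 2 * C\<^sup>2) * real (B_max lam) * ?S2" by (simp add: algebra_simps)
    finally show "(\<Sum>x1\<in>lattice_circle lam. \<Sum>x2\<in>lattice_circle lam. \<Sum>x3\<in>lattice_circle lam. \<Sum>x4\<in>lattice_circle lam.
       ?f x1 x2 x3 x4) \<le> (600 + 2 * C\<^sup>2) * real (B_max lam) * (\<Sum>x\<in>lattice_circle lam. (A x)\<^sup>2)\<^sup>2"
      unfolding E_def .
  qed
qed

text \<open>
  Periodicity is used one coordinate at a time: a translation of the cell is then undone by cutting the cell
  once and moving one piece by a full period. In this way invariance of the integral, and from it
  integration by parts and orthogonality, are obtained with no recourse to iterated integrals.
\<close>

section \<open>Integrals over the torus\<close>

definition axis_periodic :: "2 \<Rightarrow> (real^2 \<Rightarrow> 'a) \<Rightarrow> bool" where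
  "axis_periodic i f \<longleftrightarrow> (\<forall>x. f (x + (2 * pi) *\<^sub>R axis i 1) = f x)"

lemma axis_in_int_lattice: "axis i 1 \<in> int_lattice"
  by (auto simp: int_lattice_def axis_def)

lemma on_torus_axis_periodic: "on_torus f \<Longrightarrow> axis_periodic i f"
  using axis_in_int_lattice unfolding on_torus_def axis_periodic_def by blast

lemma torus_cell_integrable:
  fixes f :: "real^2 \<Rightarrow> 'a::banach"
  assumes "continuous_on UNIV f" shows "f integrable_on torus_cell"
  unfolding torus_cell_def by (rule integrable_continuous[OF continuous_on_subset[OF assms]]) simp

lemma integral_torus_cell_split:
  fixes f :: "real^2 \<Rightarrow> 'a::banach"
  assumes f: "continuous_on UNIV f" and h: "0 \<le> h" "h \<le> 2 * pi"
  shows "integral torus_cell f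
    = integral (cbox 0 (\<chi> j. if j = i then h else 2 * pi)) f
      + integral (cbox (\<chi> j. if j = i then h else 0) (\<chi> j. 2 * pi)) f"
proof -
  have ax: "x \<bullet> axis i 1 = x $ i" for x :: "real^2" by (simp add: inner_axis)
  have 1: "cbox 0 (\<chi> j. 2 * pi) \<inter> {x::real^2. x \<bullet> axis i 1 \<le> h} = cbox 0 (\<chi> j. if j = i then h else 2 * pi)"
    using h by (auto simp: mem_box_cart ax split: if_splits) (metis order_trans)+
  have 2: "cbox 0 (\<chi> j. 2 * pi) \<inter> {x::real^2. x \<bullet> axis i 1 \<ge> h} = cbox (\<chi> j. if j = i then h else 0) (\<chi> j. 2 * pi)"
    using h by (auto simp: mem_box_cart ax split: if_splits) (metis order_trans)+
  show ?thesis
    using integral_split[OF torus_cell_integrable[OF f, unfolded torus_cell_def], of "axis i 1" h]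
    unfolding 1 2 by (simp add: torus_cell_def axis_in_Basis_iff)
qed

lemma integral_torus_cell_translate:
  fixes f :: "real^2 \<Rightarrow> 'a::banach"
  assumes f: "continuous_on UNIV f" and per: "axis_periodic i f" and h: "0 \<le> h" "h \<le> 2 * pi"
  shows "integral torus_cell (\<lambda>x. f (x + h *\<^sub>R axis i 1)) = integral torus_cell f"
proof -
  let ?e = "axis i 1 :: real^2"
  let ?T = "(\<chi> j. 2 * pi) :: real^2"
  let ?lo = "\<lambda>h. cbox 0 (\<chi> j. if j = i then h else 2 * pi) :: (real^2) set"
  let ?up = "\<lambda>h. cbox (\<chi> j. if j = i then h else 0) ?T :: (real^2) set"
  have fc: "continuous_on UNIV (\<lambda>x. f (x + h *\<^sub>R ?e))"
    by (rule continuous_on_compose2[OF f]) (auto intro!: continuous_intros)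
  have "integral torus_cell (\<lambda>x. f (x + h *\<^sub>R ?e))
    = integral (?lo (2 * pi - h)) (\<lambda>x. f (x + h *\<^sub>R ?e)) + integral (?up (2 * pi - h)) (\<lambda>x. f (x + h *\<^sub>R ?e))"
    using h by (intro integral_torus_cell_split[OF fc]) auto
  also have "integral (?lo (2 * pi - h)) (\<lambda>x. f (x + h *\<^sub>R ?e)) = integral (?up h) f"
  proof -
    have "?lo (2 * pi - h) = cbox ((\<chi> j. if j = i then h else 0) - h *\<^sub>R ?e) (?T - h *\<^sub>R ?e)"
      by (intro arg_cong2[of _ _ _ _ cbox]) (auto simp: vec_eq_iff axis_def)
    then show ?thesis by (simp only: integral_shift_cbox)
  qed
  also have "integral (?up (2 * pi - h)) (\<lambda>x. f (x + h *\<^sub>R ?e)) = integral (?lo h) f"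
  proof -
    have "f (x + h *\<^sub>R ?e) = f (x + (h - 2 * pi) *\<^sub>R ?e)" for x
    proof -
      have "x + (h - 2 * pi) *\<^sub>R ?e + (2 * pi) *\<^sub>R ?e = x + h *\<^sub>R ?e"
        by (simp add: algebra_simps)
      then show ?thesis using per unfolding axis_periodic_def by metis
    qed
    moreover have "?up (2 * pi - h) = cbox (0 - (h - 2 * pi) *\<^sub>R ?e)
       ((\<chi> j. if j = i then h else 2 * pi) - (h - 2 * pi) *\<^sub>R ?e)"
      by (intro arg_cong2[of _ _ _ _ cbox]) (auto simp: vec_eq_iff axis_def)
    ultimately show ?thesis by (simp only: integral_shift_cbox)
  qed
  also have "integral (?up h) f + integral (?lo h) f = integral torus_cell f"
    using integral_torus_cell_split[OF f h, of i] by simp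
  finally show ?thesis .
qed

text \<open>
  By translation invariance the difference quotient \<open>(G (x + h e) - G x) / h\<close> has integral zero, and it
  converges to \<open>g\<close> uniformly on the cell.
\<close>

lemma integral_torus_derivative_zero:
  fixes G g :: "real^2 \<Rightarrow> 'a::banach"
  assumes G: "continuous_on UNIV G" "axis_periodic i G" and g: "continuous_on UNIV g"
    and d: "\<And>x s. ((\<lambda>s. G (x + s *\<^sub>R axis i 1)) has_vector_derivative g (x + s *\<^sub>R axis i 1)) (at s)"
  shows "integral torus_cell g = 0"
proof -
  let ?e = "axis i 1 :: real^2"
  let ?K = "cbox 0 ((\<chi> j. 2 * pi) + ?e)"
  have "uniformly_continuous_on ?K g"
    by (intro compact_uniformly_continuous continuous_on_subset[OF g]) auto
  have bound: "norm (integral torus_cell g) \<le> \<epsilon> * measure lborel torus_cell" if \<epsilon>: "\<epsilon> > 0" for \<epsilon>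
  proof -
    obtain \<delta> where \<delta>: "\<delta> > 0" "\<And>x y. x \<in> ?K \<Longrightarrow> y \<in> ?K \<Longrightarrow> dist y x < \<delta> \<Longrightarrow> dist (g y) (g x) < \<epsilon>"
      using \<open>uniformly_continuous_on ?K g\<close> \<epsilon> unfolding uniformly_continuous_on_def by metis
    \<comment> \<open>The cap at \<open>1\<close> keeps the translated cell inside the compact box \<open>?K\<close>.\<close>
    define h where "h = min 1 (\<delta> / 2)"
    have h: "0 < h" "h \<le> 1" "h < \<delta>" using \<delta>(1) by (auto simp: h_def)
    have hp: "h \<le> 2 * pi" using h pi_ge_two by linarith
    have pt: "norm (G (x + h *\<^sub>R ?e) - G x - h *\<^sub>R g x) \<le> h * \<epsilon>" if x: "x \<in> torus_cell" for x
    proof -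
      have "norm (G (x + h *\<^sub>R ?e) - G (x + 0 *\<^sub>R ?e) - (h - 0) *\<^sub>R g (x + 0 *\<^sub>R ?e)) \<le> norm (h - 0) * \<epsilon>"
      proof (rule vector_differentiable_bound_linearization[where S = "{0..h}" and f = "\<lambda>s. G (x + s *\<^sub>R ?e)"
            and f' = "\<lambda>s. g (x + s *\<^sub>R ?e)"])
        show "((\<lambda>s. G (x + s *\<^sub>R ?e)) has_vector_derivative g (x + s *\<^sub>R ?e)) (at s within {0..h})" for s
          by (rule has_vector_derivative_at_within[OF d])
        show "closed_segment 0 h \<subseteq> {0..h}" using h by (simp add: closed_segment_eq_real_ivl)
        show "0 \<in> {0..h}" using h by simp
        show "norm (g (x + s *\<^sub>R ?e) - g (x + 0 *\<^sub>R ?e)) \<le> \<epsilon>" if s: "s \<in> {0..h}" for s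
        proof -
          have x0: "\<And>j. 0 \<le> x $ j" "\<And>j. x $ j \<le> 2 * pi"
            using x by (auto simp: torus_cell_def mem_box_cart)
          have "x + s *\<^sub>R ?e \<in> ?K" "x \<in> ?K"
            unfolding mem_box_cart using x0 s h by (auto simp: axis_def add_increasing2 add_mono)
          moreover have "dist (x + s *\<^sub>R ?e) x < \<delta>" using s h by (simp add: dist_norm)
          ultimately show ?thesis using \<delta>(2)[of x "x + s *\<^sub>R ?e"] by (simp add: dist_norm)
        qed
      qed
      then show ?thesis using h by simp
    qed
    have Gc: "continuous_on UNIV (\<lambda>x. G (x + h *\<^sub>R ?e))"
      by (rule continuous_on_compose2[OF G(1)]) (auto intro!: continuous_intros)
    have "norm (integral torus_cell (\<lambda>x. G (x + h *\<^sub>R ?e) - G x - h *\<^sub>R g x)) \<le> (h * \<epsilon>) * measure lborel torus_cell"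
      unfolding torus_cell_def
    proof (rule has_integral_bound[OF _ integrable_integral])
      show "(\<lambda>x. G (x + h *\<^sub>R ?e) - G x - h *\<^sub>R g x) integrable_on cbox 0 (\<chi> i. 2 * pi)"
        unfolding torus_cell_def[symmetric]
        by (rule torus_cell_integrable) (intro continuous_intros Gc G g)
    qed (use h \<epsilon> pt in \<open>auto simp: torus_cell_def\<close>)
    also have "integral torus_cell (\<lambda>x. G (x + h *\<^sub>R ?e) - G x - h *\<^sub>R g x) = - (h *\<^sub>R integral torus_cell g)"
      using integral_torus_cell_translate[OF G(1,2), of h] h hp torus_cell_integrable[OF Gc]
        torus_cell_integrable[OF G(1)] torus_cell_integrable[OF g]
      by (simp add: integral_diff integrable_diff integrable_cmul)
    finally show ?thesis using h by simp
  qed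
  have "norm (integral torus_cell g) \<le> 0"
  proof (rule field_le_epsilon)
    fix \<epsilon> :: real assume \<epsilon>: "\<epsilon> > 0"
    let ?c = "measure lborel torus_cell + 1"
    have c: "?c > 0" by (simp add: add_nonneg_pos)
    have "norm (integral torus_cell g) \<le> \<epsilon> / ?c * measure lborel torus_cell" using \<epsilon> c by (intro bound) auto
    also have "\<dots> \<le> \<epsilon>" using \<epsilon> c by (simp add: field_simps)
    finally show "norm (integral torus_cell g) \<le> 0 + \<epsilon>" by simp
  qed
  then show ?thesis by simp
qed

section \<open>Characters and uniqueness of Fourier coefficients\<close>

definition character :: "real^2 \<Rightarrow> real^2 \<Rightarrow> complex" where
  "character \<nu> x = cis (\<nu> \<bullet> x)"

lemma character_add: "character \<nu> (x + y) = character \<nu> x * character \<nu> y"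
  by (simp add: character_def inner_add_right cis_mult)

lemma character_mult: "character \<mu> x * character \<nu> x = character (\<mu> + \<nu>) x"
  by (simp add: character_def inner_add_left cis_mult)

lemma character_0: "character 0 x = 1"
  by (simp add: character_def)

lemma cnj_character: "cnj (character \<nu> x) = character (- \<nu>) x"
  by (simp add: character_def cis_cnj)

lemma continuous_on_character: "continuous_on S (character \<nu>)"
  unfolding character_def cis_conv_exp by (intro continuous_intros)

lemma int_lattice_inner:
  assumes "\<mu> \<in> int_lattice" "\<nu> \<in> int_lattice" shows "\<mu> \<bullet> \<nu> \<in> \<int>"
  using assms unfolding inner_vec_def int_lattice_def by (auto intro!: Ints_sum Ints_mult)

lemma int_lattice_closed:
  "0 \<in> int_lattice" "\<mu> \<in> int_lattice \<Longrightarrow> - \<mu> \<in> int_lattice"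
  "\<mu> \<in> int_lattice \<Longrightarrow> \<nu> \<in> int_lattice \<Longrightarrow> \<mu> + \<nu> \<in> int_lattice"
  by (auto simp: int_lattice_def)

lemma on_torus_character:
  assumes "\<nu> \<in> int_lattice" shows "on_torus (character \<nu>)"
  unfolding on_torus_def
proof (intro allI ballI)
  fix x \<mu> assume "\<mu> \<in> int_lattice"
  then have "\<nu> \<bullet> \<mu> \<in> \<int>" by (rule int_lattice_inner[OF assms])
  then obtain n where n: "\<nu> \<bullet> \<mu> = of_int n" by (elim Ints_cases)
  have "character \<nu> ((2 * pi) *\<^sub>R \<mu>) = 1"
    unfolding character_def using cis_multiple_2pi[of "of_int n"] by (simp add: n)
  then show "character \<nu> (x + (2 * pi) *\<^sub>R \<mu>) = character \<nu> x" by (simp add: character_add)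
qed

text \<open>
  A suitable translation by at most half a period multiplies a non-trivial character by \<open>-1\<close>.
\<close>

lemma integral_character:
  assumes "\<nu> \<in> int_lattice"
  shows "integral torus_cell (character \<nu>) = (if \<nu> = 0 then of_real (4 * pi\<^sup>2) else 0)"
proof (cases "\<nu> = 0")
  case True
  have "measure lborel torus_cell = 4 * pi\<^sup>2"
  proof -
    have "0 \<in> torus_cell" by (simp add: torus_cell_def mem_box_cart)
    then have "measure lborel torus_cell = (\<Prod>i\<in>(UNIV::2 set). 2 * pi)"
      unfolding torus_cell_def by (subst content_cbox_cart) auto
    then show ?thesis by (simp add: power_mult_distrib)
  qed
  moreover have "integral torus_cell (character \<nu>) = of_real (measure lborel torus_cell)"
    unfolding True character_0 torus_cell_def by (simp add: scaleR_conv_of_real)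
  ultimately show ?thesis using True by simp
next
  case False
  then obtain i where i: "\<nu> $ i \<noteq> 0" by (auto simp: vec_eq_iff)
  have "\<nu> $ i \<in> \<int>" using assms by (simp add: int_lattice_def)
  then have ge: "1 \<le> \<bar>\<nu> $ i\<bar>" using i by (rule Ints_nonzero_abs_ge1)
  \<comment> \<open>A nonzero integer coordinate has absolute value at least \<open>1\<close>, so this is at most half a period.\<close>
  define h where "h = pi / \<bar>\<nu> $ i\<bar>"
  have h: "0 \<le> h" "h \<le> 2 * pi"
    using ge pi_gt_zero unfolding h_def by (auto simp: divide_le_eq intro: order_trans[of _ "2*pi*1"])
  have "character \<nu> (h *\<^sub>R axis i 1) = -1"
  proof -
    have "\<nu> \<bullet> (h *\<^sub>R axis i 1) = pi \<or> \<nu> \<bullet> (h *\<^sub>R axis i 1) = - pi"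
      using i by (auto simp: h_def inner_axis abs_if)
    then show ?thesis unfolding character_def by (auto simp: complex_eq_iff)
  qed
  then have neg: "character \<nu> (x + h *\<^sub>R axis i 1) = - character \<nu> x" for x by (simp add: character_add)
  let ?I = "integral torus_cell (character \<nu>)"
  have "- ?I = ?I"
    using integral_torus_cell_translate[OF continuous_on_character
      on_torus_axis_periodic[OF on_torus_character[OF assms], of i] h] by (simp add: neg)
  then have "2 * ?I = 0" by (metis add.right_inverse mult_2)
  then show ?thesis using False by simp
qed

inductive trig_poly :: "(real^2 \<Rightarrow> complex) \<Rightarrow> bool" where
  trig_char: "\<nu> \<in> int_lattice \<Longrightarrow> trig_poly (\<lambda>x. c * character \<nu> x)"
| trig_add: "trig_poly f \<Longrightarrow> trig_poly g \<Longrightarrow> trig_poly (\<lambda>x. f x + g x)"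

lemma trig_poly_const: "trig_poly (\<lambda>x. c)"
  using trig_char[OF int_lattice_closed(1), of c] by (simp add: character_0)

lemma trig_poly_mult_character:
  assumes "trig_poly f" "\<nu> \<in> int_lattice" shows "trig_poly (\<lambda>x. f x * (c * character \<nu> x))"
  using assms(1)
proof induction
  case (trig_char \<mu> d)
  have "trig_poly (\<lambda>x. (d * c) * character (\<mu> + \<nu>) x)"
    by (intro trig_poly.trig_char int_lattice_closed trig_char assms)
  then show ?case by (simp add: character_mult[symmetric] mult_ac)
next
  case (trig_add f g)
  then show ?case using trig_poly.trig_add by (simp add: distrib_right)
qed

lemma trig_poly_mult:
  assumes "trig_poly f" "trig_poly g" shows "trig_poly (\<lambda>x. f x * g x)"
  using assms(2)
proof induction
  case (trig_char \<nu> c)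
  then show ?case using trig_poly_mult_character[OF assms(1)] by simp
next
  case (trig_add g h)
  then show ?case using trig_poly.trig_add by (simp add: distrib_left)
qed

lemma continuous_on_trig_poly: "trig_poly f \<Longrightarrow> continuous_on S f"
  by (induction rule: trig_poly.induct) (intro continuous_intros continuous_on_character; assumption?)+

text \<open>
  The torus as a compact subset of a Euclidean space, on which the Stone-Weierstrass theorem for polynomials
  applies. Polynomials in the real coordinates of this space pull back to trigonometric polynomials.
\<close>

definition torus_embedding :: "real^2 \<Rightarrow> complex \<times> complex" where
  "torus_embedding x = (cis (x $ 1), cis (x $ 2))"

lemma trig_poly_axis: "trig_poly (\<lambda>x. of_real (cos (x $ i)))" "trig_poly (\<lambda>x. of_real (sin (x $ i)))"
proof -
  have c: "character (axis i 1) x = cis (x $ i)" "character (- axis i 1) x = cis (- (x $ i))" for x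
    by (simp_all add: character_def inner_commute[of "axis i 1"] inner_axis)
  have l: "axis i 1 \<in> int_lattice" "- axis i 1 \<in> int_lattice"
    by (intro int_lattice_closed axis_in_int_lattice)+
  have "trig_poly (\<lambda>x. 1/2 * character (axis i 1) x + 1/2 * character (- axis i 1) x)"
    by (intro trig_add trig_char l)
  moreover have "1/2 * character (axis i 1) x + 1/2 * character (- axis i 1) x = of_real (cos (x $ i))" for x
    unfolding c by (simp add: complex_eq_iff)
  ultimately show "trig_poly (\<lambda>x. of_real (cos (x $ i)))" by simp
  have "trig_poly (\<lambda>x. - \<i>/2 * character (axis i 1) x + \<i>/2 * character (- axis i 1) x)"
    by (intro trig_add trig_char l)
  moreover have "- \<i>/2 * character (axis i 1) x + \<i>/2 * character (- axis i 1) x = of_real (sin (x $ i))" for x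
    unfolding c by (simp add: complex_eq_iff)
  ultimately show "trig_poly (\<lambda>x. of_real (sin (x $ i)))" by simp
qed

lemma trig_poly_real_polynomial:
  assumes "real_polynomial_function p"
  shows "trig_poly (\<lambda>x. of_real (p (torus_embedding x)))"
  using assms
proof induction
  case (linear f)
  then interpret bounded_linear f .
  have "f (torus_embedding x) = f (1,0) * cos (x$1) + f (\<i>,0) * sin (x$1) + f (0,1) * cos (x$2) + f (0,\<i>) * sin (x$2)" for x
  proof -
    have "torus_embedding x = cos (x$1) *\<^sub>R (1,0) + sin (x$1) *\<^sub>R (\<i>,0) + cos (x$2) *\<^sub>R (0,1) + sin (x$2) *\<^sub>R (0,\<i>)"
      by (simp add: torus_embedding_def complex_eq_iff)
    then show ?thesis by (simp only: add scaleR) (simp add: mult.commute)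
  qed
  then have "(\<lambda>x. complex_of_real (f (torus_embedding x))) = (\<lambda>x. of_real (f (1,0)) * of_real (cos (x$1)) + of_real (f (\<i>,0)) * of_real (sin (x$1))
     + of_real (f (0,1)) * of_real (cos (x$2)) + of_real (f (0,\<i>)) * of_real (sin (x$2)))"
    by simp
  then show ?case
    by (simp only:) (intro trig_add trig_poly_mult trig_poly_const trig_poly_axis)
next
  case (const c)
  show ?case by (rule trig_poly_const)
next
  case (add f g)
  then show ?case using trig_add by simp
next
  case (mult f g)
  then show ?case using trig_poly_mult by simp
qed

lemma torus_embedding_eq_imp:
  assumes "on_torus f" "torus_embedding x = torus_embedding y" shows "f x = f y"
proof -
  have "\<exists>n::int. x $ i = y $ i + 2 * pi * n" for i :: 2
  proof -
    have "cis (x $ i) = cis (y $ i)" using assms(2) exhaust_2[of i] by (auto simp: torus_embedding_def)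
    then show ?thesis unfolding sin_cos_eq_iff[symmetric] by (simp add: complex_eq_iff)
  qed
  then obtain n :: "2 \<Rightarrow> int" where n: "\<And>i. x $ i = y $ i + 2 * pi * n i" by metis
  define \<mu> :: "real^2" where "\<mu> = (\<chi> i. of_int (n i))"
  have "\<mu> \<in> int_lattice" by (simp add: \<mu>_def int_lattice_def)
  moreover have "x = y + (2 * pi) *\<^sub>R \<mu>" by (simp add: vec_eq_iff \<mu>_def n)
  ultimately show ?thesis using assms(1) unfolding on_torus_def by metis
qed

lemma torus_cell_representative: "\<exists>y\<in>torus_cell. torus_embedding y = torus_embedding x"
proof
  define y :: "real^2" where "y = (\<chi> i. x $ i - 2 * pi * of_int \<lfloor>x $ i / (2 * pi)\<rfloor>)"
  have "0 \<le> y $ i \<and> y $ i \<le> 2 * pi" for i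
  proof -
    have "of_int \<lfloor>x $ i / (2 * pi)\<rfloor> \<le> x $ i / (2 * pi)" "x $ i / (2 * pi) \<le> of_int \<lfloor>x $ i / (2 * pi)\<rfloor> + 1"
      by linarith+
    then have "of_int \<lfloor>x $ i / (2 * pi)\<rfloor> * (2 * pi) \<le> x $ i" "x $ i \<le> (of_int \<lfloor>x $ i / (2 * pi)\<rfloor> + 1) * (2 * pi)"
      by (simp_all only: pos_le_divide_eq pos_divide_le_eq pi_gt_zero mult_pos_pos zero_less_numeral)
    then show ?thesis by (simp add: y_def algebra_simps)
  qed
  then show "y \<in> torus_cell" by (simp add: torus_cell_def mem_box_cart)
  have "cis (y $ i) = cis (x $ i)" for i
  proof -
    have "sin (x $ i) = sin (y $ i) \<and> cos (x $ i) = cos (y $ i)"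
      unfolding sin_cos_eq_iff y_def by (intro exI[of _ "\<lfloor>x $ i / (2 * pi)\<rfloor>"]) simp
    then show ?thesis by (simp add: complex_eq_iff)
  qed
  then show "torus_embedding y = torus_embedding x" by (simp add: torus_embedding_def)
qed

text \<open>
  A continuous periodic function factors through the embedded torus, and the factor is continuous because a
  continuous map from a compact space onto a Hausdorff space is a quotient map.
\<close>

lemma torus_approx_trig_poly:
  fixes f :: "real^2 \<Rightarrow> real"
  assumes f: "continuous_on UNIV f" "on_torus f" and e: "e > 0"
  shows "\<exists>p. trig_poly (\<lambda>x. of_real (p x)) \<and> (\<forall>x\<in>torus_cell. \<bar>f x - p x\<bar> < e)"
proof -
  let ?q = torus_embedding
  define T where "T = ?q ` torus_cell"
  have qc: "continuous_on torus_cell ?q"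
    unfolding torus_embedding_def cis_conv_exp by (intro continuous_intros)
  have cc: "compact torus_cell" by (simp add: torus_cell_def)
  have T: "compact T" unfolding T_def by (intro compact_continuous_image qc cc)
  define g where "g y = f (inv_into torus_cell ?q y)" for y
  have gq: "g (?q x) = f x" if "x \<in> torus_cell" for x
    unfolding g_def using that by (intro torus_embedding_eq_imp[OF f(2)] f_inv_into_f) auto
  have "quotient_map (top_of_set torus_cell) (top_of_set T) ?q"
    using qc cc by (intro T1_Spaces.continuous_imp_quotient_map)
      (auto simp: T_def Hausdorff_space_subtopology compact_space_subtopology continuous_map_subtopology_eu)
  moreover have "continuous_map (top_of_set torus_cell) euclidean (g \<circ> ?q)"
    using continuous_on_subset[OF f(1)] gq by (auto cong: continuous_on_cong simp: o_def)
  ultimately have "continuous_map (top_of_set T) euclidean g"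
    by (simp only: continuous_compose_quotient_map_eq)
  then have gc: "continuous_on T g" by simp
  obtain p where p: "real_polynomial_function p" "\<And>y. y \<in> T \<Longrightarrow> \<bar>g y - p y\<bar> < e"
    using Stone_Weierstrass_real_polynomial_function[OF T gc e] by metis
  show ?thesis
  proof (intro exI[of _ "\<lambda>x. p (?q x)"] conjI ballI)
    show "trig_poly (\<lambda>x. of_real (p (?q x)))" by (rule trig_poly_real_polynomial[OF p(1)])
    show "\<bar>f x - p (?q x)\<bar> < e" if "x \<in> torus_cell" for x
      using p(2)[of "?q x"] gq[OF that] that by (auto simp: T_def)
  qed
qed

lemma integral_trig_poly_zero:
  fixes f :: "real^2 \<Rightarrow> real"
  assumes f: "continuous_on UNIV f"
    and z: "\<And>\<nu>. \<nu> \<in> int_lattice \<Longrightarrow> integral torus_cell (\<lambda>x. of_real (f x) * character \<nu> x) = 0"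
    and t: "trig_poly t"
  shows "integral torus_cell (\<lambda>x. of_real (f x) * t x) = 0"
  using t
proof induction
  case (trig_char \<nu> c)
  have "(\<lambda>x. of_real (f x) * (c * character \<nu> x)) = (\<lambda>x. c * (of_real (f x) * character \<nu> x))"
    by (simp add: mult_ac)
  then show ?case using z[OF trig_char] by simp
next
  case (trig_add u v)
  have "(\<lambda>x. of_real (f x) * u x) integrable_on torus_cell" "(\<lambda>x. of_real (f x) * v x) integrable_on torus_cell"
    by (intro torus_cell_integrable continuous_on_mult continuous_on_of_real f
        continuous_on_trig_poly trig_add)+
  then show ?case using trig_add by (simp add: distrib_left integral_add)
qed

text \<open>
  If \<open>p\<close> is a trigonometric polynomial within \<open>e\<close> of \<open>f\<close>, then \<open>\<integral> f\<^sup>2 = \<integral> f (f - p) \<le> e \<integral> |f|\<close>.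
\<close>

lemma torus_Fourier_uniqueness:
  fixes f :: "real^2 \<Rightarrow> real"
  assumes f: "continuous_on UNIV f" "on_torus f"
    and z: "\<And>\<nu>. \<nu> \<in> int_lattice \<Longrightarrow> integral torus_cell (\<lambda>x. of_real (f x) * character \<nu> x) = 0"
  shows "f x = 0"
proof -
  let ?J = "integral torus_cell (\<lambda>x. \<bar>f x\<bar>)"
  have fi: "(\<lambda>x. \<bar>f x\<bar>) integrable_on torus_cell" and f2i: "(\<lambda>x. (f x)\<^sup>2) integrable_on torus_cell"
    by (intro torus_cell_integrable continuous_intros f)+
  have J: "0 \<le> ?J" using fi by (intro integral_nonneg) auto
  have le: "integral torus_cell (\<lambda>x. (f x)\<^sup>2) \<le> e * ?J" if e: "e > 0" for e
  proof -
    obtain p where p: "trig_poly (\<lambda>x. of_real (p x))" "\<And>x. x \<in> torus_cell \<Longrightarrow> \<bar>f x - p x\<bar> < e"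
      using torus_approx_trig_poly[OF f e] by metis
    have "continuous_on UNIV (\<lambda>x. Re (of_real (p x)))"
      by (intro continuous_intros continuous_on_trig_poly p)
    then have pc: "continuous_on UNIV p" by simp
    have fpi: "(\<lambda>x. f x * p x) integrable_on torus_cell"
      by (intro torus_cell_integrable continuous_intros f pc)
    have "complex_of_real (integral torus_cell (\<lambda>x. f x * p x)) = integral torus_cell (\<lambda>x. of_real (f x * p x))"
      using has_integral_of_real[OF integrable_integral[OF fpi], where 'b = complex]
      by (simp add: integral_unique)
    also have "\<dots> = 0" using integral_trig_poly_zero[OF f(1) z p(1)] by simp
    finally have fp0: "integral torus_cell (\<lambda>x. f x * p x) = 0" by simp
    have "integral torus_cell (\<lambda>x. (f x)\<^sup>2) = integral torus_cell (\<lambda>x. (f x)\<^sup>2 - f x * p x)"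
      using fp0 by (simp add: integral_diff[OF f2i fpi])
    also have "\<dots> \<le> integral torus_cell (\<lambda>x. e * \<bar>f x\<bar>)"
    proof (intro integral_le integrable_diff f2i fpi integrable_on_mult_right fi)
      fix x assume "x \<in> torus_cell"
      then have "\<bar>f x\<bar> * \<bar>f x - p x\<bar> \<le> \<bar>f x\<bar> * e" using p(2) by (intro mult_left_mono) (auto intro: less_imp_le)
      then have "\<bar>f x * (f x - p x)\<bar> \<le> e * \<bar>f x\<bar>" by (simp add: abs_mult mult.commute)
      then show "(f x)\<^sup>2 - f x * p x \<le> e * \<bar>f x\<bar>" by (simp add: power2_eq_square right_diff_distrib)
    qed
    finally show ?thesis by simp
  qed
  have "integral torus_cell (\<lambda>x. (f x)\<^sup>2) \<le> 0"
  proof (rule field_le_epsilon)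
    fix e :: real assume e: "e > 0"
    have "integral torus_cell (\<lambda>x. (f x)\<^sup>2) \<le> e / (?J + 1) * ?J" using e J by (intro le) auto
    also have "\<dots> \<le> e" using e J by (simp add: field_simps)
    finally show "integral torus_cell (\<lambda>x. (f x)\<^sup>2) \<le> 0 + e" by simp
  qed
  moreover have "0 \<le> integral torus_cell (\<lambda>x. (f x)\<^sup>2)" using f2i by (intro integral_nonneg) auto
  ultimately have "integral torus_cell (\<lambda>x. (f x)\<^sup>2) = 0" by simp
  then have hi: "((\<lambda>x. (f x)\<^sup>2) has_integral 0) torus_cell" using f2i by (metis integrable_integral)
  have cell: "f y = 0" if "y \<in> torus_cell" for y
  proof -
    have "(f y)\<^sup>2 = 0"
    proof (rule has_integral_0_cbox_imp_0[OF _ _ hi[unfolded torus_cell_def]])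
      show "continuous_on (cbox 0 (\<chi> i. 2 * pi)) (\<lambda>x. (f x)\<^sup>2)"
        by (intro continuous_intros continuous_on_subset[OF f(1)]) auto
      have "((\<chi> i. pi) :: real^2) \<in> box 0 ((\<chi> i. 2 * pi) :: real^2)"
        by (simp add: mem_box_cart)
      then show "box 0 (\<chi> i. 2 * pi) \<noteq> ({} :: (real^2) set)" by blast
    qed (use that in \<open>auto simp: torus_cell_def\<close>)
    then show ?thesis by simp
  qed
  obtain y where "y \<in> torus_cell" "torus_embedding y = torus_embedding x"
    using torus_cell_representative by blast
  then show "f x = 0" using cell torus_embedding_eq_imp[OF f(2)] by metis
qed

section \<open>Fourier expansion of eigenfunctions\<close>

lemma has_vector_derivative_along_axis:
  assumes "f differentiable_on UNIV"
  shows "((\<lambda>s. f (x + s *\<^sub>R axis i 1)) has_vector_derivative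
     partial_deriv i f (x + s *\<^sub>R axis i 1)) (at s)"
proof -
  let ?y = "x + s *\<^sub>R axis i 1"
  have "f differentiable (at ?y)" using assms by (auto simp: differentiable_on_def)
  then have d: "(f has_derivative frechet_derivative f (at ?y)) (at ?y)"
    by (simp add: frechet_derivative_works)
  interpret bounded_linear "frechet_derivative f (at ?y)" by (rule has_derivative_bounded_linear[OF d])
  have "((\<lambda>s. x + s *\<^sub>R axis i 1) has_derivative (\<lambda>h. h *\<^sub>R axis i 1)) (at s)"
    by (auto intro!: derivative_eq_intros)
  from has_derivative_compose[OF this d] show ?thesis
    by (simp add: has_vector_derivative_def partial_deriv_def scaleR)
qed

lemma on_torus_partial_deriv:
  assumes f: "f differentiable_on UNIV" "on_torus f" shows "on_torus (partial_deriv i f)"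
  unfolding on_torus_def
proof (intro allI ballI)
  fix x \<mu> :: "real^2" assume \<mu>: "\<mu> \<in> int_lattice"
  let ?p = "(2 * pi) *\<^sub>R \<mu>"
  have "f differentiable (at (x + ?p))" using f by (auto simp: differentiable_on_def)
  then have d: "(f has_derivative frechet_derivative f (at (x + ?p))) (at (x + ?p))"
    by (simp add: frechet_derivative_works)
  have "((\<lambda>y. y + ?p) has_derivative (\<lambda>h. h)) (at x)"
    by (auto intro!: derivative_eq_intros)
  from has_derivative_compose[OF this d]
  have "((\<lambda>y. f (y + ?p)) has_derivative frechet_derivative f (at (x + ?p))) (at x)" .
  moreover have "(\<lambda>y. f (y + ?p)) = f" using f(2) \<mu> by (simp add: on_torus_def)
  ultimately have "(f has_derivative frechet_derivative f (at (x + ?p))) (at x)" by simp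
  then show "partial_deriv i f (x + ?p) = partial_deriv i f x"
    unfolding partial_deriv_def by (metis frechet_derivative_at)
qed

lemma character_derivative_along_axis:
  "((\<lambda>s. character \<nu> (x + s *\<^sub>R axis i 1)) has_vector_derivative
     \<i> * of_real (\<nu> $ i) * character \<nu> (x + s *\<^sub>R axis i 1)) (at s)"
proof -
  have e: "\<nu> \<bullet> (x + s *\<^sub>R axis i 1) = \<nu> \<bullet> x + s * \<nu> $ i" for s
    by (simp add: inner_add_right inner_axis)
  have "((\<lambda>s. \<nu> \<bullet> x + s * \<nu> $ i) has_real_derivative \<nu> $ i) (at s)"
    by (auto intro!: derivative_eq_intros)
  then have "((\<lambda>s. \<i> * of_real (\<nu> \<bullet> x + s * \<nu> $ i)) has_vector_derivative \<i> * of_real (\<nu> $ i)) (at s)"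
    by (intro has_vector_derivative_mult_right has_vector_derivative_of_real)
  from field_vector_diff_chain_at[OF this DERIV_exp] show ?thesis
    unfolding character_def e by (simp add: o_def cis_conv_exp)
qed

definition Fourier_coeff :: "(real^2 \<Rightarrow> real) \<Rightarrow> real^2 \<Rightarrow> complex" where
  "Fourier_coeff F \<nu> = integral torus_cell (\<lambda>x. of_real (F x) * character \<nu> x)"

text \<open>
  Green's identity in coordinates. With \<open>e\<close> the character of \<open>\<nu>\<close>, the function
  \<open>(\<partial>\<^sub>i F - i \<nu>\<^sub>i F) e\<close> has the \<open>i\<close>-th partial derivative \<open>(\<partial>\<^sub>i\<^sup>2 F + \<nu>\<^sub>i\<^sup>2 F) e\<close>, whose integral therefore vanishes. Summed over
  \<open>i\<close> this is \<open>(\<Delta> F + |\<nu>|\<^sup>2 F) e = (|\<nu>|\<^sup>2 - lam\<^sup>2) F e\<close>.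
\<close>

lemma eigenfunction_Fourier_support:
  assumes F: "torus_eigenfunction lam F" and \<nu>: "\<nu> \<in> int_lattice"
  shows "((norm \<nu>)\<^sup>2 - lam\<^sup>2) * Fourier_coeff F \<nu> = 0"
proof -
  have per: "on_torus F" and C1: "C1_fun F" and C1': "\<And>i. C1_fun (partial_deriv i F)"
    and eq: "\<And>x. - laplacian F x = lam\<^sup>2 * F x"
    using F by (auto simp: torus_eigenfunction_def C2_fun_def)
  have d0: "F differentiable_on UNIV" and d1: "\<And>i. partial_deriv i F differentiable_on UNIV"
    and c2: "\<And>i. continuous_on UNIV (partial_deriv i (partial_deriv i F))"
    using C1 C1' by (auto simp: C1_fun_def)
  have c0: "continuous_on UNIV F" and c1: "\<And>i. continuous_on UNIV (partial_deriv i F)"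
    using d0 d1 by (auto intro: differentiable_imp_continuous_on)
  define g where "g i x = (of_real (partial_deriv i (partial_deriv i F) x) + of_real ((\<nu> $ i)\<^sup>2 * F x)) * character \<nu> x"
    for i x
  have gc: "continuous_on UNIV (g i)" for i
    unfolding g_def by (intro continuous_intros c0 c2 continuous_on_character)
  have zero: "integral torus_cell (g i) = 0" for i
  proof (rule integral_torus_derivative_zero[OF _ _ gc])
    let ?G = "\<lambda>x. (of_real (partial_deriv i F x) - \<i> * of_real (\<nu> $ i) * of_real (F x)) * character \<nu> x"
    show "continuous_on UNIV ?G" by (intro continuous_intros c0 c1 continuous_on_character)
    show "axis_periodic i ?G"
      using on_torus_axis_periodic[OF per, of i] on_torus_axis_periodic[OF on_torus_partial_deriv[OF d0 per], of i]
        on_torus_axis_periodic[OF on_torus_character[OF \<nu>], of i]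
      unfolding axis_periodic_def by simp
    fix x :: "real^2" and s :: real
    let ?y = "x + s *\<^sub>R axis i 1"
    have a: "((\<lambda>s. of_real (partial_deriv i F (x + s *\<^sub>R axis i 1)) - \<i> * of_real (\<nu> $ i) * of_real (F (x + s *\<^sub>R axis i 1)))
       has_vector_derivative (of_real (partial_deriv i (partial_deriv i F) ?y)
          - \<i> * of_real (\<nu> $ i) * complex_of_real (partial_deriv i F ?y))) (at s)"
      by (intro has_vector_derivative_diff has_vector_derivative_mult_right has_vector_derivative_of_real)
         (simp_all add: has_real_derivative_iff_has_vector_derivative has_vector_derivative_along_axis d0 d1)
    from has_vector_derivative_mult[OF a character_derivative_along_axis[of \<nu> x i s]]
    show "((\<lambda>s. ?G (x + s *\<^sub>R axis i 1)) has_vector_derivative g i ?y) (at s)"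
    proof (rule has_vector_derivative_eq_rhs)
    qed (simp add: g_def algebra_simps power2_eq_square)
  qed
  have "(\<Sum>i\<in>UNIV. g i x) = of_real ((norm \<nu>)\<^sup>2 - lam\<^sup>2) * (of_real (F x) * character \<nu> x)" for x
  proof -
    have n: "(norm \<nu>)\<^sup>2 = (\<nu>$1)\<^sup>2 + (\<nu>$2)\<^sup>2"
      unfolding power2_norm_eq_inner by (simp add: inner_vec_def sum_2 power2_eq_square)
    have l: "partial_deriv 2 (partial_deriv 2 F) x
        = - (lam\<^sup>2 * F x) - partial_deriv 1 (partial_deriv 1 F) x"
      using eq[of x] by (simp add: laplacian_def sum_2)
    show ?thesis unfolding n sum_2 g_def l by (simp add: algebra_simps)
  qed
  then have "integral torus_cell (\<lambda>x. of_real ((norm \<nu>)\<^sup>2 - lam\<^sup>2) * (of_real (F x) * character \<nu> x))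
      = integral torus_cell (\<lambda>x. \<Sum>i\<in>UNIV. g i x)" by simp
  also have "\<dots> = (\<Sum>i\<in>UNIV. integral torus_cell (g i))"
    by (rule integral_sum) (auto intro: torus_cell_integrable gc)
  also have "\<dots> = 0" by (simp add: zero)
  finally show ?thesis unfolding Fourier_coeff_def by simp
qed

lemma cnj_Fourier_coeff: "cnj (Fourier_coeff F \<nu>) = Fourier_coeff F (- \<nu>)"
  unfolding Fourier_coeff_def integral_cnj by (simp add: cnj_character)

lemma minus_lattice_circle: "- \<mu> \<in> lattice_circle lam \<longleftrightarrow> \<mu> \<in> lattice_circle lam"
proof -
  have "- \<mu> \<in> lattice_circle lam" if "\<mu> \<in> lattice_circle lam" for \<mu>
    using that int_lattice_closed(2) by (auto simp: lattice_circle_def)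
  from this[of \<mu>] this[of "- \<mu>"] show ?thesis by auto
qed

text \<open>
  The difference of \<open>F\<close> and its Fourier sum has vanishing Fourier coefficients: on the
  circle by orthogonality, elsewhere because \<open>F\<close> has none. The norm identity follows by integrating
  \<open>F\<close> against its expansion, where real values give \<open>a (- \<mu>) = cnj (a \<mu>)\<close>.
\<close>

lemma eigenfunction_expansion:
  assumes lam: "lam > 0" and fin: "finite (lattice_circle lam)" and F: "torus_eigenfunction lam F"
  shows "\<exists>a. (\<forall>x. complex_of_real (F x) = (\<Sum>\<mu>\<in>lattice_circle lam. a \<mu> * character \<mu> x)) \<and>
     integral torus_cell (\<lambda>x. (F x)\<^sup>2) = 4 * pi\<^sup>2 * (\<Sum>\<mu>\<in>lattice_circle lam. (cmod (a \<mu>))\<^sup>2)"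
proof -
  let ?E = "lattice_circle lam"
  have EL: "\<mu> \<in> int_lattice" if "\<mu> \<in> ?E" for \<mu> using that by (simp add: lattice_circle_def)
  have per: "on_torus F" and Fc: "continuous_on UNIV F"
    using F by (auto simp: torus_eigenfunction_def C2_fun_def C1_fun_def intro: differentiable_imp_continuous_on)
  define a where "a \<mu> = Fourier_coeff F (- \<mu>) / of_real (4 * pi\<^sup>2)" for \<mu>
  define S where "S x = (\<Sum>\<mu>\<in>?E. a \<mu> * character \<mu> x)" for x
  have Sc: "continuous_on UNIV S" unfolding S_def by (intro continuous_intros continuous_on_character)
  have cnj_a: "cnj (a \<mu>) = a (- \<mu>)" for \<mu> by (simp add: a_def cnj_Fourier_coeff)
  have cnj_S: "cnj (S x) = S x" for x
  proof -
    have "cnj (S x) = (\<Sum>\<mu>\<in>?E. a (- \<mu>) * character (- \<mu>) x)"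
      unfolding S_def by (simp add: cnj_a cnj_character)
    also have "\<dots> = S x" unfolding S_def
      by (rule sum.reindex_bij_witness[of _ uminus uminus]) (auto simp: minus_lattice_circle)
    finally show ?thesis .
  qed
  have SR: "of_real (Re (S x)) = S x" for x
    using cnj_S[of x] by (simp add: complex_eq_iff)
  have fi: "(\<lambda>x. of_real (F x) * character \<nu> x) integrable_on torus_cell" for \<nu>
    by (intro torus_cell_integrable continuous_intros Fc continuous_on_character)
  define f where "f x = F x - Re (S x)" for x
  have "f x = 0" for x
  proof (rule torus_Fourier_uniqueness)
    show "continuous_on UNIV f" unfolding f_def by (intro continuous_intros Fc Sc)
    show "on_torus f"
      using per on_torus_character[OF EL] unfolding f_def S_def on_torus_def by simp
    fix \<nu> assume \<nu>: "\<nu> \<in> int_lattice"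
    have ci: "(\<lambda>x. a \<mu> * character (\<mu> + \<nu>) x) integrable_on torus_cell" for \<mu>
      by (intro torus_cell_integrable continuous_intros continuous_on_character)
    have "integral torus_cell (\<lambda>x. of_real (f x) * character \<nu> x)
      = integral torus_cell (\<lambda>x. of_real (F x) * character \<nu> x - (\<Sum>\<mu>\<in>?E. a \<mu> * character (\<mu> + \<nu>) x))"
      unfolding f_def of_real_diff SR left_diff_distrib
      unfolding S_def sum_distrib_right by (simp add: mult.assoc character_mult)
    also have "\<dots> = Fourier_coeff F \<nu> - (\<Sum>\<mu>\<in>?E. a \<mu> * integral torus_cell (character (\<mu> + \<nu>)))"
      using fi ci fin unfolding Fourier_coeff_def
      by (simp add: integral_diff integrable_sum integral_sum)
    also have "(\<Sum>\<mu>\<in>?E. a \<mu> * integral torus_cell (character (\<mu> + \<nu>)))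
       = (\<Sum>\<mu>\<in>?E. if \<mu> = - \<nu> then Fourier_coeff F \<nu> else 0)"
    proof (rule sum.cong[OF refl])
      fix \<mu> assume "\<mu> \<in> ?E"
      then have "\<mu> + \<nu> \<in> int_lattice" using EL \<nu> int_lattice_closed(3) by blast
      moreover have "\<mu> + \<nu> = 0 \<longleftrightarrow> \<mu> = - \<nu>" by (simp add: eq_neg_iff_add_eq_0)
      ultimately show "a \<mu> * integral torus_cell (character (\<mu> + \<nu>)) = (if \<mu> = - \<nu> then Fourier_coeff F \<nu> else 0)"
        by (auto simp: integral_character a_def)
    qed
    also have "\<dots> = (if - \<nu> \<in> ?E then Fourier_coeff F \<nu> else 0)" using fin by simp
    also have "\<dots> = Fourier_coeff F \<nu>"
    proof -
      have "Fourier_coeff F \<nu> = 0" if "- \<nu> \<notin> ?E"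
      proof -
        have "norm \<nu> \<noteq> lam" using that \<nu> minus_lattice_circle by (auto simp: lattice_circle_def)
        then have "(norm \<nu>)\<^sup>2 - lam\<^sup>2 \<noteq> 0" using lam by (simp add: power2_eq_iff_nonneg)
        then show ?thesis using eigenfunction_Fourier_support[OF F \<nu>] by (simp only: mult_eq_0_iff of_real_eq_0_iff simp_thms)
      qed
      then show ?thesis by auto
    qed
    finally show "integral torus_cell (\<lambda>x. of_real (f x) * character \<nu> x) = 0" by simp
  qed
  then have exp: "complex_of_real (F x) = S x" for x
    using SR[of x] unfolding f_def by (metis right_minus_eq)
  have F2i: "(\<lambda>x. (F x)\<^sup>2) integrable_on torus_cell" by (intro torus_cell_integrable continuous_intros Fc)
  have "complex_of_real (integral torus_cell (\<lambda>x. (F x)\<^sup>2)) = integral torus_cell (\<lambda>x. of_real ((F x)\<^sup>2))"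
    using has_integral_of_real[OF integrable_integral[OF F2i], where 'b = complex] by (simp add: integral_unique)
  also have "\<dots> = integral torus_cell (\<lambda>x. \<Sum>\<mu>\<in>?E. a \<mu> * (of_real (F x) * character \<mu> x))"
  proof -
    have "complex_of_real ((F x)\<^sup>2) = (\<Sum>\<mu>\<in>?E. a \<mu> * (of_real (F x) * character \<mu> x))" for x
    proof -
      have "complex_of_real ((F x)\<^sup>2) = of_real (F x) * S x" by (simp add: power2_eq_square exp[symmetric])
      then show ?thesis unfolding S_def by (simp add: sum_distrib_left mult_ac)
    qed
    then show ?thesis by simp
  qed
  also have "\<dots> = (\<Sum>\<mu>\<in>?E. a \<mu> * Fourier_coeff F \<mu>)"
    unfolding Fourier_coeff_def using fin fi by (subst integral_sum) (auto intro: integrable_on_mult_right)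
  also have "\<dots> = (\<Sum>\<mu>\<in>?E. of_real (4 * pi\<^sup>2 * (cmod (a \<mu>))\<^sup>2))"
  proof (rule sum.cong[OF refl])
    fix \<mu>
    have "Fourier_coeff F \<mu> = of_real (4 * pi\<^sup>2) * cnj (a \<mu>)" unfolding cnj_a by (simp add: a_def)
    then show "a \<mu> * Fourier_coeff F \<mu> = of_real (4 * pi\<^sup>2 * (cmod (a \<mu>))\<^sup>2)"
      using complex_norm_square[of "a \<mu>"] by (simp add: mult_ac)
  qed
  also have "\<dots> = of_real (4 * pi\<^sup>2 * (\<Sum>\<mu>\<in>?E. (cmod (a \<mu>))\<^sup>2))"
    by (simp add: sum_distrib_left)
  finally have "integral torus_cell (\<lambda>x. (F x)\<^sup>2) = 4 * pi\<^sup>2 * (\<Sum>\<mu>\<in>?E. (cmod (a \<mu>))\<^sup>2)"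
    by (simp only: of_real_eq_iff)
  with exp show ?thesis unfolding S_def by blast
qed

section \<open>The fourth moment along the curve\<close>

text \<open>
  The stationary phase estimate for long frequencies, and the trivial bound by the length of the curve for
  short ones.
\<close>

lemma curve_Fourier_kernel_bound:
  assumes arc: "arclength_param L \<gamma>"
    and curv: "\<forall>t\<in>{0..L}. curvature L \<gamma> t \<noteq> 0"
  shows "\<exists>C>0. \<forall>\<xi>. norm (integral {0..L} (\<lambda>t. character \<xi> (\<gamma> t))) \<le> C * decay_kernel \<xi>"
proof -
  have L: "0 < L" using arc by (simp add: arclength_param_def)
  have \<gamma>c: "continuous_on {0..L} \<gamma>"
    using smooth_curve_continuous[of L \<gamma> 0] arc by (simp add: arclength_param_def)
  obtain C where C: "C > 0" "\<And>\<xi>. norm \<xi> \<ge> 1 \<Longrightarrow> norm (integral {0..L} (\<lambda>t. cis (\<xi> \<bullet> \<gamma> t))) \<le> C / sqrt (norm \<xi>)"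
    using curve_Fourier_decay[OF arc curv] by blast
  show ?thesis
  proof (intro exI[of _ "max C L"] conjI allI)
    show "0 < max C L" using C by simp
    fix \<xi> :: "real^2"
    show "norm (integral {0..L} (\<lambda>t. character \<xi> (\<gamma> t))) \<le> max C L * decay_kernel \<xi>"
    proof (cases "norm \<xi> \<ge> 1")
      case True
      then have "norm (integral {0..L} (\<lambda>t. character \<xi> (\<gamma> t))) \<le> C / sqrt (norm \<xi>)"
        using C(2) unfolding character_def by blast
      also have "\<dots> = C * decay_kernel \<xi>" using True by (simp add: decay_kernel_def max_def)
      also have "\<dots> \<le> max C L * decay_kernel \<xi>" by (intro mult_right_mono decay_kernel_nonneg) simp
      finally show ?thesis .
    next
      case False
      have "norm (integral {0..L} (\<lambda>t. character \<xi> (\<gamma> t))) \<le> 1 * (L - 0)"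
      proof (rule integral_bound)
        show "continuous_on {0..L} (\<lambda>t. character \<xi> (\<gamma> t))"
          by (rule continuous_on_compose2[OF continuous_on_character[of UNIV] \<gamma>c]) simp
      qed (use L in \<open>auto simp: character_def\<close>)
      then show ?thesis using False by (simp add: decay_kernel_def max_def)
    qed
  qed
qed

lemma curve_fourth_moment_expansion:
  fixes F :: "real^2 \<Rightarrow> real" and a :: "real^2 \<Rightarrow> complex" and \<gamma> :: "real \<Rightarrow> real^2"
  assumes \<gamma>c: "continuous_on {0..L} \<gamma>" and fin: "finite E"
    and exp: "\<And>x. complex_of_real (F x) = (\<Sum>\<mu>\<in>E. a \<mu> * character \<mu> x)"
  shows "complex_of_real (integral {0..L} (\<lambda>t. \<bar>F (\<gamma> t)\<bar> ^ 4))
    = (\<Sum>x1\<in>E. \<Sum>x2\<in>E. \<Sum>x3\<in>E. \<Sum>x4\<in>E.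
        a x1 * a x2 * a x3 * a x4 * integral {0..L} (\<lambda>t. character (x1 + x2 + x3 + x4) (\<gamma> t)))"
proof -
  have cc: "continuous_on {0..L} (\<lambda>t. character \<xi> (\<gamma> t))" for \<xi>
    by (rule continuous_on_compose2[OF continuous_on_character[of UNIV] \<gamma>c]) simp
  have ii: "(\<lambda>t. c * character \<xi> (\<gamma> t)) integrable_on {0..L}" for \<xi> c
    by (intro integrable_continuous_real continuous_intros cc)
  have "continuous_on {0..L} (\<lambda>t. Re (\<Sum>\<mu>\<in>E. a \<mu> * character \<mu> (\<gamma> t)))"
    by (intro continuous_intros cc)
  then have Fc: "continuous_on {0..L} (\<lambda>t. F (\<gamma> t))" by (simp add: exp[symmetric])
  have Fi: "(\<lambda>t. \<bar>F (\<gamma> t)\<bar> ^ 4) integrable_on {0..L}"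
    by (intro integrable_continuous_real continuous_intros Fc)
  have pt: "complex_of_real (\<bar>F x\<bar> ^ 4) = (\<Sum>x1\<in>E. \<Sum>x2\<in>E. \<Sum>x3\<in>E. \<Sum>x4\<in>E.
        (a x1 * a x2 * a x3 * a x4) * character (x1 + x2 + x3 + x4) x)" for x
  proof -
    have "complex_of_real (\<bar>F x\<bar> ^ 4) = complex_of_real (F x) * complex_of_real (F x) * complex_of_real (F x) * complex_of_real (F x)"
    proof -
      have "\<bar>F x\<bar> ^ 4 = F x ^ 4" by simp
      then show ?thesis by (simp only: power4_eq_xxxx of_real_mult)
    qed
    also have "\<dots> = (\<Sum>x1\<in>E. \<Sum>x2\<in>E. \<Sum>x3\<in>E. \<Sum>x4\<in>E. (a x1 * character x1 x) * (a x2 * character x2 x)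
        * (a x3 * character x3 x) * (a x4 * character x4 x))"
      unfolding exp by (simp only: sum_distrib_left[symmetric] sum_distrib_right[symmetric])
    also have "\<dots> = (\<Sum>x1\<in>E. \<Sum>x2\<in>E. \<Sum>x3\<in>E. \<Sum>x4\<in>E.
        (a x1 * a x2 * a x3 * a x4) * character (x1 + x2 + x3 + x4) x)"
      by (simp add: character_mult[symmetric] mult_ac)
    finally show ?thesis .
  qed
  have "complex_of_real (integral {0..L} (\<lambda>t. \<bar>F (\<gamma> t)\<bar> ^ 4)) = integral {0..L} (\<lambda>t. of_real (\<bar>F (\<gamma> t)\<bar> ^ 4))"
    using has_integral_of_real[OF integrable_integral[OF Fi], where 'b = complex] by (simp add: integral_unique)
  also have "\<dots> = (\<Sum>x1\<in>E. \<Sum>x2\<in>E. \<Sum>x3\<in>E. \<Sum>x4\<in>E.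
        a x1 * a x2 * a x3 * a x4 * integral {0..L} (\<lambda>t. character (x1 + x2 + x3 + x4) (\<gamma> t)))"
    unfolding pt using fin ii by (simp add: integral_sum integrable_sum)
  finally show ?thesis .
qed

theorem theorem1p3:
  fixes L :: real and \<gamma> :: "real \<Rightarrow> real^2"
  assumes "arclength_param L \<gamma>"
    and "\<forall>t\<in>{0..L}. curvature L \<gamma> t \<noteq> 0"
  shows "\<exists>C>0. \<forall>lam>0. \<forall>F. torus_eigenfunction lam F \<longrightarrow>
    curve_L4_norm L \<gamma> F \<le> C * real (B_max lam) powr (1/4) * torus_L2_norm F"
proof -
  have \<gamma>c: "continuous_on {0..L} \<gamma>"
    using smooth_curve_continuous[of L \<gamma> 0] assms(1) by (simp add: arclength_param_def)
  obtain C1 where C1: "C1 > 0" "\<And>\<xi>. norm (integral {0..L} (\<lambda>t. character \<xi> (\<gamma> t))) \<le> C1 * decay_kernel \<xi>"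
    using curve_Fourier_kernel_bound[OF assms] by blast
  obtain C2 where C2: "C2 > 0" "\<And>lam A. lam > 0 \<Longrightarrow> lattice_circle lam \<noteq> {} \<Longrightarrow>
    (\<Sum>x1\<in>lattice_circle lam. \<Sum>x2\<in>lattice_circle lam. \<Sum>x3\<in>lattice_circle lam. \<Sum>x4\<in>lattice_circle lam.
       \<bar>A x1 * A x2 * A x3 * A x4\<bar> * decay_kernel (x1 + x2 + x3 + x4))
    \<le> C2 * real (B_max lam) * (\<Sum>x\<in>lattice_circle lam. (A x)\<^sup>2)\<^sup>2"
    using quadruple_sum_bound by blast
  define K where "K = C1 * C2 / (4 * pi\<^sup>2)\<^sup>2"
  have K: "K > 0" using C1 C2 by (simp add: K_def)
  show ?thesis
  proof (intro exI[of _ "K powr (1/4)"] conjI allI impI)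
    show "0 < K powr (1/4)" using K by simp
    fix lam :: real and F assume lam: "lam > 0" and F: "torus_eigenfunction lam F"
    define E where "E = lattice_circle lam"
    have fin: "finite E" unfolding E_def by (rule lattice_circle_finite[OF lam])
    obtain a where exp: "\<And>x. complex_of_real (F x) = (\<Sum>\<mu>\<in>E. a \<mu> * character \<mu> x)"
      and L2: "integral torus_cell (\<lambda>x. (F x)\<^sup>2) = 4 * pi\<^sup>2 * (\<Sum>\<mu>\<in>E. (cmod (a \<mu>))\<^sup>2)"
      using eigenfunction_expansion[OF lam _ F] fin unfolding E_def by blast
    have "E \<noteq> {}"
    proof
      assume "E = {}"
      then have "F = (\<lambda>x. 0)" using exp by auto
      then show False using F by (simp add: torus_eigenfunction_def)
    qed
    let ?I = "integral {0..L} (\<lambda>t. \<bar>F (\<gamma> t)\<bar> ^ 4)"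
    let ?Q = "integral torus_cell (\<lambda>x. (F x)\<^sup>2)"
    let ?B = "real (B_max lam)"
    have Q: "0 \<le> ?Q" unfolding L2 by (intro mult_nonneg_nonneg sum_nonneg) auto
    have "\<bar>?I\<bar> = norm (complex_of_real ?I)" by simp
    also have "\<dots> \<le> (\<Sum>x1\<in>E. \<Sum>x2\<in>E. \<Sum>x3\<in>E. \<Sum>x4\<in>E.
       norm (a x1 * a x2 * a x3 * a x4 * integral {0..L} (\<lambda>t. character (x1 + x2 + x3 + x4) (\<gamma> t))))"
      unfolding curve_fourth_moment_expansion[OF \<gamma>c fin exp]
      by (intro order_trans[OF norm_sum] sum_mono order_refl)
    also have "\<dots> \<le> (\<Sum>x1\<in>E. \<Sum>x2\<in>E. \<Sum>x3\<in>E. \<Sum>x4\<in>E.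
       C1 * (\<bar>cmod (a x1) * cmod (a x2) * cmod (a x3) * cmod (a x4)\<bar> * decay_kernel (x1 + x2 + x3 + x4)))"
    proof (intro sum_mono)
      fix x1 x2 x3 x4
      let ?p = "cmod (a x1) * cmod (a x2) * cmod (a x3) * cmod (a x4)"
      have "?p * norm (integral {0..L} (\<lambda>t. character (x1 + x2 + x3 + x4) (\<gamma> t)))
         \<le> ?p * (C1 * decay_kernel (x1 + x2 + x3 + x4))"
        by (intro mult_left_mono C1) simp
      then show "norm (a x1 * a x2 * a x3 * a x4 * integral {0..L} (\<lambda>t. character (x1 + x2 + x3 + x4) (\<gamma> t)))
        \<le> C1 * (\<bar>?p\<bar> * decay_kernel (x1 + x2 + x3 + x4))"
        by (simp add: norm_mult abs_mult mult_ac)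
    qed
    also have "\<dots> = C1 * (\<Sum>x1\<in>E. \<Sum>x2\<in>E. \<Sum>x3\<in>E. \<Sum>x4\<in>E.
       \<bar>cmod (a x1) * cmod (a x2) * cmod (a x3) * cmod (a x4)\<bar> * decay_kernel (x1 + x2 + x3 + x4))"
      by (simp only: sum_distrib_left)
    also have "\<dots> \<le> C1 * (C2 * ?B * (\<Sum>x\<in>E. (cmod (a x))\<^sup>2)\<^sup>2)"
      using C2(2)[OF lam, of "\<lambda>x. cmod (a x)"] \<open>E \<noteq> {}\<close> C1 unfolding E_def by (intro mult_left_mono) auto
    also have "\<dots> = K * ?B * ?Q\<^sup>2" unfolding L2 K_def by (simp add: power_mult_distrib)
    finally have I: "?I \<le> K * ?B * ?Q\<^sup>2" by linarith
    have I0: "0 \<le> ?I"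
    proof (cases "(\<lambda>t. \<bar>F (\<gamma> t)\<bar> ^ 4) integrable_on {0..L}")
      case True
      then show ?thesis by (rule integral_nonneg) simp
    qed (simp add: not_integrable_integral)
    have "curve_L4_norm L \<gamma> F \<le> (K * ?B * ?Q\<^sup>2) powr (1/4)"
      unfolding curve_L4_norm_def using I I0 by (intro powr_mono2) auto
    also have "\<dots> = K powr (1/4) * ?B powr (1/4) * (?Q\<^sup>2) powr (1/4)"
      using K by (simp add: powr_mult)
    also have "(?Q\<^sup>2) powr (1/4) = sqrt ?Q"
    proof (cases "?Q = 0")
      case False
      then have "?Q > 0" using Q by simp
      then have "(?Q\<^sup>2) powr (1/4) = (?Q powr 2) powr (1/4)" by simp
      also have "\<dots> = ?Q powr (1/2)" unfolding powr_powr by simp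
      also have "\<dots> = sqrt ?Q" using Q by (rule powr_half_sqrt)
      finally show ?thesis .
    qed simp
    also have "sqrt ?Q = torus_L2_norm F" by (simp add: torus_L2_norm_def)
    finally show "curve_L4_norm L \<gamma> F \<le> K powr (1/4) * ?B powr (1/4) * torus_L2_norm F" .
  qed
qed

end
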